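(* Let $n\ge3$. (a) If $P$ is a weighted oriented path of length $n$, then there exists a weighted oriented $n$-cycle $C$ such that $\beta_i(R/I(P))=\beta_i(R/I(C))$ for each $i\in\mathbb Z$. (b) If $C$ is a weighted oriented $n$-cycle such that $C$ has a block of cardinality $2$ or $n\le4$, then there exists a weighted oriented path $P$ of length $n$ such that $\beta_i(R/I(P))=\beta_i(R/I(C))$ for each $i\in\mathbb Z$. (c) For each $n\ge5$, there exists a weighted oriented $n$-cycle $C$ such that for any weighted oriented path $P$, we have $\beta_i(R/I(P))\ne\beta_i(R/I(C))$ for some $i\in\mathbb Z$.
   Context: A weighted oriented graph is a triple $\mathcal D=(V,E,\mathbf w)$ with $V$ a finite vertex set, $E$ a set of directed edges whose underlying undirected graph is simple, and $\mathbf w:V\to\mathbb N^+$. Its edge ideal is $I(\mathcal D)=(xy^{\mathbf w(y)}\mid(x,y)\in E)$, where $(x,y)$ is the edge oriented from $x$ to $y$, in the polynomial ring (denoted $R$ in each case) over a field $\Bbbk$ on the vertices of the graph. $\beta_i$ denotes total Betti numbers. A weighted oriented path of length $n$ has underlying graph a path with $n$ edges; a weighted oriented $n$-cycle has underlying graph a cycle on $n$ vertices (edge orientations arbitrary). Blocks of a cycle. Let $C$ be a weighted oriented cycle on $x_1,\dots,x_n$ and let $m_i$ be the generator of $I(C)$ corresponding to the edge between $x_i$ and $x_{i+1}$ (indices modulo $n$). $m_i$ is a blockend if $m_i\nmid\operatorname{lcm}(m_{i-1},m_{i+1})$. If there is exactly one blockend, the only block is the set $\{m_1,\dots,m_n\}$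 of all generators. If there are at least two blockends, a block is a set $\{m_i,m_{i+1},\dots,m_{i+k}\}$ ($k\ge1$) of generators of consecutive edges such that $m_i$ and $m_{i+k}$ are distinct blockends and no $m_j$ strictly between them is a blockend. If there are no blockends there are no blocks. *)

theory Defs
  imports
    "HOL-Library.Poly_Mapping"
    "HOL-Library.Infinite_Typeclass"
    "HOL-Algebra.Ideal"
    "Jordan_Normal_Form.Matrix"
begin

section \<open>Polynomials and monomials\<close>

text \<open>A monomial is represented by its exponent vector, so the product of monomials is \<open>+\<close>.\<close>

type_synonym 'v monomial = "'v \<Rightarrow>\<^sub>0 nat"
type_synonym ('v, 'k) polynomial = "'v monomial \<Rightarrow>\<^sub>0 'k"

definition mono_deg :: "'v monomial \<Rightarrow> nat" where
  "mono_deg t = (\<Sum>v\<in>Poly_Mapping.keys t. Poly_Mapping.lookup t v)"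

definition mono_dvd :: "'v monomial \<Rightarrow> 'v monomial \<Rightarrow> bool" where
  "mono_dvd s t \<longleftrightarrow> (\<exists>u. t = s + u)"

lift_definition mono_lcm :: "'v monomial \<Rightarrow> 'v monomial \<Rightarrow> 'v monomial"
  is "\<lambda>s t v. max (s v) (t v)"
proof -
  fix s t :: "'v \<Rightarrow> nat"
  assume "finite {v. s v \<noteq> 0}" "finite {v. t v \<noteq> 0}"
  then have "finite ({v. s v \<noteq> 0} \<union> {v. t v \<noteq> 0})" by simp
  then show "finite {v. max (s v) (t v) \<noteq> 0}"
    by (rule finite_subset[rotated]) (auto simp: max_def)
qed

definition mono_poly :: "'v monomial \<Rightarrow> ('v, 'k::field) polynomial" where
  "mono_poly t = Poly_Mapping.single t 1"

definition polys_over :: "'v set \<Rightarrow> ('v, 'k::field) polynomial set" where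
  "polys_over V = {p. \<forall>t\<in>Poly_Mapping.keys p. Poly_Mapping.keys t \<subseteq> V}"

definition poly_ring :: "'v set \<Rightarrow> ('v, 'k::field) polynomial ring" where
  "poly_ring V = \<lparr>carrier = polys_over V, monoid.mult = (*), one = 1, zero = 0, add = (+)\<rparr>"


section \<open>Total Betti numbers\<close>

definition free_mod :: "'v set \<Rightarrow> nat \<Rightarrow> ('v, 'k::field) polynomial vec set" where
  "free_mod V r = {u \<in> carrier_vec r. \<forall>j<r. u $ j \<in> polys_over V}"

text \<open>
  Write \<open>R = poly_ring V\<close> and let \<open>I\<close> be a proper homogeneous ideal of \<open>R\<close>.
  A minimal graded free resolution
  \<open>\<dots> \<longrightarrow> F 2 \<longrightarrow> F 1 \<longrightarrow> F 0 = R \<longrightarrow> R/I \<longrightarrow> 0\<close>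
  is given by the ranks \<open>b i\<close> of the free modules, the degrees \<open>a i j\<close> of their basis elements
  (that is, \<open>F i\<close> is the direct sum of the \<open>R(-a i j)\<close> for \<open>j < b i\<close>), and the matrices
  \<open>d i\<close> of the maps \<open>F (i+1) \<longrightarrow> F i\<close>.
  The entry of \<open>d i\<close> in row \<open>r\<close> and column \<open>c\<close> is homogeneous of degree \<open>a (i+1) c - a i r\<close>
  (zero if this number is negative).  Minimality says that the image of \<open>d i\<close> is contained in
  the product of \<open>F i\<close> with the ideal generated by the variables, that is, all matrix entries
  have constant coefficient \<open>0\<close>.
\<close>

definition minimal_free_resolution ::
    "'v set \<Rightarrow> ('v, 'k::field) polynomial set \<Rightarrow> (nat \<Rightarrow> nat) \<Rightarrow> (nat \<Rightarrow> nat \<Rightarrow> nat)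
      \<Rightarrow> (nat \<Rightarrow> ('v, 'k) polynomial mat) \<Rightarrow> bool" where
  "minimal_free_resolution V I b a d \<longleftrightarrow>
     b 0 = 1 \<and> a 0 0 = 0
   \<and> (\<forall>i. d i \<in> carrier_mat (b i) (b (Suc i)))
   \<and> (\<forall>i. \<forall>r<b i. \<forall>c<b (Suc i). d i $$ (r, c) \<in> polys_over V)
   \<and> (\<forall>i. \<forall>r<b i. \<forall>c<b (Suc i). \<forall>t\<in>Poly_Mapping.keys (d i $$ (r, c)). mono_deg t + a i r = a (Suc i) c)
   \<and> (\<forall>i. \<forall>r<b i. \<forall>c<b (Suc i). Poly_Mapping.lookup (d i $$ (r, c)) 0 = 0)
   \<and> {(d 0 *\<^sub>v u) $ 0 | u. u \<in> free_mod V (b 1)} = I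
   \<and> (\<forall>i. {u \<in> free_mod V (b (Suc i)). d i *\<^sub>v u = 0\<^sub>v (b i)}
          = (\<lambda>u. d (Suc i) *\<^sub>v u) ` free_mod V (b (Suc (Suc i))))"

text \<open>
  The ranks in a minimal graded free resolution of \<open>R/I\<close> do not depend on the resolution.
\<close>

definition betti :: "'v set \<Rightarrow> ('v, 'k::field) polynomial set \<Rightarrow> int \<Rightarrow> nat" where
  "betti V I i = (if i < 0 then 0
     else (THE r. \<exists>b a d. minimal_free_resolution V I b a d \<and> b (nat i) = r))"


section \<open>Weighted oriented graphs and their edge ideals\<close>

record 'v wo_digraph =
  verts :: "'v set"
  edges :: "('v \<times> 'v) set"
  weight :: "'v \<Rightarrow> nat"

definition weighted_oriented_graph :: "'v wo_digraph \<Rightarrow> bool" where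
  "weighted_oriented_graph D \<longleftrightarrow>
     finite (verts D) \<and> edges D \<subseteq> verts D \<times> verts D
   \<and> (\<forall>x y. (x, y) \<in> edges D \<longrightarrow> x \<noteq> y \<and> (y, x) \<notin> edges D)
   \<and> (\<forall>v\<in>verts D. weight D v \<ge> 1)"

definition underlying_edges :: "'v wo_digraph \<Rightarrow> 'v set set" where
  "underlying_edges D = {{x, y} | x y. (x, y) \<in> edges D}"

definition edge_mono :: "'v wo_digraph \<Rightarrow> 'v \<times> 'v \<Rightarrow> 'v monomial" where
  "edge_mono D = (\<lambda>(x, y). Poly_Mapping.single x 1 + Poly_Mapping.single y (weight D y))"

definition edge_ideal :: "'v wo_digraph \<Rightarrow> ('v, 'k::field) polynomial set" where
  "edge_ideal D = genideal (poly_ring (verts D)) ((\<lambda>e. mono_poly (edge_mono D e)) ` edges D)"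

text \<open>The total Betti numbers of \<open>R/I(D)\<close>; the type argument fixes the coefficient field.\<close>

definition graph_betti :: "'k::field itself \<Rightarrow> 'v wo_digraph \<Rightarrow> int \<Rightarrow> nat" where
  "graph_betti (_ :: 'k itself) D i =
     betti (verts D) (edge_ideal D :: ('v, 'k) polynomial set) i"


section \<open>Paths, cycles and blocks\<close>

definition wo_path :: "nat \<Rightarrow> 'v wo_digraph \<Rightarrow> bool" where
  "wo_path n P \<longleftrightarrow> weighted_oriented_graph P
   \<and> (\<exists>xs. distinct xs \<and> length xs = n + 1 \<and> verts P = set xs
        \<and> underlying_edges P = {{xs ! i, xs ! (i + 1)} | i. i < n})"

text \<open>The list \<open>xs\<close> enumerates the vertices \<open>x\<^sub>1, \<dots>, x\<^sub>n\<close> along the cycle, starting at index \<open>0\<close>.\<close>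

definition wo_cycle_on :: "'v list \<Rightarrow> 'v wo_digraph \<Rightarrow> bool" where
  "wo_cycle_on xs C \<longleftrightarrow> weighted_oriented_graph C
   \<and> length xs \<ge> 3 \<and> distinct xs \<and> verts C = set xs
   \<and> underlying_edges C = {{xs ! i, xs ! ((i + 1) mod length xs)} | i. i < length xs}"

definition wo_cycle :: "nat \<Rightarrow> 'v wo_digraph \<Rightarrow> bool" where
  "wo_cycle n C \<longleftrightarrow> (\<exists>xs. length xs = n \<and> wo_cycle_on xs C)"

text \<open>
  The generator of the edge between the vertices with indices \<open>i\<close> and \<open>i+1\<close>.  Here and below
  indices are arbitrary natural numbers read modulo the length of the cycle.
\<close>

definition cycle_gen :: "'v wo_digraph \<Rightarrow> 'v list \<Rightarrow> nat \<Rightarrow> 'v monomial" where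
  "cycle_gen C xs i =
     (let x = xs ! (i mod length xs); y = xs ! ((i + 1) mod length xs)
      in if (x, y) \<in> edges C then edge_mono C (x, y) else edge_mono C (y, x))"

text \<open>The predecessor of index \<open>i\<close> is written \<open>i + (n - 1)\<close> to avoid truncated subtraction.\<close>

definition blockend :: "'v wo_digraph \<Rightarrow> 'v list \<Rightarrow> nat \<Rightarrow> bool" where
  "blockend C xs i \<longleftrightarrow>
     \<not> mono_dvd (cycle_gen C xs i)
         (mono_lcm (cycle_gen C xs (i + (length xs - 1))) (cycle_gen C xs (i + 1)))"

text \<open>If there is no blockend, the second alternative yields the empty set of blocks.\<close>

definition blocks :: "'v wo_digraph \<Rightarrow> 'v list \<Rightarrow> 'v monomial set set" where
  "blocks C xs =
     (if card {i. i < length xs \<and> blockend C xs i} = 1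
      then {cycle_gen C xs ` {..<length xs}}
      else {cycle_gen C xs ` {i..i + k} | i k.
              k \<ge> 1 \<and> blockend C xs i \<and> blockend C xs (i + k)
              \<and> cycle_gen C xs i \<noteq> cycle_gen C xs (i + k)
              \<and> (\<forall>j. i < j \<and> j < i + k \<longrightarrow> \<not> blockend C xs j)})"

end

theory Submission
  imports Defs "Jordan_Normal_Form.Determinant"
begin

text \<open>
  The polynomial ring of a path with \<open>n\<close> edges has one variable more than that of an \<open>n\<close>-cycle, so
  the two quotients live over different rings.  They are compared through the divisibility
  pattern of their generators.  Let \<open>m\<^sub>0, \<dots>, m\<^sub>n\<^sub>-\<^sub>1\<close> be monomials and let \<open>\<C>\<close> be the family of the sets
  \<open>{j. m\<^sub>j divides t}\<close>, where \<open>t\<close> runs over all monomials; ordered by inclusion, \<open>\<C>\<close> is the lcm lattice.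
  A multigraded complex of free modules whose basis elements sit in degrees that are lcms of generators is
  the same thing as a sequence of scalar matrices together with a set of generators for every basis
  element.  Its component in degree \<open>t\<close> is spanned by the basis elements whose set is contained in
  \<open>{j. m\<^sub>j divides t}\<close>, so exactness is a condition on the members of \<open>\<C>\<close> alone.  Such scalar
  resolutions (\<open>set_resolution\<close>) exist for every \<open>\<C>\<close> that contains the empty set and the
  singletons (\<open>minimal_cover\<close>, \<open>partial_resolution_extends\<close>), and each of them yields a minimal
  free resolution of the quotient by the ideal (\<open>set_resolution_realizes\<close>).  As the ranks of a
  minimal free resolution are unique (\<open>mfr_rank_le\<close>), the Betti numbers depend on \<open>n\<close> and \<open>\<C>\<close> only.
  This is the theorem of Gasharov, Peeva and Welker on lcm lattices.

  For a path or a cycle with at least three edges, \<open>m\<^sub>j\<close> divides the lcm of a set of other generators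
  only if both neighbours of \<open>m\<^sub>j\<close> belong to the set and \<open>m\<^sub>j\<close> divides the lcm of these two.  Call \<open>j\<close> a
  bridge if the latter holds.  Thus \<open>\<C>\<close>, and with it the Betti numbers, are determined by \<open>n\<close> and the
  set of bridges (\<open>dividing_gens_family\<close>).  In a cycle the bridges are the edges that are not
  blockends.  In a path the first and the last edge are never bridges.  Orienting all edges in one
  direction and giving weights 1 and 2 to the vertices realises every set of bridges in a cycle, and every set
  that avoids the two end edges in a path.  This gives (a), and it gives (b) for a cycle
  with two consecutive blockends, which is cut open between the two; a block of cardinality 2
  consists of two consecutive blockends.  The remaining cycles with at most four edges have at least
  one bridge.  Their resolutions are written down: the ranks are \<open>1, 3, 2\<close> for three
  edges, \<open>1, 4, 4, 1\<close> for four edges with two adjacent bridges, and \<open>1, 4, 5, 2\<close> for four edges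
  that alternate between bridges and blockends.  Certain paths have the same ranks.

  For (c), the first Betti number is the number of edges.  If there are \<open>n \<ge> 5\<close> edges, the second one is the
  number of pairs of generators minus the number of bridges, since the two neighbours of a
  bridge give a redundant syzygy.  A cycle in which every edge is a bridge loses \<open>n\<close> pairs in this
  way, a path at most \<open>n - 2\<close>.
\<close>

section \<open>Polynomials and matrices over a set of variables\<close>

abbreviation lookup where "lookup \<equiv> Poly_Mapping.lookup"
abbreviation keys where "keys \<equiv> Poly_Mapping.keys"

lemma monomial_add_eq_0: "(s :: 'v monomial) + t = 0 \<longleftrightarrow> s = 0 \<and> t = 0"
  by (metis add_eq_0_iff_both_eq_0 lookup_add lookup_zero poly_mapping_eqI add_0)

text \<open>
  Taking constant coefficients is multiplicative because a sum of exponent vectors vanishes only if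
  both summands do.  It turns complexes over the polynomial ring into complexes over the field.
\<close>

lemma const_coeff_mult:
  "lookup (p * q :: ('v, 'k::field) polynomial) 0 = lookup p 0 * lookup q 0"
proof -
  have inner: "Sum_any (\<lambda>t. lookup q t when 0 = s + t) = (lookup q 0 when s = 0)" for s :: "'v monomial"
  proof -
    have "(\<lambda>t. lookup q t when 0 = s + t) = (\<lambda>t. (lookup q 0 when s = 0) when t = 0)"
    proof (rule ext)
      fix t
      have "0 = s + t \<longleftrightarrow> s = 0 \<and> t = 0" using monomial_add_eq_0[of s t] by (simp only: eq_commute[of 0])
      then show "(lookup q t when 0 = s + t) = ((lookup q 0 when s = 0) when t = 0)"
        by (simp only: when_def) simp
    qed
    then show ?thesis by (simp only: Sum_any_when_equal)
  qed
  show ?thesis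
    unfolding lookup_mult inner by (simp only: mult_when Sum_any_when_equal)
qed

lemma lookup_single_mult:
  "lookup (Poly_Mapping.single s a * p :: ('v, 'k::field) polynomial) t =
     (if mono_dvd s t then a * lookup p (t - s) else 0)"
proof -
  have "lookup (Poly_Mapping.single s a * p) t = a * Sum_any (\<lambda>u. lookup p u when t = s + u)"
    unfolding lookup_mult by (simp add: lookup_single when_mult)
  also have "(\<lambda>u. lookup p u when t = s + u) = (\<lambda>u. (lookup p (t - s) when mono_dvd s t) when u = t - s)"
    by (rule ext) (auto simp: when_def mono_dvd_def)
  finally show ?thesis by simp
qed

lemma polys_over_0 [simp]: "0 \<in> polys_over V"
  and polys_over_1 [simp]: "1 \<in> polys_over V"
  unfolding polys_over_def by auto

lemma polys_over_add: "p \<in> polys_over V \<Longrightarrow> q \<in> polys_over V \<Longrightarrow> p + q \<in> polys_over V"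
  unfolding polys_over_def using keys_add[of p q] by auto

lemma polys_over_minus: "p \<in> polys_over V \<Longrightarrow> q \<in> polys_over V \<Longrightarrow> p - q \<in> polys_over V"
  unfolding polys_over_def using keys_diff[of p q] by auto

lemma polys_over_mult:
  assumes "p \<in> polys_over V" "q \<in> polys_over V" shows "p * q \<in> polys_over V"
  unfolding polys_over_def
proof (intro CollectI ballI)
  fix t assume "t \<in> keys (p * q)"
  then obtain s u where "t = s + u" "s \<in> keys p" "u \<in> keys q"
    using keys_mult[of p q] by blast
  then show "keys t \<subseteq> V"
    using assms keys_add[of s u] unfolding polys_over_def by blast
qed

lemma polys_over_sum: "(\<And>x. x \<in> X \<Longrightarrow> f x \<in> polys_over V) \<Longrightarrow> sum f X \<in> polys_over V"
  by (induction X rule: infinite_finite_induct) (auto intro: polys_over_add)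

text \<open>
  The type of polynomials has a variable for each element of the type of vertices; this set collects the
  matrices that only involve the variables in \<open>V\<close>.
\<close>

definition mats_over :: "'v set \<Rightarrow> nat \<Rightarrow> nat \<Rightarrow> ('v, 'k::field) polynomial mat set" where
  "mats_over V m n = {M \<in> carrier_mat m n. \<forall>i<m. \<forall>j<n. M $$ (i, j) \<in> polys_over V}"

lemma mats_over_carrier: "M \<in> mats_over V m n \<Longrightarrow> M \<in> carrier_mat m n"
  unfolding mats_over_def by simp

lemma mats_over_mult:
  assumes "M \<in> mats_over V l m" "N \<in> mats_over V m n" shows "M * N \<in> mats_over V l n"
  using assms unfolding mats_over_def
  by (auto simp: scalar_prod_def intro!: polys_over_sum polys_over_mult)

lemma mats_over_minus:
  assumes "M \<in> mats_over V m n" "N \<in> mats_over V m n" shows "M - N \<in> mats_over V m n"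
  using assms unfolding mats_over_def by (auto intro!: polys_over_minus)

lemma mats_over_one: "1\<^sub>m n \<in> mats_over V n n"
  unfolding mats_over_def by (auto simp: one_mat_def)

lemma mats_over_zero: "0\<^sub>m m n \<in> mats_over V m n"
  unfolding mats_over_def by auto

section \<open>Uniqueness of the ranks of a minimal free resolution\<close>

lemma minimal_free_resolutionD:
  assumes "minimal_free_resolution V I b a d"
  shows mfr_rank_0: "b 0 = 1"
    and mfr_d: "d i \<in> mats_over V (b i) (b (Suc i))"
    and mfr_const: "r < b i \<Longrightarrow> s < b (Suc i) \<Longrightarrow> lookup (d i $$ (r, s)) 0 = 0"
    and mfr_ideal: "{(d 0 *\<^sub>v u) $ 0 | u. u \<in> free_mod V (b 1)} = I"
    and mfr_exact: "{u \<in> free_mod V (b (Suc i)). d i *\<^sub>v u = 0\<^sub>v (b i)}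
          = (\<lambda>u. d (Suc i) *\<^sub>v u) ` free_mod V (b (Suc (Suc i)))"
proof -
  note def = assms[unfolded minimal_free_resolution_def]
  show "b 0 = 1" using def by (elim conjE) assumption
  have "\<forall>i. d i \<in> carrier_mat (b i) (b (Suc i))" using def by (elim conjE) assumption
  moreover have "\<forall>i. \<forall>r<b i. \<forall>c<b (Suc i). d i $$ (r, c) \<in> polys_over V" using def by (elim conjE) assumption
  ultimately show "d i \<in> mats_over V (b i) (b (Suc i))" unfolding mats_over_def by simp
  have "\<forall>i. \<forall>r<b i. \<forall>c<b (Suc i). lookup (d i $$ (r, c)) 0 = 0" using def by (elim conjE) assumption
  then show "r < b i \<Longrightarrow> s < b (Suc i) \<Longrightarrow> lookup (d i $$ (r, s)) 0 = 0" by simp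
  show "{(d 0 *\<^sub>v u) $ 0 | u. u \<in> free_mod V (b 1)} = I" using def by (elim conjE) assumption
  have "\<forall>i. {u \<in> free_mod V (b (Suc i)). d i *\<^sub>v u = 0\<^sub>v (b i)}
          = (\<lambda>u. d (Suc i) *\<^sub>v u) ` free_mod V (b (Suc (Suc i)))" using def by (elim conjE) assumption
  then show "{u \<in> free_mod V (b (Suc i)). d i *\<^sub>v u = 0\<^sub>v (b i)}
          = (\<lambda>u. d (Suc i) *\<^sub>v u) ` free_mod V (b (Suc (Suc i)))" by (rule spec)
qed

lemma col_mats_over: "M \<in> mats_over V m n \<Longrightarrow> j < n \<Longrightarrow> col M j \<in> free_mod V m"
  unfolding mats_over_def free_mod_def by auto

lemma mat_eq_via_cols:
  assumes "M \<in> carrier_mat m n" "N \<in> carrier_mat m n" "\<And>j. j < n \<Longrightarrow> col M j = col N j"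
  shows "M = N"
  using assms by (intro mat_col_eqI) auto

text \<open>
  Free modules are projective: a map into the image of \<open>D\<close> factors through \<open>D\<close>, column by column.
\<close>

lemma lift_columns:
  assumes D: "D \<in> mats_over V m n" and M: "M \<in> mats_over V m l"
    and ex: "\<And>j. j < l \<Longrightarrow> \<exists>w\<in>free_mod V n. D *\<^sub>v w = col M j"
  obtains N where "N \<in> mats_over V n l" "D * N = M"
proof -
  obtain w where w: "\<And>j. j < l \<Longrightarrow> w j \<in> free_mod V n" "\<And>j. j < l \<Longrightarrow> D *\<^sub>v w j = col M j"
    using ex by metis
  define N where "N = mat n l (\<lambda>(i, j). w j $ i)"
  have colN: "col N j = w j" if "j < l" for j
    using w(1)[OF that] that unfolding N_def free_mod_def by auto
  have N: "N \<in> mats_over V n l"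
    using w(1) unfolding N_def mats_over_def free_mod_def by auto
  have "D * N = M"
  proof (rule mat_eq_via_cols)
    show "D * N \<in> carrier_mat m l" "M \<in> carrier_mat m l"
      using mats_over_carrier[OF D] mats_over_carrier[OF N] mats_over_carrier[OF M] by auto
    show "col (D * N) j = col M j" if "j < l" for j
      using w(2)[OF that] colN[OF that] col_mult2[OF mats_over_carrier[OF D] mats_over_carrier[OF N] that] by simp
  qed
  with N show thesis by (rule that)
qed

lemma mfr_lift:
  assumes res: "minimal_free_resolution V I b a d"
    and M: "M \<in> mats_over V (b (Suc i)) l" and zero: "d i * M = 0\<^sub>m (b i) l"
  obtains N where "N \<in> mats_over V (b (Suc (Suc i))) l" "d (Suc i) * N = M"
proof (rule lift_columns[OF mfr_d[OF res, of "Suc i"] M])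
  fix j assume j: "j < l"
  have "d i *\<^sub>v col M j = col (d i * M) j"
    using col_mult2[OF mats_over_carrier[OF mfr_d[OF res, of i]] mats_over_carrier[OF M] j] by simp
  also have "\<dots> = 0\<^sub>v (b i)" using zero j by simp
  finally have "col M j \<in> {u \<in> free_mod V (b (Suc i)). d i *\<^sub>v u = 0\<^sub>v (b i)}"
    using col_mats_over[OF M j] by simp
  also have "\<dots> = (\<lambda>u. d (Suc i) *\<^sub>v u) ` free_mod V (b (Suc (Suc i)))"
    by (rule mfr_exact[OF res])
  finally show "\<exists>w\<in>free_mod V (b (Suc (Suc i))). d (Suc i) *\<^sub>v w = col M j" by auto
qed (use that in blast)

lemma mfr_complex:
  assumes res: "minimal_free_resolution V I b a d"
  shows "d i * d (Suc i) = 0\<^sub>m (b i) (b (Suc (Suc i)))"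
proof (rule mat_eq_via_cols)
  note D = mats_over_carrier[OF mfr_d[OF res]]
  show "d i * d (Suc i) \<in> carrier_mat (b i) (b (Suc (Suc i)))" using D[of i] D[of "Suc i"] by auto
  fix j assume j: "j < b (Suc (Suc i))"
  have u: "unit_vec (b (Suc (Suc i))) j \<in> free_mod V (b (Suc (Suc i)))"
    unfolding free_mod_def by (auto simp: unit_vec_def)
  have "d (Suc i) *\<^sub>v unit_vec (b (Suc (Suc i))) j \<in> (\<lambda>u. d (Suc i) *\<^sub>v u) ` free_mod V (b (Suc (Suc i)))"
    using u by blast
  also have "\<dots> = {u \<in> free_mod V (b (Suc i)). d i *\<^sub>v u = 0\<^sub>v (b i)}"
    by (rule mfr_exact[OF res, symmetric])
  finally have "d i *\<^sub>v (d (Suc i) *\<^sub>v unit_vec (b (Suc (Suc i))) j) = 0\<^sub>v (b i)" by simp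
  moreover have "d (Suc i) *\<^sub>v unit_vec (b (Suc (Suc i))) j = col (d (Suc i)) j"
    using D[of "Suc i"] j by (auto intro!: eq_vecI)
  ultimately have "d i *\<^sub>v col (d (Suc i)) j = 0\<^sub>v (b i)" by simp
  then show "col (d i * d (Suc i)) j = col (0\<^sub>m (b i) (b (Suc (Suc i)))) j"
    using col_mult2[OF D D j] j by simp
qed simp

text \<open>
  The comparison map between two resolutions of the same quotient, built one degree at a time:
  \<open>Y\<close> exists in degree \<open>i + 1\<close> because \<open>X * d i\<close> has its columns in the image of \<open>d' i\<close>.
\<close>

lemma mfr_chain_map:
  assumes res: "minimal_free_resolution V I b a d" and res': "minimal_free_resolution V I b' a' d'"
  obtains X where "\<And>i. X i \<in> mats_over V (b' i) (b i)" "X 0 = 1\<^sub>m 1"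
    "\<And>i. X i * d i = d' i * X (Suc i)"
proof -
  note D = mats_over_carrier[OF mfr_d[OF res]] and D' = mats_over_carrier[OF mfr_d[OF res']]
  have b0: "b 0 = 1" "b' 0 = 1" by (rule mfr_rank_0[OF res], rule mfr_rank_0[OF res'])
  define P where "P i X \<longleftrightarrow> X \<in> mats_over V (b' i) (b i) \<and> (i = 0 \<longrightarrow> X = 1\<^sub>m 1)
      \<and> (\<exists>Y\<in>mats_over V (b' (Suc i)) (b (Suc i)). X * d i = d' i * Y)" for i X
  have "\<exists>f. \<forall>i. P i (f i) \<and> f i * d i = d' i * f (Suc i)"
  proof (rule dependent_nat_choice)
    have d0: "\<exists>w\<in>free_mod V (b' 1). d' 0 *\<^sub>v w = col (d 0) j" if j: "j < b 1" for j
    proof -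
      have "unit_vec (b 1) j \<in> free_mod V (b 1)" unfolding free_mod_def by (auto simp: unit_vec_def)
      then have "(d 0 *\<^sub>v unit_vec (b 1) j) $ 0 \<in> {(d 0 *\<^sub>v u) $ 0 | u. u \<in> free_mod V (b 1)}" by blast
      also have "\<dots> = {(d' 0 *\<^sub>v u) $ 0 | u. u \<in> free_mod V (b' 1)}"
        unfolding mfr_ideal[OF res] mfr_ideal[OF res'] ..
      finally obtain w where w: "w \<in> free_mod V (b' 1)" "(d 0 *\<^sub>v unit_vec (b 1) j) $ 0 = (d' 0 *\<^sub>v w) $ 0" by blast
      moreover have "d 0 *\<^sub>v unit_vec (b 1) j = col (d 0) j"
        using D[of 0] j by (auto intro!: eq_vecI)
      ultimately have "(d' 0 *\<^sub>v w) $ 0 = col (d 0) j $ 0" by (simp only:)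
      then have "d' 0 *\<^sub>v w = col (d 0) j"
        using D[of 0] D'[of 0] b0 by (intro eq_vecI) (auto simp del: index_mult_mat_vec)
      then show ?thesis using w(1) by blast
    qed
    have "d 0 \<in> mats_over V (b' 0) (b 1)" using mfr_d[OF res, of 0] b0 by simp
    then obtain Y where "Y \<in> mats_over V (b' 1) (b 1)" "d' 0 * Y = d 0"
      using lift_columns[OF mfr_d[OF res', of 0], of "d 0" "b 1"] d0 by auto
    then have "P 0 (1\<^sub>m 1)"
      unfolding P_def using mats_over_one[of 1 V] b0 D[of 0] by (auto intro!: bexI[of _ Y])
    then show "\<exists>X. P 0 X" by blast
    fix X i assume X: "P i X"
    then obtain Y where Xm: "X \<in> mats_over V (b' i) (b i)" and Y: "Y \<in> mats_over V (b' (Suc i)) (b (Suc i))"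
      and XY: "X * d i = d' i * Y" unfolding P_def by blast
    note Xc = mats_over_carrier[OF Xm] and Yc = mats_over_carrier[OF Y]
    have "d' i * (Y * d (Suc i)) = X * d i * d (Suc i)"
      unfolding XY by (rule assoc_mult_mat[symmetric, OF D' Yc D])
    also have "\<dots> = X * (d i * d (Suc i))" by (rule assoc_mult_mat[OF Xc D D])
    also have "\<dots> = 0\<^sub>m (b' i) (b (Suc (Suc i)))" unfolding mfr_complex[OF res] using Xc by simp
    finally obtain Z where "Z \<in> mats_over V (b' (Suc (Suc i))) (b (Suc (Suc i)))" "d' (Suc i) * Z = Y * d (Suc i)"
      using mfr_lift[where i = i, OF res' mats_over_mult[OF Y mfr_d[OF res, of "Suc i"]]] by metis
    then have "P (Suc i) Y" unfolding P_def using Y by (auto intro!: bexI[of _ Z])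
    then show "\<exists>Y. P (Suc i) Y \<and> X * d i = d' i * Y" using XY by blast
  qed
  then obtain f where "\<And>i. P i (f i)" "\<And>i. f i * d i = d' i * f (Suc i)" by blast
  then show thesis using that[of f] unfolding P_def by blast
qed

text \<open>
  A chain endomorphism over the identity of \<open>R\<close> is homotopic to the identity.  The homotopy \<open>H\<close> is built by
  lifting: the part of \<open>X - 1\<close> that the homotopy in lower degree does not explain consists of cycles.
\<close>

lemma mfr_homotopy:
  assumes res: "minimal_free_resolution V I b a d"
    and X: "\<And>i. X i \<in> mats_over V (b i) (b i)" "X 0 = 1\<^sub>m 1" "\<And>i. X i * d i = d i * X (Suc i)"
  obtains H where "\<And>i. H i \<in> mats_over V (b (Suc i)) (b i)"
    "\<And>i. X (Suc i) - 1\<^sub>m (b (Suc i)) - H i * d i = d (Suc i) * H (Suc i)"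
proof -
  note D = mats_over_carrier[OF mfr_d[OF res]] and Xc = mats_over_carrier[OF X(1)]
  define E where "E i h = X (Suc i) - 1\<^sub>m (b (Suc i)) - h * d i" for i h
  define P where "P i h \<longleftrightarrow> h \<in> mats_over V (b (Suc i)) (b i) \<and> d i * E i h = 0\<^sub>m (b i) (b (Suc i))" for i h
  have E: "E i h \<in> mats_over V (b (Suc i)) (b (Suc i))" if "h \<in> mats_over V (b (Suc i)) (b i)" for i h
    unfolding E_def by (intro mats_over_minus X mats_over_one mats_over_mult[OF that mfr_d[OF res]])
  have "\<exists>f. \<forall>i. P i (f i) \<and> E i (f i) = d (Suc i) * f (Suc i)"
  proof (rule dependent_nat_choice)
    have b0: "b 0 = 1" by (rule mfr_rank_0[OF res])
    have "d 0 * E 0 (0\<^sub>m (b 1) (b 0)) = d 0 * (X 1 - 1\<^sub>m (b 1))"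
    proof -
      have "X 1 - 1\<^sub>m (b 1) - 0\<^sub>m (b 1) (b 1) = X 1 - 1\<^sub>m (b 1)"
        using Xc[of 1] by (intro eq_matI) auto
      then show ?thesis unfolding E_def using D[of 0] by simp
    qed
    also have "\<dots> = d 0 * X 1 - d 0 * 1\<^sub>m (b 1)"
      using mult_minus_distrib_mat[OF D[of 0] Xc[of "Suc 0"], of "1\<^sub>m (b 1)"] by simp
    also have "\<dots> = 0\<^sub>m (b 0) (b 1)"
      using X(3)[of 0] X(2) D[of 0] b0 by auto
    finally have "P 0 (0\<^sub>m (b 1) (b 0))" unfolding P_def using mats_over_zero by auto
    then show "\<exists>h. P 0 h" by blast
    fix h i assume h: "P i h"
    then have hm: "h \<in> mats_over V (b (Suc i)) (b i)" unfolding P_def by simp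
    note hc = mats_over_carrier[OF hm]
    obtain h' where h': "h' \<in> mats_over V (b (Suc (Suc i))) (b (Suc i))" "d (Suc i) * h' = E i h"
      using mfr_lift[OF res E[OF hm]] h unfolding P_def by metis
    note h'c = mats_over_carrier[OF h'(1)]
    have c1: "X (Suc (Suc i)) - 1\<^sub>m (b (Suc (Suc i))) \<in> carrier_mat (b (Suc (Suc i))) (b (Suc (Suc i)))"
      by (rule mats_over_carrier[OF mats_over_minus[OF X(1) mats_over_one]])
    have c2: "X (Suc i) - 1\<^sub>m (b (Suc i)) \<in> carrier_mat (b (Suc i)) (b (Suc i))"
      by (rule mats_over_carrier[OF mats_over_minus[OF X(1) mats_over_one]])
    have c3: "h' * d (Suc i) \<in> carrier_mat (b (Suc (Suc i))) (b (Suc (Suc i)))" using h'c D by simp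
    have c4: "h * d i \<in> carrier_mat (b (Suc i)) (b (Suc i))" using hc D by simp
    have "d (Suc i) * E (Suc i) h' = d (Suc i) * (X (Suc (Suc i)) - 1\<^sub>m (b (Suc (Suc i)))) - d (Suc i) * (h' * d (Suc i))"
      unfolding E_def by (rule mult_minus_distrib_mat[OF D c1 c3])
    also have "d (Suc i) * (X (Suc (Suc i)) - 1\<^sub>m (b (Suc (Suc i)))) = d (Suc i) * X (Suc (Suc i)) - d (Suc i) * 1\<^sub>m (b (Suc (Suc i)))"
      by (rule mult_minus_distrib_mat[OF D Xc]) simp
    also have "\<dots> = X (Suc i) * d (Suc i) - 1\<^sub>m (b (Suc i)) * d (Suc i)"
      unfolding X(3) using D[of "Suc i"] by simp
    also have "\<dots> = (X (Suc i) - 1\<^sub>m (b (Suc i))) * d (Suc i)"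
      by (rule minus_mult_distrib_mat[symmetric, OF Xc _ D]) simp
    also have "d (Suc i) * (h' * d (Suc i)) = E i h * d (Suc i)"
      unfolding h'(2)[symmetric] by (rule assoc_mult_mat[symmetric, OF D h'c D])
    also have "\<dots> = (X (Suc i) - 1\<^sub>m (b (Suc i))) * d (Suc i) - h * d i * d (Suc i)"
      unfolding E_def by (rule minus_mult_distrib_mat[OF c2 c4 D])
    also have "h * d i * d (Suc i) = h * (d i * d (Suc i))" by (rule assoc_mult_mat[OF hc D D])
    also have "\<dots> = 0\<^sub>m (b (Suc i)) (b (Suc (Suc i)))" unfolding mfr_complex[OF res] using hc by simp
    finally have "d (Suc i) * E (Suc i) h' = 0\<^sub>m (b (Suc i)) (b (Suc (Suc i)))"
      using Xc[of "Suc i"] D[of "Suc i"] by (auto intro!: eq_matI)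
    then have "P (Suc i) h'" unfolding P_def using h'(1) by simp
    then show "\<exists>h'. P (Suc i) h' \<and> E i h = d (Suc i) * h'" using h'(2) by auto
  qed
  then obtain H where "\<And>i. P i (H i)" "\<And>i. E i (H i) = d (Suc i) * H (Suc i)" by blast
  then show thesis using that[of H] unfolding P_def E_def by blast
qed

lemma mat_left_inverse_dims:
  fixes A B :: "'k::field mat"
  assumes A: "A \<in> carrier_mat m n" and B: "B \<in> carrier_mat n m" and BA: "B * A = 1\<^sub>m n"
  shows "n \<le> m"
proof (rule ccontr)
  assume "\<not> n \<le> m"
  then have mn: "m < n" by simp
  \<comment> \<open>Pad both matrices with zeros to square ones.\<close>
  define A' where "A' = mat n n (\<lambda>(r, c). if r < m then A $$ (r, c) else 0)"
  define B' where "B' = mat n n (\<lambda>(r, c). if c < m then B $$ (r, c) else 0)"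
  have A': "A' \<in> carrier_mat n n" and B': "B' \<in> carrier_mat n n" unfolding A'_def B'_def by auto
  have "B' * A' = 1\<^sub>m n"
  proof (rule eq_matI)
    fix r c assume rc: "r < dim_row (1\<^sub>m n :: 'k mat)" "c < dim_col (1\<^sub>m n :: 'k mat)"
    have "(B' * A') $$ (r, c) = (\<Sum>q<n. (if q < m then B $$ (r, q) * A $$ (q, c) else 0))"
      using rc unfolding A'_def B'_def by (auto simp: scalar_prod_def atLeast0LessThan intro!: sum.cong)
    also have "\<dots> = (\<Sum>q<m. B $$ (r, q) * A $$ (q, c))"
      using mn by (intro sum.mono_neutral_cong_right) auto
    also have "\<dots> = (B * A) $$ (r, c)"
      using rc A B by (auto simp: scalar_prod_def atLeast0LessThan intro!: sum.cong)
    finally show "(B' * A') $$ (r, c) = (1\<^sub>m n :: 'k mat) $$ (r, c)" using BA by simp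
  qed (use A' B' in auto)
  then have "A' * B' = 1\<^sub>m n" by (rule mat_mult_left_right_inverse[OF B' A'])
  moreover have "(A' * B') $$ (m, m) = 0"
    using mn unfolding A'_def B'_def by (auto simp: scalar_prod_def)
  ultimately show False using mn by simp
qed

text \<open>
  Compose comparison maps in both directions.  The composite differs from the identity by
  \<open>d * H + H * d\<close>, and the constant coefficients of \<open>d\<close> vanish by minimality.  So the matrices of constant
  coefficients of the two comparison maps are inverse to each other on one side, which bounds the rank.
\<close>

lemma mfr_rank_le:
  assumes res: "minimal_free_resolution V I b a d"
    and res': "minimal_free_resolution V I b' a' (d' :: nat \<Rightarrow> ('v, 'k::field) polynomial mat)"
  shows "b i \<le> b' i"
proof -
  obtain X where X: "\<And>i. X i \<in> mats_over V (b' i) (b i)" "X 0 = 1\<^sub>m 1" "\<And>i. X i * d i = d' i * X (Suc i)"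
    using mfr_chain_map[OF res res'] by blast
  obtain Y where Y: "\<And>i. Y i \<in> mats_over V (b i) (b' i)" "Y 0 = 1\<^sub>m 1" "\<And>i. Y i * d' i = d i * Y (Suc i)"
    using mfr_chain_map[OF res' res] by blast
  note D = mats_over_carrier[OF mfr_d[OF res]] and D' = mats_over_carrier[OF mfr_d[OF res']]
  note Xc = mats_over_carrier[OF X(1)] and Yc = mats_over_carrier[OF Y(1)]
  have Z1: "Y i * X i \<in> mats_over V (b i) (b i)" for i by (rule mats_over_mult[OF Y(1) X(1)])
  have Z2: "Y 0 * X 0 = 1\<^sub>m 1" unfolding X(2) Y(2) by simp
  have Z3: "Y i * X i * d i = d i * (Y (Suc i) * X (Suc i))" for i
  proof -
    have "Y i * X i * d i = Y i * (d' i * X (Suc i))"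
      unfolding X(3)[symmetric] by (rule assoc_mult_mat[OF Yc Xc D])
    also have "\<dots> = d i * Y (Suc i) * X (Suc i)"
      unfolding Y(3)[symmetric] by (rule assoc_mult_mat[symmetric, OF Yc D' Xc])
    also have "\<dots> = d i * (Y (Suc i) * X (Suc i))" by (rule assoc_mult_mat[OF D Yc Xc])
    finally show ?thesis .
  qed
  obtain H where H: "\<And>i. H i \<in> mats_over V (b (Suc i)) (b i)"
    "\<And>i. Y (Suc i) * X (Suc i) - 1\<^sub>m (b (Suc i)) - H i * d i = d (Suc i) * H (Suc i)"
    using mfr_homotopy[OF res Z1 Z2 Z3] by metis
  note Hc = mats_over_carrier[OF H(1)]
  define cf where "cf = map_mat (\<lambda>p :: ('v, 'k) polynomial. lookup p 0)"
  have cf_mult: "lookup ((M * N) $$ (r, s)) 0 = (\<Sum>q<m. lookup (M $$ (r, q)) 0 * lookup (N $$ (q, s)) 0)"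
    if "M \<in> carrier_mat l m" "N \<in> carrier_mat m n" "r < l" "s < n"
    for M N :: "('v, 'k) polynomial mat" and l m n r s
    using that by (auto simp: scalar_prod_def lookup_sum const_coeff_mult atLeast0LessThan)
  have const: "lookup ((Y i * X i) $$ (r, s)) 0 = (if r = s then 1 else 0)" if rs: "r < b i" "s < b i" for r s
  proof (cases i)
    case 0
    then have "r = 0" "s = 0" using rs mfr_rank_0[OF res] by auto
    then show ?thesis unfolding 0 Z2 by simp
  next
    case (Suc j)
    have "lookup ((Y i * X i - 1\<^sub>m (b i) - H j * d j) $$ (r, s)) 0 = lookup ((d i * H i) $$ (r, s)) 0"
      using H(2)[of j] Suc by simp
    moreover have "lookup ((d i * H i) $$ (r, s)) 0 = 0"
      by (subst cf_mult[OF D Hc rs]) (simp add: mfr_const[OF res rs(1)])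
    moreover have "lookup ((H j * d j) $$ (r, s)) 0 = 0"
      using rs by (subst cf_mult[OF Hc D]) (simp_all add: mfr_const[OF res] Suc)
    moreover have "(Y i * X i - 1\<^sub>m (b i) - H j * d j) $$ (r, s)
        = (Y i * X i) $$ (r, s) - (if r = s then 1 else 0) - (H j * d j) $$ (r, s)"
      using rs Xc[of i] Yc[of i] Hc[of j] D[of j] unfolding Suc by simp
    ultimately show ?thesis by (simp add: lookup_minus)
  qed
  have "cf (Y i) * cf (X i) = 1\<^sub>m (b i)"
  proof (rule eq_matI)
    fix r s assume "r < dim_row (1\<^sub>m (b i) :: 'k mat)" "s < dim_col (1\<^sub>m (b i) :: 'k mat)"
    then have rs: "r < b i" "s < b i" by auto
    have "(cf (Y i) * cf (X i)) $$ (r, s) = (\<Sum>q<b' i. lookup (Y i $$ (r, q)) 0 * lookup (X i $$ (q, s)) 0)"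
      using rs Xc[of i] Yc[of i] unfolding cf_def by (auto simp: scalar_prod_def atLeast0LessThan)
    also have "\<dots> = lookup ((Y i * X i) $$ (r, s)) 0" by (rule cf_mult[symmetric, OF Yc Xc rs])
    finally show "(cf (Y i) * cf (X i)) $$ (r, s) = (1\<^sub>m (b i) :: 'k mat) $$ (r, s)"
      using const[OF rs] rs by simp
  qed (use Xc[of i] Yc[of i] in \<open>auto simp: cf_def\<close>)
  moreover have "cf (X i) \<in> carrier_mat (b' i) (b i)" "cf (Y i) \<in> carrier_mat (b i) (b' i)"
    using Xc[of i] Yc[of i] unfolding cf_def by auto
  ultimately show ?thesis by (intro mat_left_inverse_dims)
qed

lemma betti_eq:
  assumes "minimal_free_resolution V I b a d"
  shows "betti V I i = (if i < 0 then 0 else b (nat i))"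
proof -
  have "(THE r. \<exists>b a d. minimal_free_resolution V I b a d \<and> b (nat i) = r) = b (nat i)"
  proof (rule the_equality)
    show "\<exists>b' a d. minimal_free_resolution V I b' a d \<and> b' (nat i) = b (nat i)"
      using assms by (intro exI conjI) (assumption, rule refl)
    fix r assume "\<exists>b a d. minimal_free_resolution V I b a d \<and> b (nat i) = r"
    then show "r = b (nat i)"
    proof (elim exE conjE)
      fix b' a' d' assume res': "minimal_free_resolution V I b' a' d'" and r: "b' (nat i) = r"
      show "r = b (nat i)"
      unfolding r[symmetric] by (rule antisym[OF mfr_rank_le[OF res' assms] mfr_rank_le[OF assms res']])
    qed
  qed
  then show ?thesis unfolding betti_def by (simp only: if_cancel)
qed

section \<open>Complexes of scalar matrices labelled by sets\<close>

text \<open>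
  Induction on \<open>n\<close>: split off one element of \<open>K\<close> with nonzero last coordinate, if there is one.
\<close>

lemma finite_spanning_subset:
  fixes K :: "(nat \<Rightarrow> 'k::field) set"
  assumes "\<And>u i. u \<in> K \<Longrightarrow> u i \<noteq> 0 \<Longrightarrow> i < n"
    and "\<And>u v a. u \<in> K \<Longrightarrow> v \<in> K \<Longrightarrow> (\<lambda>i. u i - a * v i) \<in> K"
  shows "\<exists>T. finite T \<and> T \<subseteq> K \<and> (\<forall>u\<in>K. \<exists>a. \<forall>i. u i = (\<Sum>v\<in>T. a v * v i))"
  using assms
proof (induction n arbitrary: K)
  case 0
  then have "u i = 0" if "u \<in> K" for u i using that by blast
  then show ?case by (intro exI[of _ "{}"]) auto
next
  case (Suc n)
  define K' where "K' = {u \<in> K. u n = 0}"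
  have "\<exists>T. finite T \<and> T \<subseteq> K' \<and> (\<forall>u\<in>K'. \<exists>a. \<forall>i. u i = (\<Sum>v\<in>T. a v * v i))"
  proof (rule Suc.IH)
    show "i < n" if "u \<in> K'" "u i \<noteq> 0" for u i
    proof -
      have "i < Suc n" using Suc.prems(1) that unfolding K'_def by blast
      moreover have "i \<noteq> n" using that unfolding K'_def by auto
      ultimately show ?thesis by simp
    qed
    show "(\<lambda>i. u i - a * v i) \<in> K'" if "u \<in> K'" "v \<in> K'" for u v a
      using that Suc.prems(2) unfolding K'_def by auto
  qed
  then obtain T where T: "finite T" "T \<subseteq> K'"
    "\<And>u. u \<in> K' \<Longrightarrow> \<exists>a. \<forall>i. u i = (\<Sum>v\<in>T. a v * v i)" by blast
  show ?case
  proof (cases "\<exists>v\<in>K. v n \<noteq> 0")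
    case False
    then have "K' = K" unfolding K'_def by auto
    then show ?thesis using T by blast
  next
    case True
    then obtain v where v: "v \<in> K" "v n \<noteq> 0" by blast
    have vT: "v \<notin> T" using T(2) v unfolding K'_def by auto
    have "\<exists>a. \<forall>i. u i = (\<Sum>x\<in>insert v T. a x * x i)" if u: "u \<in> K" for u
    proof -
      define e where "e = u n / v n"
      have "(\<lambda>i. u i - e * v i) \<in> K'"
        using Suc.prems(2)[OF u v(1), of e] v(2) unfolding K'_def by (simp add: e_def)
      then obtain a where a: "\<And>i. u i - e * v i = (\<Sum>x\<in>T. a x * x i)" using T(3) by blast
      have "u i = (\<Sum>x\<in>insert v T. (a(v := e)) x * x i)" for i
      proof -
        have "(\<Sum>x\<in>insert v T. (a(v := e)) x * x i) = e * v i + (\<Sum>x\<in>T. (a(v := e)) x * x i)"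
          using T(1) vT by simp
        also have "(\<Sum>x\<in>T. (a(v := e)) x * x i) = (\<Sum>x\<in>T. a x * x i)"
          using vT by (intro sum.cong) auto
        also have "\<dots> = u i - e * v i" by (simp add: a)
        finally show ?thesis by simp
      qed
      then show ?thesis by blast
    qed
    then show ?thesis using T(1,2) v(1) by (intro exI[of _ "insert v T"]) (auto simp: K'_def)
  qed
qed

type_synonym 'k scalar_mat = "nat \<Rightarrow> nat \<Rightarrow> 'k"
type_synonym 'k scalar_mats = "nat \<Rightarrow> 'k scalar_mat"

text \<open>
  A labelled vector space is given by its dimension \<open>b\<close> and a set \<open>A s\<close> of generators for each basis
  element \<open>s < b\<close>; its vectors are functions that vanish from \<open>b\<close> on.  The vectors supported
  in \<open>S\<close> form the component of a free module in a degree \<open>t\<close> with \<open>S = {j. m j divides t}\<close>.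
\<close>

definition supported :: "nat \<Rightarrow> (nat \<Rightarrow> nat set) \<Rightarrow> nat set \<Rightarrow> (nat \<Rightarrow> 'k::field) \<Rightarrow> bool" where
  "supported b A S u \<longleftrightarrow> (\<forall>s. u s \<noteq> 0 \<longrightarrow> s < b \<and> A s \<subseteq> S)"

definition mat_app :: "'k::field scalar_mat \<Rightarrow> nat \<Rightarrow> (nat \<Rightarrow> 'k) \<Rightarrow> nat \<Rightarrow> 'k" where
  "mat_app c b u r = (\<Sum>s<b. c r s * u s)"

definition kernel_at ::
  "nat \<Rightarrow> 'k::field scalar_mat \<Rightarrow> nat \<Rightarrow> (nat \<Rightarrow> nat set) \<Rightarrow> nat set \<Rightarrow> (nat \<Rightarrow> 'k) set" where
  "kernel_at b c b' A' S = {u. supported b' A' S u \<and> (\<forall>r<b. mat_app c b' u r = 0)}"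

text \<open>
  A vector \<open>w\<close> in the kernel over \<open>S\<close> may become a column, with label \<open>S\<close>, of the next matrix of a
  resolution.  The condition forces \<open>S\<close> to be strictly bigger than the label of each basis element that
  occurs in \<open>w\<close>, in the sense that some member of \<open>\<C>\<close> tells them apart.  It thus makes the next
  matrix minimal.
\<close>

definition minimal_at ::
  "nat set set \<Rightarrow> nat \<Rightarrow> 'k::field scalar_mat \<Rightarrow> nat \<Rightarrow> (nat \<Rightarrow> nat set) \<Rightarrow> bool" where
  "minimal_at \<C> b c b' A' \<longleftrightarrow>
     (\<forall>S\<in>\<C>. \<forall>w\<in>kernel_at b c b' A' S. \<forall>s. w s \<noteq> 0 \<longrightarrow> (\<exists>S'\<in>\<C>. A' s \<subseteq> S' \<and> \<not> S \<subseteq> S'))"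

text \<open>
  The entry in row \<open>r\<close> and column \<open>s\<close> stands for a scalar times \<open>lcm (A' s) / lcm (A r)\<close>.  A nonzero entry
  requires this quotient to be a monomial different from 1; the set \<open>S\<close> witnesses that the two lcms differ.
\<close>

definition strict_map ::
  "nat set set \<Rightarrow> nat \<Rightarrow> (nat \<Rightarrow> nat set) \<Rightarrow> 'k::field scalar_mat \<Rightarrow> nat \<Rightarrow> (nat \<Rightarrow> nat set) \<Rightarrow> bool" where
  "strict_map \<C> b A c b' A' \<longleftrightarrow>
     (\<forall>r<b. \<forall>s<b'. c r s \<noteq> 0 \<longrightarrow> A r \<subseteq> A' s \<and> (\<exists>S\<in>\<C>. A r \<subseteq> S \<and> \<not> A' s \<subseteq> S))"

definition exact_at ::
  "nat set set \<Rightarrow> nat \<Rightarrow> 'k::field scalar_mat \<Rightarrow> nat \<Rightarrow> (nat \<Rightarrow> nat set)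
    \<Rightarrow> 'k scalar_mat \<Rightarrow> nat \<Rightarrow> (nat \<Rightarrow> nat set) \<Rightarrow> bool" where
  "exact_at \<C> b c b' A' c' b'' A'' \<longleftrightarrow>
     (\<forall>r<b. \<forall>s<b''. (\<Sum>q<b'. c r q * c' q s) = 0)
   \<and> (\<forall>S\<in>\<C>. \<forall>u\<in>kernel_at b c b' A' S.
        \<exists>w. supported b'' A'' S w \<and> (\<forall>q<b'. u q = mat_app c' b'' w q))"

lemma mat_app_diff:
  "mat_app c b (\<lambda>i. u i - a * v i) r = mat_app c b u r - a * mat_app c b v r"
  unfolding mat_app_def by (simp add: algebra_simps sum_subtractf sum_distrib_left)

lemma kernel_at_diff:
  assumes "u \<in> kernel_at b c b' A' S" "v \<in> kernel_at b c b' A' S"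
  shows "(\<lambda>i. u i - a * v i) \<in> kernel_at b c b' A' S"
proof -
  have "s < b' \<and> A' s \<subseteq> S" if "u s - a * v s \<noteq> 0" for s
  proof -
    have "u s \<noteq> 0 \<or> v s \<noteq> 0" using that by auto
    then show ?thesis using assms unfolding kernel_at_def supported_def by blast
  qed
  then show ?thesis using assms unfolding kernel_at_def supported_def by (auto simp: mat_app_diff)
qed

text \<open>
  Over each \<open>S\<close> the kernel is a finite-dimensional space, and the kernels grow with \<open>S\<close>.  Among the finite sets
  \<open>G\<close> of pairs of a label and a kernel vector that span all these kernels, take one of least cardinality; its vectors
  are the columns of the next matrix.  Least cardinality gives minimality: in a
  relation over \<open>S\<close> no generator with label \<open>S\<close> can occur, since it could be removed from \<open>G\<close>.
\<close>

lemma minimal_cover: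
  fixes c :: "'k::field scalar_mat"
  assumes fin: "finite \<C>" and min: "minimal_at \<C> b c b' A'"
  obtains b'' A'' c' where "exact_at \<C> b c b' A' c' b'' A''" "strict_map \<C> b' A' c' b'' A''"
    "minimal_at \<C> b' c' b'' A''" "\<And>s. s < b'' \<Longrightarrow> A'' s \<in> \<C>"
    "(\<And>S u s. S \<in> \<C> \<Longrightarrow> u \<in> kernel_at b c b' A' S \<Longrightarrow> u s = 0) \<Longrightarrow> b'' = 0"
proof -
  define spans where "spans G \<longleftrightarrow> finite G \<and> (\<forall>(S, v)\<in>G. S \<in> \<C> \<and> v \<in> kernel_at b c b' A' S)
      \<and> (\<forall>S\<in>\<C>. \<forall>u\<in>kernel_at b c b' A' S. \<exists>a. (\<forall>g\<in>G. a g \<noteq> 0 \<longrightarrow> fst g \<subseteq> S)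
           \<and> (\<forall>q. u q = (\<Sum>g\<in>G. a g * snd g q)))" for G :: "(nat set \<times> (nat \<Rightarrow> 'k)) set"
  have "\<exists>T. finite T \<and> T \<subseteq> kernel_at b c b' A' S \<and>
      (\<forall>u\<in>kernel_at b c b' A' S. \<exists>a. \<forall>i. u i = (\<Sum>v\<in>T. a v * v i))" for S
    by (rule finite_spanning_subset[where n = b'], auto intro: kernel_at_diff)
       (auto simp: kernel_at_def supported_def)
  then obtain T where T: "\<And>S. finite (T S)" "\<And>S. T S \<subseteq> kernel_at b c b' A' S"
    "\<And>S u. u \<in> kernel_at b c b' A' S \<Longrightarrow> \<exists>a. \<forall>i. u i = (\<Sum>v\<in>T S. a v * v i)" by metis
  have "spans (Sigma \<C> T)"
    unfolding spans_def
  proof (intro conjI ballI)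
    show "finite (Sigma \<C> T)" using fin T(1) by auto
    show "case g of (S, v) \<Rightarrow> S \<in> \<C> \<and> v \<in> kernel_at b c b' A' S" if "g \<in> Sigma \<C> T" for g
      using that T(2) by auto
    fix S u assume S: "S \<in> \<C>" and u: "u \<in> kernel_at b c b' A' S"
    obtain a where a: "\<And>i. u i = (\<Sum>v\<in>T S. a v * v i)" using T(3)[OF u] by blast
    define a' where "a' g = (if fst g = S then a (snd g) else 0)" for g :: "nat set \<times> (nat \<Rightarrow> 'k)"
    have "(\<Sum>g\<in>Sigma \<C> T. a' g * snd g q) = u q" for q
    proof -
      have "(\<Sum>g\<in>Sigma \<C> T. a' g * snd g q) = (\<Sum>g\<in>{S} \<times> T S. a' g * snd g q)"
        by (rule sum.mono_neutral_right) (use fin T(1) S in \<open>auto simp: a'_def\<close>)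
      also have "\<dots> = (\<Sum>v\<in>T S. a v * v q)"
        by (subst sum.Sigma[symmetric, of "{S}" "\<lambda>_. T S" "\<lambda>x y. a' (x, y) * y q", simplified split_def, simplified])
           (use T(1) in \<open>auto simp: a'_def\<close>)
      finally show ?thesis by (simp add: a)
    qed
    then show "\<exists>a. (\<forall>g\<in>Sigma \<C> T. a g \<noteq> 0 \<longrightarrow> fst g \<subseteq> S) \<and> (\<forall>q. u q = (\<Sum>g\<in>Sigma \<C> T. a g * snd g q))"
      by (intro exI[of _ a']) (auto simp: a'_def)
  qed
  then obtain G where G: "spans G" and least: "\<And>G'. spans G' \<Longrightarrow> card G \<le> card G'"
    using ex_has_least_nat[of spans _ card] by blast
  have finG: "finite G" using G unfolding spans_def by blast
  have Gker: "fst g \<in> \<C>" "snd g \<in> kernel_at b c b' A' (fst g)" if "g \<in> G" for g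
    using G that unfolding spans_def by auto
  \<comment> \<open>An element \<open>g0\<close> of \<open>G\<close> that depends on elements with labels inside its own label could be dropped.\<close>
  have irred: False
    if g0: "g0 \<in> G" "a g0 \<noteq> 0" and below: "\<And>g. g \<in> G \<Longrightarrow> a g \<noteq> 0 \<Longrightarrow> fst g \<subseteq> fst g0"
      and zero: "\<And>q. (\<Sum>g\<in>G. a g * snd g q) = 0" for g0 and a :: "_ \<Rightarrow> 'k"
  proof -
    have "spans (G - {g0})"
      unfolding spans_def
    proof (intro conjI ballI)
      show "finite (G - {g0})" using finG by simp
      show "case g of (S, v) \<Rightarrow> S \<in> \<C> \<and> v \<in> kernel_at b c b' A' S" if "g \<in> G - {g0}" for g
        using that G unfolding spans_def by auto
      fix S u assume S: "S \<in> \<C>" and u: "u \<in> kernel_at b c b' A' S"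
      obtain e where e: "\<And>g. g \<in> G \<Longrightarrow> e g \<noteq> 0 \<Longrightarrow> fst g \<subseteq> S"
        "\<And>q. u q = (\<Sum>g\<in>G. e g * snd g q)" using G S u unfolding spans_def by meson
      define e' where "e' g = e g - e g0 / a g0 * a g" for g
      have "fst g \<subseteq> S" if "g \<in> G" "e' g \<noteq> 0" for g
      proof (cases "e g = 0")
        case True
        then have "e g0 \<noteq> 0" "a g \<noteq> 0" using that by (auto simp: e'_def)
        then show ?thesis using e(1)[OF g0(1)] below[OF that(1)] by blast
      qed (use e(1) that in auto)
      moreover have "(\<Sum>g\<in>G - {g0}. e' g * snd g q) = u q" for q
      proof -
        have "(\<Sum>g\<in>G - {g0}. e' g * snd g q) = (\<Sum>g\<in>G. e' g * snd g q)"
          by (rule sum.mono_neutral_left) (use finG g0 in \<open>auto simp: e'_def\<close>)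
        also have "\<dots> = (\<Sum>g\<in>G. e g * snd g q) - e g0 / a g0 * (\<Sum>g\<in>G. a g * snd g q)"
          unfolding e'_def by (simp add: algebra_simps sum_subtractf sum_distrib_left)
        finally show ?thesis using zero e(2) by simp
      qed
      ultimately show "\<exists>a. (\<forall>g\<in>G - {g0}. a g \<noteq> 0 \<longrightarrow> fst g \<subseteq> S)
           \<and> (\<forall>q. u q = (\<Sum>g\<in>G - {g0}. a g * snd g q))"
        by (intro exI[of _ e']) auto
    qed
    from least[OF this] show False using finG g0(1)
      by (metis card_Diff1_less linorder_not_le)
  qed
  obtain h where h: "bij_betw h {..<card G} G"
    using ex_bij_betw_nat_finite[OF finG] by (auto simp: atLeast0LessThan)
  define A'' where "A'' s = fst (h s)" for s
  define c' where "c' q s = snd (h s) q" for q s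
  have hG: "h s \<in> G" if "s < card G" for s using bij_betwE[OF h] that by auto
  have col: "(\<lambda>q. c' q s) \<in> kernel_at b c b' A' (A'' s)" "A'' s \<in> \<C>" if "s < card G" for s
    using Gker[OF hG[OF that]] unfolding A''_def c'_def by auto
  have app: "mat_app c' (card G) w q = (\<Sum>g\<in>G. w (inv_into {..<card G} h g) * snd g q)" for w q
  proof -
    have "(\<Sum>g\<in>G. w (inv_into {..<card G} h g) * snd g q)
        = (\<Sum>s<card G. w (inv_into {..<card G} h (h s)) * snd (h s) q)"
      by (rule sum.reindex_bij_betw[OF h, symmetric])
    also have "\<dots> = mat_app c' (card G) w q"
      unfolding mat_app_def c'_def using h
      by (intro sum.cong) (auto simp: bij_betw_def mult.commute)
    finally show ?thesis by simp
  qed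
  show thesis
  proof (rule that[of c' "card G" A''])
    show "exact_at \<C> b c b' A' c' (card G) A''"
      unfolding exact_at_def
    proof (intro conjI allI impI ballI)
      show "(\<Sum>q<b'. c r q * c' q s) = 0" if "r < b" "s < card G" for r s
        using col(1)[OF that(2)] that(1) unfolding kernel_at_def mat_app_def by auto
      fix S u assume S: "S \<in> \<C>" and u: "u \<in> kernel_at b c b' A' S"
      obtain a where a: "\<And>g. g \<in> G \<Longrightarrow> a g \<noteq> 0 \<Longrightarrow> fst g \<subseteq> S"
        "\<And>q. u q = (\<Sum>g\<in>G. a g * snd g q)" using G S u unfolding spans_def by meson
      define w where "w s = (if s < card G then a (h s) else 0)" for s
      have "u q = mat_app c' (card G) w q" for q
      proof -
        have "w (inv_into {..<card G} h g) = a g" if g: "g \<in> G" for g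
        proof -
          have g': "g \<in> h ` {..<card G}" using h g by (simp add: bij_betw_def)
          show ?thesis using inv_into_into[OF g'] f_inv_into_f[OF g'] unfolding w_def by simp
        qed
        then show ?thesis unfolding app a(2)[of q] by simp
      qed
      moreover have "supported (card G) A'' S w"
        using a(1) hG unfolding supported_def w_def A''_def by auto
      ultimately show "\<exists>w. supported (card G) A'' S w \<and> (\<forall>q<b'. u q = mat_app c' (card G) w q)"
        by blast
    qed
    show "strict_map \<C> b' A' c' (card G) A''"
      unfolding strict_map_def
    proof (intro allI impI)
      fix r s assume rs: "r < b'" "s < card G" "c' r s \<noteq> 0"
      have "A' r \<subseteq> A'' s" using col(1)[OF rs(2)] rs(3) unfolding kernel_at_def supported_def by auto
      moreover have "\<exists>S\<in>\<C>. A' r \<subseteq> S \<and> \<not> A'' s \<subseteq> S"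
        using min[unfolded minimal_at_def, rule_format, OF col(2)[OF rs(2)] col(1)[OF rs(2)], of r] rs(3)
        by simp
      ultimately show "A' r \<subseteq> A'' s \<and> (\<exists>S\<in>\<C>. A' r \<subseteq> S \<and> \<not> A'' s \<subseteq> S)" ..
    qed
    have nodep: "\<not> S \<subseteq> A'' s"
      if w: "w \<in> kernel_at b' c' (card G) A'' S" "w s \<noteq> 0" "S \<in> \<C>" for S w s
    proof
      assume SA: "S \<subseteq> A'' s"
      define a where "a g = w (inv_into {..<card G} h g)" for g
      have sup: "\<And>s. w s \<noteq> 0 \<Longrightarrow> s < card G \<and> A'' s \<subseteq> S"
        using w(1) unfolding kernel_at_def supported_def by auto
      have s: "s < card G" using sup w(2) by blast
      have ah: "a (h s) = w s" if "s < card G" for s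
        unfolding a_def using h that by (auto simp: bij_betw_def)
      show False
      proof (rule irred[of "h s" a])
        show "h s \<in> G" "a (h s) \<noteq> 0" using s w(2) hG ah by auto
        show "fst g \<subseteq> fst (h s)" if g: "g \<in> G" "a g \<noteq> 0" for g
        proof -
          obtain s' where s': "s' < card G" "g = h s'" using g(1) h by (auto simp: bij_betw_def)
          then have "fst g \<subseteq> S" using sup[of s'] g(2) ah unfolding A''_def by auto
          then show ?thesis using SA unfolding A''_def by auto
        qed
        show "(\<Sum>g\<in>G. a g * snd g q) = 0" for q
        proof (cases "q < b'")
          case True
          then show ?thesis using w(1) unfolding kernel_at_def a_def by (auto simp: app)
        next
          case False
          then have "snd g q = 0" if "g \<in> G" for g
            using Gker(2)[OF that] unfolding kernel_at_def supported_def by auto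
          then show ?thesis by simp
        qed
      qed
    qed
    show "minimal_at \<C> b' c' (card G) A''"
      unfolding minimal_at_def
    proof (intro ballI allI impI)
      fix S w s assume S: "S \<in> \<C>" "w \<in> kernel_at b' c' (card G) A'' S" "w s \<noteq> 0"
      then have "s < card G" unfolding kernel_at_def supported_def by auto
      then show "\<exists>S'\<in>\<C>. A'' s \<subseteq> S' \<and> \<not> S \<subseteq> S'" using col(2) nodep[OF S(2,3,1)] by blast
    qed
    show "A'' s \<in> \<C>" if "s < card G" for s using col(2) that .
    assume triv: "\<And>S u s. S \<in> \<C> \<Longrightarrow> u \<in> kernel_at b c b' A' S \<Longrightarrow> u s = 0"
    show "card G = 0"
    proof (rule ccontr)
      assume "card G \<noteq> 0"
      then obtain g where g: "g \<in> G" using card.empty by (metis ex_in_conv)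
      show False
      proof (rule irred[of g "\<lambda>g'. if g' = g then 1 else 0"])
        have "(\<Sum>g'\<in>G. (if g' = g then 1 else 0) * snd g' q) = snd g q" for q
          using finG g by (simp add: if_distrib[of "\<lambda>x. x * _"] cong: if_cong)
        then show "(\<Sum>g'\<in>G. (if g' = g then 1 else 0) * snd g' q) = 0" for q
          using triv Gker[OF g] by metis
      qed (use g in \<open>auto split: if_splits\<close>)
    qed
  qed
qed

text \<open>
  The labelled counterpart of a minimal free resolution of the quotient by an ideal with \<open>n\<close> generators.
  The space in degree 0 has one basis element, labelled by the empty set; the one in degree 1
  has the generators as basis.  Exactness is required over each member of \<open>\<C>\<close>.
\<close>

definition set_resolution ::
  "nat \<Rightarrow> nat set set \<Rightarrow> (nat \<Rightarrow> nat) \<Rightarrow> (nat \<Rightarrow> nat \<Rightarrow> nat set) \<Rightarrow> 'k::field scalar_mats \<Rightarrow> bool" where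
  "set_resolution n \<C> b A c \<longleftrightarrow>
     b 0 = 1 \<and> A 0 0 = {} \<and> b 1 = n \<and> (\<forall>j<n. A 1 j = {j} \<and> c 0 0 j = 1)
   \<and> (\<forall>i. \<forall>s<b i. A i s \<subseteq> {..<n})
   \<and> (\<forall>i. strict_map \<C> (b i) (A i) (c i) (b (Suc i)) (A (Suc i)))
   \<and> (\<forall>i. exact_at \<C> (b i) (c i) (b (Suc i)) (A (Suc i)) (c (Suc i)) (b (Suc (Suc i))) (A (Suc (Suc i))))"

text \<open>
  A resolution that has been constructed up to the matrix \<open>c k\<close>; the last clause makes it possible to
  continue with a minimal cover of the kernel of \<open>c k\<close>.
\<close>

definition partial_resolution ::
  "nat \<Rightarrow> nat \<Rightarrow> nat set set \<Rightarrow> (nat \<Rightarrow> nat) \<Rightarrow> (nat \<Rightarrow> nat \<Rightarrow> nat set) \<Rightarrow> 'k::field scalar_mats \<Rightarrow> bool" where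
  "partial_resolution k n \<C> b A c \<longleftrightarrow>
     b 0 = 1 \<and> A 0 0 = {} \<and> b 1 = n \<and> (\<forall>j<n. A 1 j = {j} \<and> c 0 0 j = 1)
   \<and> (\<forall>i\<le>Suc k. \<forall>s<b i. A i s \<subseteq> {..<n})
   \<and> (\<forall>i\<le>k. strict_map \<C> (b i) (A i) (c i) (b (Suc i)) (A (Suc i)))
   \<and> (\<forall>i<k. exact_at \<C> (b i) (c i) (b (Suc i)) (A (Suc i)) (c (Suc i)) (b (Suc (Suc i))) (A (Suc (Suc i))))
   \<and> minimal_at \<C> (b k) (c k) (b (Suc k)) (A (Suc k))"

lemma partial_resolution_extends:
  fixes c :: "'k::field scalar_mats"
  assumes fam: "\<C> \<subseteq> Pow {..<n}" and part: "partial_resolution k n \<C> b A c"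
  obtains b' A' and c' :: "'k scalar_mats" where "set_resolution n \<C> b' A' c'"
    "\<And>i. i \<le> Suc k \<Longrightarrow> b' i = b i"
    "(\<And>S u s. S \<in> \<C> \<Longrightarrow> u \<in> kernel_at (b k) (c k) (b (Suc k)) (A (Suc k)) S \<Longrightarrow> u s = 0)
       \<Longrightarrow> \<forall>i>Suc k. b' i = 0"
proof -
  have fin: "finite \<C>" using fam by (rule finite_subset) simp
  \<comment> \<open>A state \<open>(b0, A0, c0, b1, A1)\<close> is one matrix together with the labelled spaces that it connects.\<close>
  define P where "P i X \<longleftrightarrow> (case X of (b0, A0, c0, b1, A1) \<Rightarrow>
      strict_map \<C> b0 A0 c0 b1 A1 \<and> (\<forall>s<b1. A1 s \<subseteq> {..<n})
      \<and> (i \<le> k \<longrightarrow> X = (b i, A i, c i, b (Suc i), A (Suc i)))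
      \<and> (k \<le> i \<longrightarrow> minimal_at \<C> b0 c0 b1 A1))" for i and X :: "nat \<times> (nat \<Rightarrow> nat set) \<times> 'k scalar_mat \<times> nat \<times> (nat \<Rightarrow> nat set)"
  define Q where "Q i X Y \<longleftrightarrow> (case X of (b0, A0, c0, b1, A1) \<Rightarrow> case Y of (b1', A1', c1, b2, A2) \<Rightarrow>
      b1' = b1 \<and> A1' = A1 \<and> exact_at \<C> b0 c0 b1 A1 c1 b2 A2
      \<and> (k \<le> i \<longrightarrow> (\<forall>S u s. S \<in> \<C> \<longrightarrow> u \<in> kernel_at b0 c0 b1 A1 S \<longrightarrow> u s = 0) \<longrightarrow> b2 = 0))"
    for i :: nat and X Y :: "nat \<times> (nat \<Rightarrow> nat set) \<times> 'k scalar_mat \<times> nat \<times> (nat \<Rightarrow> nat set)"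
  define pre where "pre i = (b i, A i, c i, b (Suc i), A (Suc i))" for i
  have P_pre: "P i (pre i)" if "i \<le> k" for i
    using part that unfolding partial_resolution_def P_def pre_def by auto
  have "\<exists>f. \<forall>i. P i (f i) \<and> Q i (f i) (f (Suc i))"
  proof (rule dependent_nat_choice)
    show "\<exists>x. P 0 x" using P_pre[of 0] by blast
    fix X i assume X: "P i X"
    show "\<exists>Y. P (Suc i) Y \<and> Q i X Y"
    proof (cases "i < k")
      case True
      then have "X = pre i" using X unfolding P_def pre_def by auto
      moreover have "Q i (pre i) (pre (Suc i))"
        using part True unfolding partial_resolution_def Q_def pre_def by auto
      ultimately show ?thesis using P_pre[of "Suc i"] True by (intro exI[of _ "pre (Suc i)"]) auto
    next
      case False
      obtain b0 A0 c0 b1 A1 where Xeq: "X = (b0, A0, c0, b1, A1)" by (cases X) auto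
      have "minimal_at \<C> b0 c0 b1 A1" using X False unfolding P_def Xeq by auto
      from minimal_cover[OF fin this] obtain b2 A2 c1 where
        *: "exact_at \<C> b0 c0 b1 A1 c1 b2 A2" "strict_map \<C> b1 A1 c1 b2 A2" "minimal_at \<C> b1 c1 b2 A2"
          "\<And>s. s < b2 \<Longrightarrow> A2 s \<in> \<C>"
          "(\<And>S u s. S \<in> \<C> \<Longrightarrow> u \<in> kernel_at b0 c0 b1 A1 S \<Longrightarrow> u s = 0) \<Longrightarrow> b2 = 0"
        by metis
      have "P (Suc i) (b1, A1, c1, b2, A2)" using * False fam unfolding P_def by auto
      moreover have "Q i X (b1, A1, c1, b2, A2)" using *(1,5) unfolding Q_def Xeq by auto
      ultimately show ?thesis by blast
    qed
  qed
  then obtain f where f: "\<And>i. P i (f i)" "\<And>i. Q i (f i) (f (Suc i))" by blast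
  define b' where "b' i = fst (f i)" for i
  define A' where "A' i = fst (snd (f i))" for i
  define c' where "c' i = fst (snd (snd (f i)))" for i
  have feq: "f i = (b' i, A' i, c' i, b' (Suc i), A' (Suc i))" for i
    using f(2)[of i] unfolding Q_def b'_def A'_def c'_def by (cases "f i"; cases "f (Suc i)") auto
  have agree: "b' i = b i \<and> A' i = A i \<and> c' i = c i \<and> b' (Suc i) = b (Suc i) \<and> A' (Suc i) = A (Suc i)"
    if "i \<le> k" for i using f(1)[of i] that unfolding P_def feq by auto
  show thesis
  proof (rule that[of b' A' c'])
    have "A' i s \<subseteq> {..<n}" if "s < b' i" for i s
    proof (cases i)
      case 0
      then show ?thesis using agree[of 0] that part unfolding partial_resolution_def by auto
    next
      case (Suc i')
      then show ?thesis using f(1)[of i'] that unfolding P_def feq by auto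
    qed
    moreover have "strict_map \<C> (b' i) (A' i) (c' i) (b' (Suc i)) (A' (Suc i))" for i
      using f(1)[of i] unfolding P_def feq by auto
    moreover have "exact_at \<C> (b' i) (c' i) (b' (Suc i)) (A' (Suc i)) (c' (Suc i)) (b' (Suc (Suc i))) (A' (Suc (Suc i)))" for i
      using f(2)[of i] unfolding Q_def feq by auto
    ultimately show "set_resolution n \<C> b' A' c'"
      using agree[of 0] part unfolding set_resolution_def partial_resolution_def by auto
    show "b' i = b i" if "i \<le> Suc k" for i
      using agree[of i] agree[of k] that by (cases "i = Suc k") auto
    assume triv: "\<And>S u s. S \<in> \<C> \<Longrightarrow> u \<in> kernel_at (b k) (c k) (b (Suc k)) (A (Suc k)) S \<Longrightarrow> u s = 0"
    have step: "b' (Suc (Suc i)) = 0"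
      if "k \<le> i" "\<And>S u s. S \<in> \<C> \<Longrightarrow> u \<in> kernel_at (b' i) (c' i) (b' (Suc i)) (A' (Suc i)) S \<Longrightarrow> u s = 0" for i
      using f(2)[of i] that unfolding Q_def feq by auto
    have "b' (Suc (Suc (k + j))) = 0" for j
    proof (induction j)
      case 0
      show ?case using step[of k] agree[of k] triv by simp
    next
      case (Suc j)
      show ?case
        by (rule step) (use Suc in \<open>auto simp: kernel_at_def supported_def\<close>)
    qed
    then show "\<forall>i>Suc k. b' i = 0" by (metis Suc_le_eq add_Suc le_Suc_ex)
  qed
qed

section \<open>Monomials and monomial ideals\<close>

text \<open>
  Exponents are natural numbers, so divisibility of monomials is a pointwise comparison.
\<close>

lemma mono_dvd_iff_le: "mono_dvd s t \<longleftrightarrow> (\<forall>v. lookup s v \<le> lookup t v)"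
proof
  assume "\<forall>v. lookup s v \<le> lookup t v"
  then have "t = s + (t - s)" by (intro poly_mapping_eqI) (simp add: lookup_add lookup_minus)
  then show "mono_dvd s t" unfolding mono_dvd_def by blast
qed (auto simp: mono_dvd_def lookup_add)

lemma mono_dvd_refl [simp]: "mono_dvd s s"
  by (simp add: mono_dvd_iff_le)

lemma mono_dvd_trans: "mono_dvd s t \<Longrightarrow> mono_dvd t u \<Longrightarrow> mono_dvd s u"
  unfolding mono_dvd_iff_le using order_trans by blast

lemma mono_dvd_antisym: "mono_dvd s t \<Longrightarrow> mono_dvd t s \<Longrightarrow> s = t"
  unfolding mono_dvd_iff_le by (intro poly_mapping_eqI) (simp add: antisym)

lemma mono_dvd_diff_add: "mono_dvd s t \<Longrightarrow> t - s + s = t"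
  unfolding mono_dvd_iff_le by (intro poly_mapping_eqI) (simp add: lookup_add lookup_minus)

lemma mono_dvd_lcm_iff: "mono_dvd (mono_lcm s t) u \<longleftrightarrow> mono_dvd s u \<and> mono_dvd t u"
  unfolding mono_dvd_iff_le mono_lcm.rep_eq by auto

lemma keys_mono_lcm: "keys (mono_lcm s t) \<subseteq> keys s \<union> keys t"
  by (auto simp: in_keys_iff mono_lcm.rep_eq)

lemma mono_deg_add: "mono_deg (s + t) = mono_deg s + mono_deg t"
proof -
  have deg: "mono_deg u = (\<Sum>v\<in>keys s \<union> keys t. lookup u v)"
    if "keys u \<subseteq> keys s \<union> keys t" for u
    unfolding mono_deg_def using that
    by (intro sum.mono_neutral_left) (auto simp: in_keys_iff)
  show ?thesis
    using keys_add[of s t] by (simp add: deg lookup_add sum.distrib)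
qed

lemma poly_ring_simps [simp]:
  "carrier (poly_ring V) = polys_over V" "x \<otimes>\<^bsub>poly_ring V\<^esub> y = x * y" "x \<oplus>\<^bsub>poly_ring V\<^esub> y = x + y"
  "\<one>\<^bsub>poly_ring V\<^esub> = 1" "\<zero>\<^bsub>poly_ring V\<^esub> = 0"
  unfolding poly_ring_def by simp_all

lemma polys_over_uminus: "p \<in> polys_over V \<Longrightarrow> - p \<in> polys_over V"
  using polys_over_minus[OF polys_over_0, of p V] by simp

lemma poly_ring_cring: "cring (poly_ring V :: ('v, 'k::field) polynomial ring)"
proof (rule cringI)
  show "abelian_group (poly_ring V :: ('v, 'k) polynomial ring)"
    by (rule abelian_groupI)
       (auto simp: polys_over_add add.assoc add.commute intro!: bexI[of _ "- _"] polys_over_uminus)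
  show "comm_monoid (poly_ring V :: ('v, 'k) polynomial ring)"
    by (rule comm_monoidI) (auto simp: polys_over_mult ac_simps)
qed (auto simp: algebra_simps)

text \<open>
  The linear combinations form an ideal, and every ideal that contains the generators contains them.
\<close>

lemma genideal_mono_polys:
  fixes n :: nat
  assumes V: "\<And>j. j < n \<Longrightarrow> keys (m j) \<subseteq> V"
  shows "genideal (poly_ring V) ((\<lambda>j. mono_poly (m j)) ` {..<n})
    = {\<Sum>j<n. mono_poly (m j) * u j | u. \<forall>j<n. u j \<in> (polys_over V :: ('v, 'k::field) polynomial set)}"
    (is "_ = ?J")
proof -
  let ?R = "poly_ring V :: ('v, 'k) polynomial ring"
  interpret cring ?R by (rule poly_ring_cring)
  have gen: "mono_poly (m j) \<in> (polys_over V :: ('v, 'k) polynomial set)" if "j < n" for j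
    using V[OF that] unfolding mono_poly_def polys_over_def by auto
  have ideal: "ideal ?J ?R"
  proof (rule idealI)
    show "ring ?R" by (rule ring_axioms)
    show "subgroup ?J (add_monoid ?R)"
    proof (rule subgroup.intro)
      show "?J \<subseteq> carrier (add_monoid ?R)"
        by (auto intro!: polys_over_sum polys_over_mult gen)
      show "\<one>\<^bsub>add_monoid ?R\<^esub> \<in> ?J" by (auto intro!: exI[of _ "\<lambda>_. 0"])
      fix x assume "x \<in> ?J"
      then obtain u where u: "x = (\<Sum>j<n. mono_poly (m j) * u j)" "\<forall>j<n. u j \<in> polys_over V" by blast
      have "x \<in> polys_over V" unfolding u(1) using u(2) by (auto intro!: polys_over_sum polys_over_mult gen)
      then have "inv\<^bsub>add_monoid ?R\<^esub> x = - x"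
        by (intro group.inv_equality[OF add.is_group]) (auto intro: polys_over_uminus)
      also have "- x = (\<Sum>j<n. mono_poly (m j) * - u j)" unfolding u(1) by (simp add: sum_negf)
      finally show "inv\<^bsub>add_monoid ?R\<^esub> x \<in> ?J" using u(2) polys_over_uminus by fast
      fix y assume "y \<in> ?J"
      then obtain w where w: "y = (\<Sum>j<n. mono_poly (m j) * w j)" "\<forall>j<n. w j \<in> polys_over V" by blast
      have "x \<otimes>\<^bsub>add_monoid ?R\<^esub> y = (\<Sum>j<n. mono_poly (m j) * (u j + w j))"
        unfolding u(1) w(1) by (simp add: algebra_simps sum.distrib)
      then show "x \<otimes>\<^bsub>add_monoid ?R\<^esub> y \<in> ?J" using u(2) w(2) polys_over_add by fast
    qed
    fix x p assume "x \<in> ?J" and p: "p \<in> carrier ?R"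
    then obtain u where u: "x = (\<Sum>j<n. mono_poly (m j) * u j)" "\<forall>j<n. u j \<in> polys_over V" by blast
    have "p * x = (\<Sum>j<n. mono_poly (m j) * (p * u j))"
      unfolding u(1) by (simp add: sum_distrib_left ac_simps)
    moreover have "\<forall>j<n. p * u j \<in> polys_over V" using u(2) p polys_over_mult by auto
    ultimately have "p * x \<in> ?J" by (intro CollectI exI[of _ "\<lambda>j. p * u j"]) (rule conjI)
    then show "p \<otimes>\<^bsub>?R\<^esub> x \<in> ?J" "x \<otimes>\<^bsub>?R\<^esub> p \<in> ?J" by (simp_all add: mult.commute)
  qed
  show ?thesis
  proof (rule antisym)
    have "mono_poly (m j) \<in> ?J" if j: "j < n" for j
    proof -
      have "mono_poly (m j) = (\<Sum>i<n. mono_poly (m i) * (if i = j then 1 else 0 :: ('v, 'k) polynomial))"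
        using j by (subst sum.mono_neutral_right[of _ "{j}"]) auto
      then show ?thesis by (auto intro!: exI[of _ "\<lambda>i. if i = j then 1 else 0"])
    qed
    then show "genideal ?R ((\<lambda>j. mono_poly (m j)) ` {..<n}) \<subseteq> ?J"
      unfolding genideal_def using ideal by blast
    show "?J \<subseteq> genideal ?R ((\<lambda>j. mono_poly (m j)) ` {..<n})"
      unfolding genideal_def
    proof (intro subsetI InterI)
      fix x K assume "x \<in> ?J" and K: "K \<in> {I. ideal I ?R \<and> (\<lambda>j. mono_poly (m j)) ` {..<n} \<subseteq> I}"
      then obtain u where u: "x = (\<Sum>j<n. mono_poly (m j) * u j)" "\<forall>j<n. u j \<in> polys_over V" by blast
      interpret K: ideal K ?R using K by blast
      have "(\<Sum>j<k. mono_poly (m j) * u j) \<in> K" if "k \<le> n" for k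
        using that
      proof (induction k)
        case 0
        show ?case using K.zero_closed by simp
      next
        case (Suc k)
        have "mono_poly (m k) * u k \<in> K"
        proof -
          have "mono_poly (m k) \<in> K" using K Suc.prems by (auto simp: Suc_le_eq)
          then show ?thesis using K.I_r_closed[of "mono_poly (m k)" "u k"] Suc.prems u(2) by simp
        qed
        then show ?case using K.a_closed[of "\<Sum>j<k. mono_poly (m j) * u j" "mono_poly (m k) * u k"] Suc by simp
      qed
      then show "x \<in> K" unfolding u(1) by blast
    qed
  qed
qed

section \<open>From labelled complexes to free resolutions\<close>

definition dividing_gens :: "nat \<Rightarrow> (nat \<Rightarrow> 'v monomial) \<Rightarrow> 'v monomial \<Rightarrow> nat set" where
  "dividing_gens n m t = {j. j < n \<and> mono_dvd (m j) t}"

text \<open>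
  The last property, that each exponent of an lcm is attained by one of the monomials, is what allows
  divisors of an lcm to be located.
\<close>

lemma lcm_exists:
  assumes "finite A" "\<And>j. j \<in> A \<Longrightarrow> keys (m j) \<subseteq> V"
  shows "\<exists>l. keys l \<subseteq> V \<and> (\<forall>t. mono_dvd l t \<longleftrightarrow> (\<forall>j\<in>A. mono_dvd (m j) t))
    \<and> (\<forall>v. lookup l v \<noteq> 0 \<longrightarrow> (\<exists>j\<in>A. lookup (m j) v = lookup l v))"
  using assms
proof (induction A rule: finite_induct)
  case empty
  then show ?case by (intro exI[of _ 0]) (auto simp: mono_dvd_iff_le)
next
  case (insert j A)
  then obtain l where l: "keys l \<subseteq> V" "\<forall>t. mono_dvd l t \<longleftrightarrow> (\<forall>j\<in>A. mono_dvd (m j) t)"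
    "\<forall>v. lookup l v \<noteq> 0 \<longrightarrow> (\<exists>j\<in>A. lookup (m j) v = lookup l v)" by auto
  show ?case
  proof (intro exI[of _ "mono_lcm (m j) l"] conjI allI impI)
    show "keys (mono_lcm (m j) l) \<subseteq> V"
      using keys_mono_lcm[of "m j" l] insert.prems[of j] l(1) by auto
    show "mono_dvd (mono_lcm (m j) l) t \<longleftrightarrow> (\<forall>j\<in>insert j A. mono_dvd (m j) t)" for t
      using l(2) by (simp add: mono_dvd_lcm_iff)
    fix v assume nz: "lookup (mono_lcm (m j) l) v \<noteq> 0"
    show "\<exists>i\<in>insert j A. lookup (m i) v = lookup (mono_lcm (m j) l) v"
    proof (cases "lookup l v \<le> lookup (m j) v")
      case False
      then show ?thesis using l(3) nz by (auto simp: mono_lcm.rep_eq max_def)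
    qed (auto simp: mono_lcm.rep_eq max_def)
  qed
qed

text \<open>
  The scalar \<open>c i r s\<close> is multiplied by the quotient of the lcms of the labels.  The resulting complex of free
  modules splits into its components in the degrees \<open>t\<close>, and the component in degree \<open>t\<close> is the
  scalar complex over \<open>{j. m j divides t}\<close>.  So kernels and images can be compared degree by degree.
\<close>

lemma set_resolution_realizes:
  fixes c :: "'k::field scalar_mats" and m :: "nat \<Rightarrow> 'v monomial"
  assumes res: "set_resolution n (range (dividing_gens n m)) b A c"
    and V: "\<And>j. j < n \<Longrightarrow> keys (m j) \<subseteq> V"
  shows "\<exists>a d. minimal_free_resolution V
    (genideal (poly_ring V) ((\<lambda>j. mono_poly (m j) :: ('v, 'k) polynomial) ` {..<n})) b a d"
proof -
  let ?C = "range (dividing_gens n m)"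
  note res' = res[unfolded set_resolution_def]
  have b0: "b 0 = 1" and A0: "A 0 0 = {}" and b1: "b 1 = n"
    and A1: "\<And>j. j < n \<Longrightarrow> A 1 j = {j}" and c0: "\<And>j. j < n \<Longrightarrow> c 0 0 j = 1"
    and A_sub: "\<And>i s. s < b i \<Longrightarrow> A i s \<subseteq> {..<n}"
    and strict: "\<And>i. strict_map ?C (b i) (A i) (c i) (b (Suc i)) (A (Suc i))"
    and exact: "\<And>i. exact_at ?C (b i) (c i) (b (Suc i)) (A (Suc i)) (c (Suc i)) (b (Suc (Suc i))) (A (Suc (Suc i)))"
    using res' by simp_all
  have "\<exists>l. keys l \<subseteq> V \<and> (\<forall>t. mono_dvd l t \<longleftrightarrow> B \<subseteq> dividing_gens n m t)" if "B \<subseteq> {..<n}" for B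
  proof -
    have "B \<subseteq> dividing_gens n m t \<longleftrightarrow> (\<forall>j\<in>B. mono_dvd (m j) t)" for t
      using that unfolding dividing_gens_def by auto
    moreover have "keys (m j) \<subseteq> V" if "j \<in> B" for j
      by (rule V) (use that \<open>B \<subseteq> {..<n}\<close> in auto)
    ultimately show ?thesis using lcm_exists[of B m V] finite_subset[OF that] by auto
  qed
  then obtain L where L: "\<And>B. B \<subseteq> {..<n} \<Longrightarrow> keys (L B) \<subseteq> V"
    "\<And>B t. B \<subseteq> {..<n} \<Longrightarrow> mono_dvd (L B) t \<longleftrightarrow> B \<subseteq> dividing_gens n m t"
    by metis
  define l where "l i s = L (A i s)" for i s
  have l_V: "keys (l i s) \<subseteq> V" if "s < b i" for i s
    unfolding l_def by (rule L(1)[OF A_sub[OF that]])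
  have l_dvd: "mono_dvd (l i s) t \<longleftrightarrow> A i s \<subseteq> dividing_gens n m t" if "s < b i" for i s t
    unfolding l_def by (rule L(2)[OF A_sub[OF that]])
  have l00: "l 0 0 = 0"
  proof (rule mono_dvd_antisym)
    show "mono_dvd (l 0 0) 0" using l_dvd[of 0 0 0] b0 A0 by simp
    show "mono_dvd 0 (l 0 0)" by (simp add: mono_dvd_iff_le)
  qed
  have l1: "l 1 j = m j" if "j < n" for j
  proof (rule mono_dvd_antisym)
    show "mono_dvd (l 1 j) (m j)" using l_dvd[of j 1 "m j"] that b1 A1 by (simp add: dividing_gens_def)
    show "mono_dvd (m j) (l 1 j)" using l_dvd[of j 1 "l 1 j"] that b1 A1 by (simp add: dividing_gens_def)
  qed
  have c_dvd: "mono_dvd (l i r) (l (Suc i) s)" "l i r \<noteq> l (Suc i) s"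
    if rsc: "r < b i" "s < b (Suc i)" "c i r s \<noteq> 0" for i r s
  proof -
    have "A i r \<subseteq> A (Suc i) s" using strict[of i, unfolded strict_map_def, rule_format, OF that] by simp
    moreover have "A (Suc i) s \<subseteq> dividing_gens n m (l (Suc i) s)"
      using l_dvd[OF that(2), of "l (Suc i) s"] by simp
    ultimately show "mono_dvd (l i r) (l (Suc i) s)" using l_dvd[OF that(1)] by blast
    obtain t where "A i r \<subseteq> dividing_gens n m t" "\<not> A (Suc i) s \<subseteq> dividing_gens n m t"
      using strict[of i, unfolded strict_map_def, rule_format, OF rsc] by auto
    then have "mono_dvd (l i r) t" "\<not> mono_dvd (l (Suc i) s) t"
      using l_dvd[OF rsc(1)] l_dvd[OF rsc(2)] by auto
    then show "l i r \<noteq> l (Suc i) s" by auto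
  qed
  define d where "d i = mat (b i) (b (Suc i)) (\<lambda>(r, s). Poly_Mapping.single (l (Suc i) s - l i r) (c i r s))" for i
  have d_carrier: "d i \<in> carrier_mat (b i) (b (Suc i))" for i unfolding d_def by simp
  have d_entry: "d i $$ (r, s) = Poly_Mapping.single (l (Suc i) s - l i r) (c i r s)"
    if "r < b i" "s < b (Suc i)" for i r s using that unfolding d_def by simp
  have d_over: "d i $$ (r, s) \<in> polys_over V" if "r < b i" "s < b (Suc i)" for i r s
    using that l_V[of s "Suc i"] keys_diff[of "l (Suc i) s" "l i r"]
    unfolding d_entry[OF that] polys_over_def by (auto simp: in_keys_iff lookup_minus subset_iff)
  \<comment> \<open>The coordinates of the component of \<open>u\<close> in degree \<open>t\<close>.\<close>
  define part where "part i t u s = (if s < b i \<and> mono_dvd (l i s) t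
      then lookup (u $ s) (t - l i s) else 0)"
    for i t and u :: "('v, 'k) polynomial vec" and s
  have part_supp: "supported (b i) (A i) (dividing_gens n m t) (part i t u)" for i t u
    unfolding supported_def part_def using l_dvd by auto
  have app: "(d i *\<^sub>v u) $ r = (\<Sum>s<b (Suc i). d i $$ (r, s) * u $ s)"
    if "u \<in> carrier_vec (b (Suc i))" "r < b i" for i u r
    using that d_carrier[of i] by (auto simp: scalar_prod_def atLeast0LessThan intro!: sum.cong)
  have lookup_app: "lookup ((d i *\<^sub>v u) $ r) t
      = mat_app (c i) (b (Suc i)) (part (Suc i) (t + l i r) u) r"
    if u: "u \<in> carrier_vec (b (Suc i))" and r: "r < b i" for i u r t
    unfolding app[OF u r] lookup_sum mat_app_def
  proof (rule sum.cong)
    fix s assume "s \<in> {..<b (Suc i)}"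
    then have s: "s < b (Suc i)" by simp
    show "lookup (d i $$ (r, s) * u $ s) t = c i r s * part (Suc i) (t + l i r) u s"
    proof (cases "c i r s = 0")
      case True
      then show ?thesis unfolding d_entry[OF r s] by simp
    next
      case False
      have le: "\<And>v. lookup (l i r) v \<le> lookup (l (Suc i) s) v"
        using c_dvd(1)[OF r s False] unfolding mono_dvd_iff_le by blast
      have "mono_dvd (l (Suc i) s - l i r) t \<longleftrightarrow> mono_dvd (l (Suc i) s) (t + l i r)"
        unfolding mono_dvd_iff_le lookup_minus lookup_add by (simp add: le_diff_conv)
      moreover have "t - (l (Suc i) s - l i r) = t + l i r - l (Suc i) s"
        using le by (intro poly_mapping_eqI) (simp add: lookup_minus lookup_add)
      ultimately show ?thesis
        unfolding d_entry[OF r s] lookup_single_mult part_def using s by simp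
    qed
  qed simp
  have app_outside: "mat_app (c i) (b (Suc i)) (part (Suc i) t u) r = 0"
    if r: "r < b i" and nd: "\<not> mono_dvd (l i r) t" for i u r t
    unfolding mat_app_def
  proof (rule sum.neutral, rule ballI)
    fix s assume "s \<in> {..<b (Suc i)}"
    then show "c i r s * part (Suc i) t u s = 0"
      using c_dvd(1)[OF r, of s] nd mono_dvd_trans[of "l i r" "l (Suc i) s" t] unfolding part_def by auto
  qed
  have part_app: "part i t (d i *\<^sub>v u) r = mat_app (c i) (b (Suc i)) (part (Suc i) t u) r"
    if u: "u \<in> carrier_vec (b (Suc i))" and r: "r < b i" for i u r t
  proof (cases "mono_dvd (l i r) t")
    case True
    then have "part i t (d i *\<^sub>v u) r = lookup ((d i *\<^sub>v u) $ r) (t - l i r)"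
      using r by (simp add: part_def)
    then show ?thesis using lookup_app[OF u r, of "t - l i r"] unfolding mono_dvd_diff_add[OF True] by simp
  next
    case False
    then show ?thesis using app_outside[OF r False] unfolding part_def by simp
  qed
  have part_eqI: "u = w" if u: "u \<in> carrier_vec (b i)" "w \<in> carrier_vec (b i)"
    and eq: "\<And>t r. r < b i \<Longrightarrow> part i t u r = part i t w r" for i u w
  proof (rule eq_vecI)
    fix r assume "r < dim_vec w"
    then have r: "r < b i" using u by simp
    show "u $ r = w $ r"
    proof (rule poly_mapping_eqI)
      fix t
      have "mono_dvd (l i r) (t + l i r)" by (simp add: mono_dvd_iff_le lookup_add)
      then show "lookup (u $ r) t = lookup (w $ r) t"
        using eq[OF r, of "t + l i r"] r unfolding part_def by simp
    qed
  qed (use u in auto)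
  have part_zero: "part i t (0\<^sub>v (b i)) r = 0" for i t r unfolding part_def by simp
  have app_carrier: "d i *\<^sub>v u \<in> carrier_vec (b i)" for i u
    using d_carrier[of i] by (auto intro: carrier_vecI)
  have app_free: "d i *\<^sub>v u \<in> free_mod V (b i)" if "u \<in> free_mod V (b (Suc i))" for i u
    unfolding free_mod_def
  proof (intro CollectI conjI allI impI)
    show "d i *\<^sub>v u \<in> carrier_vec (b i)" by (rule app_carrier)
    fix r assume r: "r < b i"
    have u: "u \<in> carrier_vec (b (Suc i))" using that unfolding free_mod_def by simp
    show "(d i *\<^sub>v u) $ r \<in> polys_over V"
      unfolding app[OF u r] using that d_over[OF r]
      by (intro polys_over_sum polys_over_mult) (auto simp: free_mod_def)
  qed
  have ex: "{u \<in> free_mod V (b (Suc i)). d i *\<^sub>v u = 0\<^sub>v (b i)}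
          = (\<lambda>u. d (Suc i) *\<^sub>v u) ` free_mod V (b (Suc (Suc i)))" for i
  proof (rule antisym)
    show "(\<lambda>u. d (Suc i) *\<^sub>v u) ` free_mod V (b (Suc (Suc i))) \<subseteq> {u \<in> free_mod V (b (Suc i)). d i *\<^sub>v u = 0\<^sub>v (b i)}"
    proof
      fix u assume "u \<in> (\<lambda>u. d (Suc i) *\<^sub>v u) ` free_mod V (b (Suc (Suc i)))"
      then obtain z where z: "z \<in> free_mod V (b (Suc (Suc i)))" and uz: "u = d (Suc i) *\<^sub>v z" by blast
      have zc: "z \<in> carrier_vec (b (Suc (Suc i)))" using z unfolding free_mod_def by simp
      have u: "u \<in> free_mod V (b (Suc i))" unfolding uz by (rule app_free[OF z])
      have uc: "u \<in> carrier_vec (b (Suc i))" using u unfolding free_mod_def by simp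
      have "d i *\<^sub>v u = 0\<^sub>v (b i)"
      proof (rule part_eqI[of _ i])
        fix t r assume r: "r < b i"
        have "part i t (d i *\<^sub>v u) r
            = (\<Sum>q<b (Suc i). c i r q * (\<Sum>s<b (Suc (Suc i)). c (Suc i) q s * part (Suc (Suc i)) t z s))"
          unfolding part_app[OF uc r] mat_app_def
          by (intro sum.cong refl arg_cong2[where f = "(*)"]) (simp add: uz part_app[OF zc] mat_app_def)
        also have "\<dots> = (\<Sum>q<b (Suc i). \<Sum>s<b (Suc (Suc i)). c i r q * c (Suc i) q s * part (Suc (Suc i)) t z s)"
          by (simp add: sum_distrib_left mult.assoc)
        also have "\<dots> = (\<Sum>s<b (Suc (Suc i)). \<Sum>q<b (Suc i). c i r q * c (Suc i) q s * part (Suc (Suc i)) t z s)"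
          by (rule sum.swap)
        also have "\<dots> = (\<Sum>s<b (Suc (Suc i)). (\<Sum>q<b (Suc i). c i r q * c (Suc i) q s) * part (Suc (Suc i)) t z s)"
          by (simp add: sum_distrib_right)
        also have "\<dots> = 0"
        proof (rule sum.neutral, rule ballI)
          fix s assume "s \<in> {..<b (Suc (Suc i))}"
          then have "(\<Sum>q<b (Suc i). c i r q * c (Suc i) q s) = 0"
            using exact[of i] r unfolding exact_at_def by blast
          then show "(\<Sum>q<b (Suc i). c i r q * c (Suc i) q s) * part (Suc (Suc i)) t z s = 0" by simp
        qed
        finally show "part i t (d i *\<^sub>v u) r = part i t (0\<^sub>v (b i)) r" unfolding part_zero .
      qed (use app_carrier in auto)
      then show "u \<in> {u \<in> free_mod V (b (Suc i)). d i *\<^sub>v u = 0\<^sub>v (b i)}" using u by simp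
    qed
    show "{u \<in> free_mod V (b (Suc i)). d i *\<^sub>v u = 0\<^sub>v (b i)} \<subseteq> (\<lambda>u. d (Suc i) *\<^sub>v u) ` free_mod V (b (Suc (Suc i)))"
    proof
      fix u assume "u \<in> {u \<in> free_mod V (b (Suc i)). d i *\<^sub>v u = 0\<^sub>v (b i)}"
      then have u: "u \<in> free_mod V (b (Suc i))" and zero: "d i *\<^sub>v u = 0\<^sub>v (b i)" by auto
      have uc: "u \<in> carrier_vec (b (Suc i))" using u unfolding free_mod_def by simp
      have "\<exists>w. supported (b (Suc (Suc i))) (A (Suc (Suc i))) (dividing_gens n m t) w
          \<and> (\<forall>q<b (Suc i). part (Suc i) t u q = mat_app (c (Suc i)) (b (Suc (Suc i))) w q)
          \<and> ((\<forall>q. part (Suc i) t u q = 0) \<longrightarrow> w = (\<lambda>_. 0))" for t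
      proof (cases "\<forall>q. part (Suc i) t u q = 0")
        case True
        then show ?thesis by (intro exI[of _ "\<lambda>_. 0"]) (auto simp: supported_def mat_app_def)
      next
        case False
        have "mat_app (c i) (b (Suc i)) (part (Suc i) t u) r = 0" if "r < b i" for r
          using part_app[OF uc that, of t] unfolding zero part_zero by simp
        then have "part (Suc i) t u \<in> kernel_at (b i) (c i) (b (Suc i)) (A (Suc i)) (dividing_gens n m t)"
          unfolding kernel_at_def using part_supp by blast
        moreover have "dividing_gens n m t \<in> ?C" by blast
        ultimately show ?thesis using exact[of i] False unfolding exact_at_def by blast
      qed
      then obtain W where W: "\<And>t. supported (b (Suc (Suc i))) (A (Suc (Suc i))) (dividing_gens n m t) (W t)"
        "\<And>t q. q < b (Suc i) \<Longrightarrow> part (Suc i) t u q = mat_app (c (Suc i)) (b (Suc (Suc i))) (W t) q"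
        "\<And>t. (\<forall>q. part (Suc i) t u q = 0) \<Longrightarrow> W t = (\<lambda>_. 0)" by metis
      define T where "T = (\<Union>s<b (Suc i). (\<lambda>k. k + l (Suc i) s) ` keys (u $ s))"
      have finT: "finite T" unfolding T_def by auto
      have T_V: "keys t \<subseteq> V" if tT: "t \<in> T" for t
      proof -
        obtain s k where sk: "s < b (Suc i)" "k \<in> keys (u $ s)" "t = k + l (Suc i) s"
          using tT unfolding T_def by blast
        have "keys k \<subseteq> V" using u sk(1,2) unfolding free_mod_def polys_over_def by auto
        then show ?thesis unfolding sk(3) using keys_add[of k "l (Suc i) s"] l_V[OF sk(1)] by blast
      qed
      have W_T: "t \<in> T" if Wts: "W t s \<noteq> 0" for t s
      proof -
        have "\<not> (\<forall>q. part (Suc i) t u q = 0)"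
        proof
          assume "\<forall>q. part (Suc i) t u q = 0"
          from W(3)[OF this] show False using Wts by simp
        qed
        then obtain q where q: "part (Suc i) t u q \<noteq> 0" by blast
        then have q': "q < b (Suc i)" "mono_dvd (l (Suc i) q) t" "t - l (Suc i) q \<in> keys (u $ q)"
          unfolding part_def in_keys_iff by (auto split: if_splits)
        have "t = (t - l (Suc i) q) + l (Suc i) q" using mono_dvd_diff_add[OF q'(2)] by simp
        then have "t \<in> (\<lambda>k. k + l (Suc i) q) ` keys (u $ q)" using q'(3) by (rule image_eqI)
        then show ?thesis unfolding T_def using q'(1) by blast
      qed
      \<comment> \<open>Assemble the preimages \<open>W t\<close>; only the finitely many degrees in \<open>T\<close> contribute.\<close>
      define z where "z = vec (b (Suc (Suc i))) (\<lambda>s. Abs_poly_mapping (\<lambda>k. W (k + l (Suc (Suc i)) s) s))"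
      have zc: "z \<in> carrier_vec (b (Suc (Suc i)))" unfolding z_def by simp
      have z_lookup: "lookup (z $ s) k = W (k + l (Suc (Suc i)) s) s"
        if s: "s < b (Suc (Suc i))" for s k
      proof -
        have "finite ((\<lambda>k. k + l (Suc (Suc i)) s) -` T)" by (rule finite_vimageI[OF finT]) (simp add: inj_def)
        then have "finite {k. W (k + l (Suc (Suc i)) s) s \<noteq> 0}"
          by (rule finite_subset[rotated]) (use W_T in auto)
        then show ?thesis unfolding z_def using s by simp
      qed
      have part_z: "part (Suc (Suc i)) t z = W t" for t
      proof
        fix s
        show "part (Suc (Suc i)) t z s = W t s"
        proof (cases "s < b (Suc (Suc i)) \<and> mono_dvd (l (Suc (Suc i)) s) t")
          case True
          then have s: "s < b (Suc (Suc i))" and st: "mono_dvd (l (Suc (Suc i)) s) t" by auto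
          show ?thesis
            using z_lookup[OF s, of "t - l (Suc (Suc i)) s"] s st
            unfolding part_def mono_dvd_diff_add[OF st] by simp
        next
          case False
          then have "W t s = 0" using W(1)[of t] l_dvd[of s "Suc (Suc i)"] unfolding supported_def by blast
          then show ?thesis using False unfolding part_def by auto
        qed
      qed
      have "z \<in> free_mod V (b (Suc (Suc i)))"
        unfolding free_mod_def polys_over_def
      proof (intro CollectI conjI allI impI ballI)
        show "z \<in> carrier_vec (b (Suc (Suc i)))" by (rule zc)
        fix s k assume s: "s < b (Suc (Suc i))" and k: "k \<in> keys (z $ s)"
        have "W (k + l (Suc (Suc i)) s) s \<noteq> 0" using k z_lookup[OF s, of k] unfolding in_keys_iff by simp
        then have "k + l (Suc (Suc i)) s \<in> T" by (rule W_T)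
        from T_V[OF this] show "keys k \<subseteq> V" by (auto simp: in_keys_iff lookup_add)
      qed
      moreover have "d (Suc i) *\<^sub>v z = u"
        by (rule part_eqI[of _ "Suc i"]) (use uc app_carrier W(2) in \<open>auto simp: part_app[OF zc] part_z\<close>)
      ultimately show "u \<in> (\<lambda>u. d (Suc i) *\<^sub>v u) ` free_mod V (b (Suc (Suc i)))" by blast
    qed
  qed
  have d0: "(d 0 *\<^sub>v u) $ 0 = (\<Sum>j<n. mono_poly (m j) * u $ j)" if u: "u \<in> free_mod V n" for u
  proof -
    have uc: "u \<in> carrier_vec (b (Suc 0))" using u b1 unfolding free_mod_def by simp
    have "d 0 $$ (0, j) = mono_poly (m j)" if "j < n" for j
      using d_entry[of 0 0 j] that b0 b1 l00 l1[OF that] c0[OF that] unfolding mono_poly_def by simp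
    then show ?thesis using app[OF uc, of 0] b0 b1 by simp
  qed
  have "{(d 0 *\<^sub>v u) $ 0 | u. u \<in> free_mod V (b 1)}
      = {\<Sum>j<n. mono_poly (m j) * u j | u. \<forall>j<n. u j \<in> polys_over V}" (is "?X = ?Y")
  proof (rule antisym)
    show "?X \<subseteq> ?Y"
    proof
      fix x assume "x \<in> ?X"
      then obtain u where u: "u \<in> free_mod V n" "x = (d 0 *\<^sub>v u) $ 0" unfolding b1 by blast
      have "x = (\<Sum>j<n. mono_poly (m j) * u $ j)" using d0[OF u(1)] u(2) by simp
      moreover have "\<forall>j<n. u $ j \<in> polys_over V" using u(1) unfolding free_mod_def by simp
      ultimately show "x \<in> ?Y" by blast
    qed
    show "?Y \<subseteq> ?X"
    proof
      fix x assume "x \<in> ?Y"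
      then obtain u where u: "x = (\<Sum>j<n. mono_poly (m j) * u j)" "\<forall>j<n. u j \<in> polys_over V" by blast
      have v: "vec n u \<in> free_mod V n" using u(2) unfolding free_mod_def by simp
      have "x = (d 0 *\<^sub>v vec n u) $ 0" unfolding d0[OF v] u(1) by simp
      then show "x \<in> ?X" using v unfolding b1 by blast
    qed
  qed
  then have ideal: "{(d 0 *\<^sub>v u) $ 0 | u. u \<in> free_mod V (b 1)}
      = genideal (poly_ring V) ((\<lambda>j. mono_poly (m j) :: ('v, 'k) polynomial) ` {..<n})"
    using genideal_mono_polys[of n m V, OF V, symmetric] by (rule trans)
  have deg: "mono_deg t + mono_deg (l i r) = mono_deg (l (Suc i) s)"
    if rs: "r < b i" "s < b (Suc i)" and t: "t \<in> keys (d i $$ (r, s))" for i r s t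
  proof -
    have c: "c i r s \<noteq> 0" and t': "t = l (Suc i) s - l i r"
      using t unfolding d_entry[OF rs] by (auto split: if_splits)
    show ?thesis unfolding t' mono_deg_add[symmetric] mono_dvd_diff_add[OF c_dvd(1)[OF rs c]] ..
  qed
  have const: "lookup (d i $$ (r, s)) 0 = 0" if rs: "r < b i" "s < b (Suc i)" for i r s
  proof (cases "c i r s = 0")
    case False
    have "l (Suc i) s - l i r \<noteq> 0"
      using mono_dvd_diff_add[OF c_dvd(1)[OF rs False]] c_dvd(2)[OF rs False] by auto
    then show ?thesis unfolding d_entry[OF rs] by (simp add: lookup_single)
  qed (simp add: d_entry[OF rs])
  show ?thesis
    unfolding minimal_free_resolution_def
  proof (intro exI[of _ "\<lambda>i s. mono_deg (l i s)"] exI[of _ d] conjI)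
    show "b 0 = 1" by (rule b0)
    show "mono_deg (l 0 0) = 0" unfolding l00 by (simp add: mono_deg_def)
    show "\<forall>i. d i \<in> carrier_mat (b i) (b (Suc i))" using d_carrier by blast
    show "\<forall>i. \<forall>r<b i. \<forall>c<b (Suc i). d i $$ (r, c) \<in> polys_over V" using d_over by simp
    show "\<forall>i. \<forall>r<b i. \<forall>c<b (Suc i). \<forall>t\<in>keys (d i $$ (r, c)). mono_deg t + mono_deg (l i r) = mono_deg (l (Suc i) c)"
      using deg by simp
    show "\<forall>i. \<forall>r<b i. \<forall>c<b (Suc i). lookup (d i $$ (r, c)) 0 = 0" using const by simp
    show "{(d 0 *\<^sub>v u) $ 0 | u. u \<in> free_mod V (b 1)}
      = genideal (poly_ring V) ((\<lambda>j. mono_poly (m j) :: ('v, 'k) polynomial) ` {..<n})" by (rule ideal)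
    show "\<forall>i. {u \<in> free_mod V (b (Suc i)). d i *\<^sub>v u = 0\<^sub>v (b i)}
          = (\<lambda>u. d (Suc i) *\<^sub>v u) ` free_mod V (b (Suc (Suc i)))" using ex by (rule allI)
  qed
qed

lemma betti_via_set_resolution:
  fixes c :: "'k::field scalar_mats"
  assumes "set_resolution n (range (dividing_gens n m)) b A c"
    and "\<And>j. j < n \<Longrightarrow> keys (m j) \<subseteq> V"
  shows "betti V (genideal (poly_ring V) ((\<lambda>j. mono_poly (m j) :: ('v, 'k) polynomial) ` {..<n})) i
    = (if i < 0 then 0 else b (nat i))"
  using set_resolution_realizes[OF assms] betti_eq by metis

section \<open>Resolutions that start with a graph on the generators\<close>

definition list_ranks :: "nat list \<Rightarrow> nat \<Rightarrow> nat" where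
  "list_ranks xs i = (if i < length xs then xs ! i else 0)"

text \<open>
  For the family of all sets \<open>{j. m j divides t}\<close> this holds if and only if no generator is 1 and no generator
  divides another one.
\<close>

definition has_points :: "nat \<Rightarrow> nat set set \<Rightarrow> bool" where
  "has_points n \<C> \<longleftrightarrow> \<C> \<subseteq> Pow {..<n} \<and> {} \<in> \<C> \<and> (\<forall>j<n. {j} \<in> \<C>)"

text \<open>
  Start with the map that sends every generator to the basis element of degree 0.  It is minimal:
  over the singleton \<open>{s}\<close> its kernel is zero.
\<close>

lemma set_resolution_exists:
  assumes "has_points n \<C>"
  shows "\<exists>b A (c :: 'k::field scalar_mats). set_resolution n \<C> b A c"
proof -
  define b where "b i = (if i = 0 then 1 else n)" for i :: nat
  define A where "A i s = (if i = 0 then {} else {s})" for i s :: nat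
  have C: "{} \<in> \<C>" "\<And>j. j < n \<Longrightarrow> {j} \<in> \<C>" using assms unfolding has_points_def by auto
  have "minimal_at \<C> 1 (\<lambda>_ _. 1 :: 'k) n (\<lambda>s. {s})"
    unfolding minimal_at_def
  proof (intro ballI allI impI)
    fix S s and w :: "nat \<Rightarrow> 'k"
    assume S: "S \<in> \<C>" and w: "w \<in> kernel_at 1 (\<lambda>_ _. 1) n (\<lambda>s. {s}) S" and ws: "w s \<noteq> 0"
    have supp: "\<And>q. w q \<noteq> 0 \<Longrightarrow> q < n \<and> q \<in> S" and sum: "(\<Sum>q<n. w q) = 0"
      using w unfolding kernel_at_def supported_def mat_app_def by auto
    have "S \<noteq> {s}"
    proof
      assume "S = {s}"
      then have "w q = 0" if "q \<noteq> s" for q using supp[of q] that by blast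
      then have "(\<Sum>q<n. w q) = (\<Sum>q\<in>{s}. w q)"
        using supp[OF ws] by (intro sum.mono_neutral_right) auto
      then show False using sum ws by simp
    qed
    then show "\<exists>S'\<in>\<C>. {s} \<subseteq> S' \<and> \<not> S \<subseteq> S'" using supp[OF ws] C(2)[of s] by (intro bexI[of _ "{s}"]) auto
  qed
  then have part: "partial_resolution 0 n \<C> b A (\<lambda>_ _ _. 1 :: 'k)"
    using C unfolding partial_resolution_def b_def A_def strict_map_def by (auto simp: le_Suc_eq)
  have fam: "\<C> \<subseteq> Pow {..<n}" using assms unfolding has_points_def by simp
  show ?thesis by (rule partial_resolution_extends[OF fam part]) (intro exI)
qed

definition incidence :: "(nat \<times> nat) list \<Rightarrow> 'k::field scalar_mat" where
  "incidence es q s = of_bool (q = fst (es ! s)) - of_bool (q = snd (es ! s))"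

definition edge_label :: "(nat \<times> nat) list \<Rightarrow> nat \<Rightarrow> nat set" where
  "edge_label es s = {fst (es ! s), snd (es ! s)}"

definition adjacent :: "(nat \<times> nat) list \<Rightarrow> nat \<Rightarrow> nat \<Rightarrow> bool" where
  "adjacent es i j \<longleftrightarrow> (i, j) \<in> set es \<or> (j, i) \<in> set es"

text \<open>
  A list \<open>es\<close> of edges on the generators, standing for syzygies between pairs of them.  Within every
  member of \<open>\<C>\<close> two generators are joined by a path of at most two edges.  This is more than connectedness, but it
  holds in all the applications and is easier to check.
\<close>

locale connecting_graph =
  fixes n :: nat and \<C> :: "nat set set" and es :: "(nat \<times> nat) list"
  assumes family: "has_points n \<C>"
    and edges: "\<And>i j. (i, j) \<in> set es \<Longrightarrow> i < n \<and> j < n \<and> i \<noteq> j"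
    and connected: "\<And>S i j. S \<in> \<C> \<Longrightarrow> i \<in> S \<Longrightarrow> j \<in> S \<Longrightarrow> i \<noteq> j \<Longrightarrow>
      adjacent es i j \<or> (\<exists>k\<in>S. adjacent es i k \<and> adjacent es k j)"
begin

lemma edge_nth:
  assumes "s < length es"
  shows "fst (es ! s) < n" "snd (es ! s) < n" "fst (es ! s) \<noteq> snd (es ! s)"
  using edges[of "fst (es ! s)" "snd (es ! s)"] assms by auto

lemma boundary_of_edge:
  assumes "adjacent es i j" "i \<in> S" "j \<in> S"
  shows "\<exists>w :: nat \<Rightarrow> 'k::field. supported (length es) (edge_label es) S w
    \<and> (\<forall>q. mat_app (incidence es) (length es) w q = of_bool (q = i) - of_bool (q = j))"
proof -
  have "\<exists>s<length es. es ! s = (i, j) \<or> es ! s = (j, i)"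
    using assms(1) unfolding adjacent_def in_set_conv_nth by blast
  then obtain s where s: "s < length es" "es ! s = (i, j) \<or> es ! s = (j, i)" by blast
  define a where "a = (if es ! s = (i, j) then 1 else - 1 :: 'k)"
  define w where "w q = (if q = s then a else 0)" for q
  have "mat_app (incidence es) (length es) w q = incidence es q s * a" for q
    unfolding mat_app_def w_def using s(1) by (simp add: if_distrib[of "\<lambda>x. _ * x"] cong: if_cong)
  moreover have "incidence es q s * a = of_bool (q = i) - of_bool (q = j)" for q
  proof (cases "es ! s = (i, j)")
    case False
    then have "es ! s = (j, i)" using s(2) by simp
    then show ?thesis using False by (simp add: incidence_def a_def)
  qed (simp add: incidence_def a_def)
  moreover have "supported (length es) (edge_label es) S w"
    using s assms(2,3) unfolding supported_def w_def edge_label_def by auto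
  ultimately show ?thesis by auto
qed

text \<open>
  The difference of two generators in \<open>S\<close> is a boundary: add up the edges of a path inside \<open>S\<close>.
\<close>

lemma boundary_of_pair:
  assumes S: "S \<in> \<C>" "i \<in> S" "j \<in> S"
  shows "\<exists>w :: nat \<Rightarrow> 'k::field. supported (length es) (edge_label es) S w
    \<and> (\<forall>q. mat_app (incidence es) (length es) w q = of_bool (q = i) - of_bool (q = j))"
proof -
  consider "i = j" | "adjacent es i j" | k where "k \<in> S" "adjacent es i k" "adjacent es k j"
    using connected[OF S] by blast
  then show ?thesis
  proof cases
    case 1
    then show ?thesis by (intro exI[of _ "\<lambda>_. 0"]) (auto simp: supported_def mat_app_def)
  next
    case 2
    then show ?thesis by (rule boundary_of_edge[OF _ S(2,3)])
  next
    case 3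
    obtain w :: "nat \<Rightarrow> 'k" where w: "supported (length es) (edge_label es) S w"
      "\<And>q. mat_app (incidence es) (length es) w q = of_bool (q = i) - of_bool (q = k)"
      using boundary_of_edge[OF 3(2) S(2) 3(1)] by blast
    obtain v :: "nat \<Rightarrow> 'k" where v: "supported (length es) (edge_label es) S v"
      "\<And>q. mat_app (incidence es) (length es) v q = of_bool (q = k) - of_bool (q = j)"
      using boundary_of_edge[OF 3(3) 3(1) S(3)] by blast
    have "supported (length es) (edge_label es) S (\<lambda>s. w s - - 1 * v s)"
      using w(1) v(1) unfolding supported_def by (metis add_0 diff_minus_eq_add mult_minus1)
    moreover have "mat_app (incidence es) (length es) (\<lambda>s. w s - - 1 * v s) q
        = of_bool (q = i) - of_bool (q = j)" for q
      unfolding mat_app_diff w(2) v(2) by simp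
    ultimately show ?thesis by blast
  qed
qed

text \<open>
  A vector on \<open>S\<close> with coordinate sum zero is a combination of differences to a fixed element of \<open>S\<close>.
\<close>

lemma incidence_exact:
  "exact_at \<C> 1 (\<lambda>_ _. 1 :: 'k::field) n (\<lambda>j. {j}) (incidence es) (length es) (edge_label es)"
  unfolding exact_at_def
proof (intro conjI allI impI ballI)
  fix s assume "s < length es"
  then have "(\<Sum>q<n. incidence es q s :: 'k) = 0"
    using edge_nth[of s] unfolding incidence_def by (simp add: sum_subtractf of_bool_def)
  then show "(\<Sum>q<n. 1 * incidence es q s :: 'k) = 0" by simp
next
  fix S and u :: "nat \<Rightarrow> 'k" assume S: "S \<in> \<C>" and u: "u \<in> kernel_at 1 (\<lambda>_ _. 1) n (\<lambda>j. {j}) S"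
  have supp: "\<And>q. u q \<noteq> 0 \<Longrightarrow> q < n \<and> q \<in> S" and sum: "(\<Sum>q<n. u q) = 0"
    using u unfolding kernel_at_def supported_def mat_app_def by auto
  have Sn: "S \<subseteq> {..<n}" using S family unfolding has_points_def by auto
  then have finS: "finite S" by (rule finite_subset) simp
  have sumS: "(\<Sum>j\<in>S. u j) = 0"
    unfolding sum[symmetric] using Sn supp by (intro sum.mono_neutral_left) auto
  show "\<exists>w. supported (length es) (edge_label es) S w
      \<and> (\<forall>q<n. u q = mat_app (incidence es) (length es) w q)"
  proof (cases "S = {}")
    case True
    then have "u = (\<lambda>_. 0)" using supp by auto
    then show ?thesis by (intro exI[of _ "\<lambda>_. 0"]) (auto simp: supported_def mat_app_def)
  next
    case False
    then obtain i where i: "i \<in> S" by blast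
    have "\<forall>j\<in>S. \<exists>w :: nat \<Rightarrow> 'k. supported (length es) (edge_label es) S w
        \<and> (\<forall>q. mat_app (incidence es) (length es) w q = of_bool (q = j) - of_bool (q = i))"
      using boundary_of_pair[OF S _ i] by blast
    then obtain W :: "'k scalar_mat" where W: "\<And>j. j \<in> S \<Longrightarrow> supported (length es) (edge_label es) S (W j)"
      "\<And>j q. j \<in> S \<Longrightarrow> mat_app (incidence es) (length es) (W j) q = of_bool (q = j) - of_bool (q = i)"
      by metis
    define w where "w s = (\<Sum>j\<in>S. u j * W j s)" for s
    have "supported (length es) (edge_label es) S w"
      unfolding supported_def
    proof (intro allI impI)
      fix s assume "w s \<noteq> 0"
      then obtain j where "j \<in> S" "u j * W j s \<noteq> 0" unfolding w_def by (meson sum.neutral)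
      then show "s < length es \<and> edge_label es s \<subseteq> S" using W(1) unfolding supported_def by auto
    qed
    moreover have "u q = mat_app (incidence es) (length es) w q" for q
    proof -
      have "mat_app (incidence es) (length es) w q
          = (\<Sum>j\<in>S. u j * mat_app (incidence es) (length es) (W j) q)"
        unfolding mat_app_def w_def sum_distrib_left by (subst sum.swap) (simp add: ac_simps)
      also have "\<dots> = (\<Sum>j\<in>S. u j * (of_bool (q = j) - of_bool (q = i)))"
        by (intro sum.cong) (simp_all add: W(2))
      also have "\<dots> = (\<Sum>j\<in>S. u j * of_bool (q = j)) - (\<Sum>j\<in>S. u j) * of_bool (q = i)"
        by (simp only: right_diff_distrib sum_subtractf sum_distrib_right)
      also have "(\<Sum>j\<in>S. u j * of_bool (q = j)) = (if q \<in> S then u q else 0)"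
        using finS by (simp add: of_bool_def if_distrib[of "\<lambda>x. _ * x"] cong: if_cong)
      also have "\<dots> = u q" using supp by auto
      finally show ?thesis unfolding sumS by simp
    qed
    ultimately show ?thesis by blast
  qed
qed

lemma incidence_strict:
  "strict_map \<C> n (\<lambda>j. {j}) (incidence es :: 'k::field scalar_mat) (length es) (edge_label es)"
  unfolding strict_map_def
proof (intro allI impI)
  fix r s assume r: "r < n" and s: "s < length es" and nz: "(incidence es r s :: 'k) \<noteq> 0"
  have "r \<in> edge_label es s" using nz unfolding incidence_def edge_label_def by auto
  moreover have "\<not> edge_label es s \<subseteq> {r}" using edge_nth(3)[OF s] unfolding edge_label_def by auto
  moreover have "{r} \<in> \<C>" using family r unfolding has_points_def by auto
  ultimately show "{r} \<subseteq> edge_label es s \<and> (\<exists>S\<in>\<C>. {r} \<subseteq> S \<and> \<not> edge_label es s \<subseteq> S)" by blast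
qed

lemma edge_label_subset: "s < length es \<Longrightarrow> edge_label es s \<subseteq> {..<n}"
  using edge_nth unfolding edge_label_def by auto

lemma graph_resolution:
  assumes "minimal_at \<C> n (incidence es :: 'k::field scalar_mat) (length es) (edge_label es)"
  obtains b A and c :: "'k::field scalar_mats" where "set_resolution n \<C> b A c"
    "b 0 = 1" "b 1 = n" "b 2 = length es"
    "(\<And>S u s. S \<in> \<C> \<Longrightarrow> u \<in> kernel_at n (incidence es :: 'k::field scalar_mat) (length es) (edge_label es) S
        \<Longrightarrow> u s = 0) \<Longrightarrow> \<forall>i>2. b i = 0"
proof -
  define b where "b i = [1, n, length es] ! i" for i
  define A where "A i = [\<lambda>_. {}, \<lambda>j. {j}, edge_label es] ! i" for i
  define c where "c i = [\<lambda>_ _. 1, incidence es :: 'k scalar_mat] ! i" for i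
  have emp: "{} \<in> \<C>" and fam: "\<C> \<subseteq> Pow {..<n}" using family unfolding has_points_def by auto
  have simps: "b 0 = 1" "b (Suc 0) = n" "b (Suc (Suc 0)) = length es"
    "A 0 = (\<lambda>_. {})" "A (Suc 0) = (\<lambda>j. {j})" "A (Suc (Suc 0)) = edge_label es"
    "c 0 = (\<lambda>_ _. 1)" "c (Suc 0) = (incidence es :: 'k scalar_mat)"
    unfolding b_def A_def c_def by simp_all
  have strict0: "strict_map \<C> 1 (\<lambda>_. {}) (\<lambda>_ _. 1 :: 'k) n (\<lambda>j. {j})"
    unfolding strict_map_def using emp by auto
  have part: "partial_resolution 1 n \<C> b A c"
    unfolding partial_resolution_def using assms strict0 incidence_strict incidence_exact edge_label_subset
    by (auto simp: simps le_Suc_eq)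
  show thesis
  proof (rule partial_resolution_extends[OF fam part])
    fix b' A' and c'' :: "'k scalar_mats"
    assume res: "set_resolution n \<C> b' A' c''" and agree: "\<And>i. i \<le> Suc 1 \<Longrightarrow> b' i = b i"
      and zero: "(\<And>S u s. S \<in> \<C> \<Longrightarrow> u \<in> kernel_at (b 1) (c 1) (b (Suc 1)) (A (Suc 1)) S \<Longrightarrow> u s = 0)
        \<Longrightarrow> \<forall>i>Suc 1. b' i = 0"
    show thesis
    proof (rule that[OF res])
      show "b' 0 = 1" "b' 1 = n" "b' 2 = length es"
        using agree[of 0] agree[of 1] agree[of 2] by (simp_all add: simps numeral_2_eq_2)
      assume "\<And>S u s. S \<in> \<C> \<Longrightarrow> u \<in> kernel_at n (incidence es :: 'k scalar_mat) (length es) (edge_label es) S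
        \<Longrightarrow> u s = 0"
      then show "\<forall>i>2. b' i = 0" using zero by (simp add: simps numeral_2_eq_2)
    qed
  qed
qed

text \<open>
  If the edges are members of \<open>\<C>\<close> and pairwise different, then over an edge the only basis element is that edge
  itself, and its boundary is nonzero.  This is minimality, so the edges form a basis in degree 2.
\<close>

lemma resolution_with_edges:
  assumes closed: "\<And>s. s < length es \<Longrightarrow> edge_label es s \<in> \<C>"
    and inj: "inj_on (edge_label es) {..<length es}"
  shows "\<exists>b A (c :: 'k::field scalar_mats). set_resolution n \<C> b A c \<and> b 1 = n \<and> b 2 = length es"
proof -
  have "minimal_at \<C> n (incidence es :: 'k scalar_mat) (length es) (edge_label es)"
    unfolding minimal_at_def
  proof (intro ballI allI impI)
    fix S s and w :: "nat \<Rightarrow> 'k"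
    assume S: "S \<in> \<C>" and w: "w \<in> kernel_at n (incidence es) (length es) (edge_label es) S" and ws: "w s \<noteq> 0"
    have supp: "\<And>q. w q \<noteq> 0 \<Longrightarrow> q < length es \<and> edge_label es q \<subseteq> S"
      and zero: "\<And>q. q < n \<Longrightarrow> (\<Sum>s<length es. incidence es q s * w s) = 0"
      using w unfolding kernel_at_def supported_def mat_app_def by auto
    have s: "s < length es" and sS: "edge_label es s \<subseteq> S" using supp[OF ws] by auto
    have "S \<noteq> edge_label es s"
    proof
      assume eq: "S = edge_label es s"
      have only: "q = s" if "w q \<noteq> 0" for q
      proof -
        have "edge_label es q \<subseteq> edge_label es s" "q < length es" using supp[OF that] eq by auto
        then have "edge_label es q = edge_label es s"
          using edge_nth(3)[of q] edge_nth(3)[OF s] unfolding edge_label_def by auto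
        then show ?thesis using inj s \<open>q < length es\<close> by (auto dest: inj_onD)
      qed
      have "(\<Sum>q<length es. incidence es (fst (es ! s)) q * w q) = (\<Sum>q\<in>{s}. incidence es (fst (es ! s)) q * w q)"
      proof (rule sum.mono_neutral_right)
        show "\<forall>q\<in>{..<length es} - {s}. incidence es (fst (es ! s)) q * w q = 0" using only by fastforce
      qed (use s in auto)
      also have "\<dots> = w s" using edge_nth(3)[OF s] unfolding incidence_def by simp
      finally show False using zero[OF edge_nth(1)[OF s]] ws by simp
    qed
    then show "\<exists>S'\<in>\<C>. edge_label es s \<subseteq> S' \<and> \<not> S \<subseteq> S'" using sS closed[OF s] by blast
  qed
  then show ?thesis
  proof (rule graph_resolution)
    fix b A and c :: "'k scalar_mats"
    assume "set_resolution n \<C> b A c" "b 1 = n" "b 2 = length es"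
    then show ?thesis by blast
  qed
qed

text \<open>
  The graph is a forest over each member of \<open>\<C>\<close>, and the resolution stops after the edges.
\<close>

lemma two_stage_ranks:
  assumes triv: "\<And>S u s. S \<in> \<C> \<Longrightarrow>
      u \<in> kernel_at n (incidence es :: 'k::field scalar_mat) (length es) (edge_label es) S \<Longrightarrow> u s = 0"
  shows "\<exists>A (c :: 'k scalar_mats). set_resolution n \<C> (list_ranks [1, n, length es]) A c"
proof -
  have "minimal_at \<C> n (incidence es :: 'k scalar_mat) (length es) (edge_label es)"
    unfolding minimal_at_def using triv by blast
  then show ?thesis
  proof (rule graph_resolution)
    fix b A and c :: "'k scalar_mats"
    assume res: "set_resolution n \<C> b A c" and b: "b 0 = 1" "b 1 = n" "b 2 = length es"
      and zero: "(\<And>S u s. S \<in> \<C> \<Longrightarrow> u \<in> kernel_at n (incidence es :: 'k scalar_mat) (length es) (edge_label es) S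
        \<Longrightarrow> u s = 0) \<Longrightarrow> \<forall>i>2. b i = 0"
    have b2: "\<forall>i>2. b i = 0" by (rule zero) (rule triv)
    have "b = list_ranks [1, n, length es]"
    proof
      fix i :: nat
      consider "i = 0" | "i = 1" | "i = 2" | "i > 2" by linarith
      then show "b i = list_ranks [1, n, length es] i" using b b2 by cases (auto simp: list_ranks_def)
    qed
    then show ?thesis using res by blast
  qed
qed

lemma three_stage_ranks:
  fixes c' :: "'k::field scalar_mat"
  assumes exact: "exact_at \<C> n (incidence es) (length es) (edge_label es) c' f A'"
    and strict: "strict_map \<C> (length es) (edge_label es) c' f A'"
    and sub: "\<And>s. s < f \<Longrightarrow> A' s \<subseteq> {..<n}"
    and triv: "\<And>S u s. S \<in> \<C> \<Longrightarrow> u \<in> kernel_at (length es) c' f A' S \<Longrightarrow> u s = 0"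
  shows "\<exists>A (c :: 'k scalar_mats). set_resolution n \<C> (list_ranks [1, n, length es, f]) A c"
proof -
  define b where "b i = [1, n, length es, f] ! i" for i
  define A where "A i = [\<lambda>_. {}, \<lambda>j. {j}, edge_label es, A'] ! i" for i
  define c where "c i = [\<lambda>_ _. 1, incidence es, c'] ! i" for i
  have emp: "{} \<in> \<C>" and fam: "\<C> \<subseteq> Pow {..<n}" using family unfolding has_points_def by auto
  have simps: "b 0 = 1" "b (Suc 0) = n" "b (Suc (Suc 0)) = length es" "b (Suc (Suc (Suc 0))) = f"
    "A 0 = (\<lambda>_. {})" "A (Suc 0) = (\<lambda>j. {j})" "A (Suc (Suc 0)) = edge_label es" "A (Suc (Suc (Suc 0))) = A'"
    "c 0 = (\<lambda>_ _. 1)" "c (Suc 0) = (incidence es :: 'k scalar_mat)" "c (Suc (Suc 0)) = c'"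
    unfolding b_def A_def c_def by simp_all
  have strict0: "strict_map \<C> 1 (\<lambda>_. {}) (\<lambda>_ _. 1 :: 'k) n (\<lambda>j. {j})"
    unfolding strict_map_def using emp by auto
  have min: "minimal_at \<C> (length es) c' f A'" unfolding minimal_at_def using triv by blast
  have part: "partial_resolution (Suc (Suc 0)) n \<C> b A c"
    unfolding partial_resolution_def
    using min exact strict sub strict0 incidence_strict incidence_exact edge_label_subset
    by (auto simp: simps le_Suc_eq less_Suc_eq)
  show ?thesis
  proof (rule partial_resolution_extends[OF fam part, unfolded simps])
    fix b' A'' and c'' :: "'k scalar_mats"
    assume res: "set_resolution n \<C> b' A'' c''" and agree: "\<And>i. i \<le> Suc (Suc (Suc 0)) \<Longrightarrow> b' i = b i"
      and zero: "(\<And>S u s. S \<in> \<C> \<Longrightarrow> u \<in> kernel_at (length es) c' f A' S \<Longrightarrow> u s = 0)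
        \<Longrightarrow> \<forall>i>Suc (Suc (Suc 0)). b' i = 0"
    have zero': "\<forall>i>Suc (Suc (Suc 0)). b' i = 0" by (rule zero) (rule triv)
    have "b' = list_ranks [1, n, length es, f]"
    proof
      fix i :: nat
      show "b' i = list_ranks [1, n, length es, f] i"
        using agree zero' by (cases "i \<le> Suc (Suc (Suc 0))") (auto simp: list_ranks_def b_def)
    qed
    then show ?thesis using res by blast
  qed
qed

end

section \<open>Explicit resolutions for three and four generators\<close>

lemma sum_upto_numeral:
  "(\<Sum>s<(2::nat). f s) = f 0 + f 1" "(\<Sum>s<(4::nat). f s) = f 0 + f 1 + f 2 + f 3"
  "(\<Sum>s<(5::nat). f s) = f 0 + f 1 + f 2 + f 3 + f 4"
  for f :: "nat \<Rightarrow> 'k::field"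
  by (simp_all add: eval_nat_numeral)

lemma less_numeral_cases:
  "(i::nat) < 2 \<longleftrightarrow> i = 0 \<or> i = 1" "(i::nat) < 3 \<longleftrightarrow> i = 0 \<or> i = 1 \<or> i = 2"
  "(i::nat) < 4 \<longleftrightarrow> i = 0 \<or> i = 1 \<or> i = 2 \<or> i = 3"
  "(i::nat) < 5 \<longleftrightarrow> i = 0 \<or> i = 1 \<or> i = 2 \<or> i = 3 \<or> i = 4"
  by linarith+

text \<open>
  The syzygies of the pairs \<open>(0, 1)\<close> and \<open>(1, 2)\<close> suffice, and a path graph has no cycles.
\<close>

lemma ranks_three_generators:
  assumes family: "has_points 3 \<C>" and bridge: "\<And>S. S \<in> \<C> \<Longrightarrow> 0 \<in> S \<Longrightarrow> 2 \<in> S \<Longrightarrow> 1 \<in> S"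
  shows "\<exists>A (c :: 'k::field scalar_mats). set_resolution 3 \<C> (list_ranks [1, 3, 2]) A c"
proof -
  define es :: "(nat \<times> nat) list" where "es = [(0, 1), (1, 2)]"
  have len: "length es = 2" unfolding es_def by simp
  have sub: "\<And>S i. S \<in> \<C> \<Longrightarrow> i \<in> S \<Longrightarrow> i = 0 \<or> i = 1 \<or> i = 2"
    using family unfolding has_points_def less_numeral_cases(2)[symmetric] by blast
  interpret connecting_graph 3 \<C> es
  proof
    fix S i j assume "S \<in> \<C>" "i \<in> S" "j \<in> S" "i \<noteq> j"
    then show "adjacent es i j
        \<or> (\<exists>k\<in>S. adjacent es i k \<and> adjacent es k j)"
      using sub[of S i] sub[of S j] bridge[of S] unfolding adjacent_def es_def by auto
  qed (use family in \<open>auto simp: es_def\<close>)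
  have triv: "u s = 0"
    if u: "u \<in> kernel_at 3 (incidence es :: 'k scalar_mat) (length es) (edge_label es) S" for S u s
  proof -
    have app: "\<And>q. q < 3 \<Longrightarrow> mat_app (incidence es) 2 u q = 0" and supp: "\<And>s. u s \<noteq> 0 \<Longrightarrow> s < 2"
      using u unfolding kernel_at_def supported_def len by auto
    have "u 0 = 0" "u 1 = 0"
      using app[of 0] app[of 2] unfolding mat_app_def sum_upto_numeral by (auto simp: incidence_def es_def)
    then show ?thesis using supp[of s] by (auto simp: less_numeral_cases)
  qed
  show ?thesis by (rule two_stage_ranks[unfolded len]) (rule triv[unfolded len])
qed

text \<open>
  The syzygies of the four sides of a square suffice, because the diagonals are covered by the two
  closure conditions.  The only cycle is the whole square, and it needs all four generators.
\<close>

lemma ranks_four_cycle: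
  assumes family: "has_points 4 \<C>"
    and closed: "{0, 1} \<in> \<C>" "{1, 2} \<in> \<C>" "{2, 3} \<in> \<C>" "{0, 3} \<in> \<C>"
    and bridge1: "\<And>S. S \<in> \<C> \<Longrightarrow> 0 \<in> S \<Longrightarrow> 2 \<in> S \<Longrightarrow> 1 \<in> S"
    and bridge2: "\<And>S. S \<in> \<C> \<Longrightarrow> 1 \<in> S \<Longrightarrow> 3 \<in> S \<Longrightarrow> 2 \<in> S"
  shows "\<exists>A (c :: 'k::field scalar_mats). set_resolution 4 \<C> (list_ranks [1, 4, 4, 1]) A c"
proof -
  define es :: "(nat \<times> nat) list" where "es = [(0, 1), (1, 2), (2, 3), (3, 0)]"
  have len: "length es = 4" unfolding es_def by simp
  have sub: "\<And>S i. S \<in> \<C> \<Longrightarrow> i \<in> S \<Longrightarrow> i = 0 \<or> i = 1 \<or> i = 2 \<or> i = 3"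
    using family unfolding has_points_def less_numeral_cases(3)[symmetric] by blast
  interpret connecting_graph 4 \<C> es
  proof
    fix S i j assume "S \<in> \<C>" "i \<in> S" "j \<in> S" "i \<noteq> j"
    then show "adjacent es i j \<or> (\<exists>k\<in>S. adjacent es i k \<and> adjacent es k j)"
      using sub[of S i] sub[of S j] bridge1[of S] bridge2[of S] unfolding adjacent_def es_def by auto
  qed (use family in \<open>auto simp: es_def\<close>)
  have lab: "edge_label es 0 = {0, 1}" "edge_label es 1 = {1, 2}" "edge_label es 2 = {2, 3}" "edge_label es 3 = {0, 3}"
    unfolding edge_label_def es_def by auto
  let ?A = "\<lambda>_::nat. {0, 1, 2, 3::nat}"
  have exact: "exact_at \<C> 4 (incidence es :: 'k scalar_mat) (length es) (edge_label es) (\<lambda>_ _. 1) 1 ?A"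
    unfolding exact_at_def len
  proof (intro conjI allI impI ballI)
    fix r :: nat assume "r < 4"
    then show "(\<Sum>q<4. incidence es r q * 1 :: 'k) = 0"
      unfolding sum_upto_numeral by (auto simp: incidence_def es_def less_numeral_cases)
  next
    fix S and u :: "nat \<Rightarrow> 'k" assume "S \<in> \<C>" and u: "u \<in> kernel_at 4 (incidence es) 4 (edge_label es) S"
    have app: "\<And>q. q < 4 \<Longrightarrow> mat_app (incidence es) 4 u q = 0"
      and supp: "\<And>s. u s \<noteq> 0 \<Longrightarrow> edge_label es s \<subseteq> S"
      using u unfolding kernel_at_def supported_def by auto
    have eq: "u 1 = u 0" "u 2 = u 0" "u 3 = u 0"
      using app[of 1] app[of 2] app[of 3] unfolding mat_app_def sum_upto_numeral by (auto simp: incidence_def es_def)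
    show "\<exists>w. supported 1 ?A S w \<and> (\<forall>q<4. u q = mat_app (\<lambda>_ _. 1) 1 w q)"
    proof (intro exI[of _ "\<lambda>s. if s = 0 then u 0 else 0"] conjI)
      show "supported 1 ?A S (\<lambda>s. if s = 0 then u 0 else 0)"
        using supp[of 0] supp[of 2] eq unfolding supported_def lab by auto
      show "\<forall>q<4. u q = mat_app (\<lambda>_ _. 1) 1 (\<lambda>s. if s = 0 then u 0 else 0) q"
        using eq by (auto simp: mat_app_def less_numeral_cases)
    qed
  qed
  have strict: "strict_map \<C> (length es) (edge_label es) (\<lambda>_ _. 1 :: 'k) 1 ?A"
    unfolding strict_map_def len
  proof (intro allI impI)
    fix r s :: nat assume "r < 4"
    then have r: "r = 0 \<or> r = 1 \<or> r = 2 \<or> r = 3" unfolding less_numeral_cases .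
    have "edge_label es r \<in> \<C>" using r by (elim disjE) (simp_all only: lab closed)
    moreover have "edge_label es r \<subseteq> {0, 1, 2, 3}" using r by (elim disjE) (simp_all only: lab, auto)
    moreover have "\<not> {0, 1, 2, 3} \<subseteq> edge_label es r" using r by (elim disjE) (simp_all only: lab, auto)
    ultimately show "edge_label es r \<subseteq> {0, 1, 2, 3} \<and> (\<exists>S\<in>\<C>. edge_label es r \<subseteq> S \<and> \<not> {0, 1, 2, 3} \<subseteq> S)" by blast
  qed
  have triv: "u s = 0" if "u \<in> kernel_at (length es) (\<lambda>_ _. 1 :: 'k) 1 ?A S" for S u s
  proof -
    have "mat_app (\<lambda>_ _. 1) 1 u 0 = 0" "u s \<noteq> 0 \<Longrightarrow> s < 1"
      using that unfolding kernel_at_def supported_def len by auto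
    then show ?thesis unfolding mat_app_def by (cases "s = 0") auto
  qed
  show ?thesis
  proof (rule three_stage_ranks[OF exact strict, unfolded len])
    show "u s = 0" if "u \<in> kernel_at 4 (\<lambda>_ _. 1 :: 'k) 1 ?A S" for S u s by (rule triv[unfolded len, OF that])
  qed auto
qed

text \<open>
  The graph is a square with the diagonal from 1 to 3, whose cycles are generated by the two triangles
  \<open>0, 1, 3\<close> and \<open>1, 2, 3\<close>.  The condition on \<open>1\<close> covers the other diagonal.
\<close>

lemma ranks_two_triangles:
  assumes family: "has_points 4 \<C>"
    and closed: "{0, 1} \<in> \<C>" "{1, 2} \<in> \<C>" "{2, 3} \<in> \<C>" "{0, 3} \<in> \<C>" "{1, 3} \<in> \<C>"
    and bridge: "\<And>S. S \<in> \<C> \<Longrightarrow> 0 \<in> S \<Longrightarrow> 2 \<in> S \<Longrightarrow> 1 \<in> S"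
  shows "\<exists>A (c :: 'k::field scalar_mats). set_resolution 4 \<C> (list_ranks [1, 4, 5, 2]) A c"
proof -
  define es :: "(nat \<times> nat) list" where "es = [(1, 0), (1, 3), (1, 2), (0, 3), (2, 3)]"
  have len: "length es = 5" unfolding es_def by simp
  have sub: "\<And>S i. S \<in> \<C> \<Longrightarrow> i \<in> S \<Longrightarrow> i = 0 \<or> i = 1 \<or> i = 2 \<or> i = 3"
    using family unfolding has_points_def less_numeral_cases(3)[symmetric] by blast
  interpret connecting_graph 4 \<C> es
  proof
    fix S i j assume "S \<in> \<C>" "i \<in> S" "j \<in> S" "i \<noteq> j"
    then show "adjacent es i j \<or> (\<exists>k\<in>S. adjacent es i k \<and> adjacent es k j)"
      using sub[of S i] sub[of S j] bridge[of S] unfolding adjacent_def es_def by auto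
  qed (use family in \<open>auto simp: es_def\<close>)
  have lab: "edge_label es 0 = {0, 1}" "edge_label es 1 = {1, 3}" "edge_label es 2 = {1, 2}"
    "edge_label es 3 = {0, 3}" "edge_label es 4 = {2, 3}"
    unfolding edge_label_def es_def by auto
  \<comment> \<open>The columns are the two triangles, written in terms of the edges.\<close>
  define c :: "'k scalar_mat" where "c q s = [[1, 0], [- 1, - 1], [0, 1], [1, 0], [0, 1]] ! q ! s" for q s
  define A where "A s = [{0, 1, 3}, {1, 2, 3 :: nat}] ! s" for s
  have exact: "exact_at \<C> 4 (incidence es) (length es) (edge_label es) c 2 A"
    unfolding exact_at_def len
  proof (intro conjI allI impI ballI)
    fix r s :: nat assume "r < 4" "s < 2"
    then show "(\<Sum>q<5. incidence es r q * c q s) = 0"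
      unfolding sum_upto_numeral c_def by (auto simp: incidence_def es_def less_numeral_cases)
  next
    fix S and u :: "nat \<Rightarrow> 'k" assume "S \<in> \<C>" and u: "u \<in> kernel_at 4 (incidence es) 5 (edge_label es) S"
    have app: "\<And>q. q < 4 \<Longrightarrow> mat_app (incidence es) 5 u q = 0"
      and supp: "\<And>s. u s \<noteq> 0 \<Longrightarrow> edge_label es s \<subseteq> S"
      using u unfolding kernel_at_def supported_def by auto
    have eq: "u 3 = u 0" "u 0 + u 1 + u 2 = 0" "u 4 = u 2"
      using app[of 0] app[of 1] app[of 2] unfolding mat_app_def sum_upto_numeral by (auto simp: incidence_def es_def)
    have eq1: "u 1 = - u 0 - u 2" using eq(2) by (simp add: algebra_simps eq_neg_iff_add_eq_0)
    let ?w = "\<lambda>s. if s = 0 then u 0 else if s = 1 then u 2 else 0"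
    show "\<exists>w. supported 2 A S w \<and> (\<forall>q<5. u q = mat_app c 2 w q)"
    proof (intro exI[of _ ?w] conjI)
      show "supported 2 A S ?w"
        using supp[of 0] supp[of 3] supp[of 2] supp[of 4] unfolding supported_def lab A_def eq(1,3) by auto
      show "\<forall>q<5. u q = mat_app c 2 ?w q"
        using eq(1,3) eq1 unfolding mat_app_def sum_upto_numeral c_def by (auto simp: less_numeral_cases)
    qed
  qed
  have strict: "strict_map \<C> (length es) (edge_label es) c 2 A"
    unfolding strict_map_def len
  proof (intro allI impI)
    fix r s :: nat assume "r < 5" "s < 2" "c r s \<noteq> 0"
    then have r: "r = 0 \<or> r = 1 \<or> r = 2 \<or> r = 3 \<or> r = 4" and s: "s = 0 \<or> s = 1"
      and nz: "c r s \<noteq> 0" unfolding less_numeral_cases .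
    have A: "A 0 = {0, 1, 3}" "A 1 = {1, 2, 3}" unfolding A_def by simp_all
    have "edge_label es r \<in> \<C>" using r by (elim disjE) (simp_all only: lab closed)
    moreover have "\<not> A s \<subseteq> edge_label es r" using r s by (elim disjE) (simp_all only: lab A, auto)
    moreover have "edge_label es r \<subseteq> A s"
      using r s nz by (elim disjE) (simp_all only: lab A, auto simp: c_def)
    ultimately show "edge_label es r \<subseteq> A s \<and> (\<exists>S\<in>\<C>. edge_label es r \<subseteq> S \<and> \<not> A s \<subseteq> S)" by blast
  qed
  have triv: "u s = 0" if u: "u \<in> kernel_at (length es) c 2 A S" for S u s
  proof -
    have app: "\<And>q. q < 5 \<Longrightarrow> mat_app c 2 u q = 0" and supp: "\<And>s. u s \<noteq> 0 \<Longrightarrow> s < 2"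
      using u unfolding kernel_at_def supported_def len by auto
    have "u 0 = 0" "u 1 = 0"
      using app[of 0] app[of 2] unfolding mat_app_def sum_upto_numeral by (auto simp: c_def)
    then show ?thesis using supp[of s] by (auto simp: less_numeral_cases)
  qed
  have sub: "A s \<subseteq> {..<4}" if "s < 2" for s using that by (auto simp: A_def less_numeral_cases)
  show ?thesis
  proof (rule three_stage_ranks[OF exact strict, unfolded len])
    show "u s = 0" if "u \<in> kernel_at 5 c 2 A S" for S u s by (rule triv[unfolded len, OF that])
  qed (rule sub)
qed

section \<open>Cyclically arranged generators and their bridges\<close>

definition prev_index :: "nat \<Rightarrow> nat \<Rightarrow> nat" where
  "prev_index n j = (j + (n - 1)) mod n"

definition next_index :: "nat \<Rightarrow> nat \<Rightarrow> nat" where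
  "next_index n j = (j + 1) mod n"

lemma prev_index_if: "j < n \<Longrightarrow> prev_index n j = (if j = 0 then n - 1 else j - 1)"
proof (cases j)
  case (Suc i)
  assume "j < n"
  then have "j + (n - 1) = n + i" "i < n" using Suc by auto
  then show ?thesis using Suc unfolding prev_index_def by simp
qed (simp add: prev_index_def)

lemma next_index_if: "j < n \<Longrightarrow> next_index n j = (if j + 1 = n then 0 else j + 1)"
  unfolding next_index_def by auto

lemma prev_index_less: "j < n \<Longrightarrow> prev_index n j < n"
  and next_index_less: "j < n \<Longrightarrow> next_index n j < n"
  unfolding prev_index_def next_index_def by auto

lemma prev_neq_next: "n \<ge> 3 \<Longrightarrow> j < n \<Longrightarrow> prev_index n j \<noteq> next_index n j"
  by (auto simp: prev_index_if next_index_if)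

lemma prev_neq_self: "n \<ge> 2 \<Longrightarrow> j < n \<Longrightarrow> prev_index n j \<noteq> j"
  and next_neq_self: "n \<ge> 2 \<Longrightarrow> j < n \<Longrightarrow> next_index n j \<noteq> j"
  by (auto simp: prev_index_if next_index_if)

lemma prev_next_index: "i < n \<Longrightarrow> prev_index n (next_index n i) = i"
  by (auto simp: prev_index_if next_index_if next_index_less)

lemma next_prev_index: "i < n \<Longrightarrow> next_index n (prev_index n i) = i"
  by (auto simp: prev_index_if next_index_if prev_index_less)

text \<open>
  Generator \<open>j\<close> shares its first variable at most with its predecessor and its second variable at most
  with its successor, where indices are read modulo \<open>n\<close>.  The edges of a cycle are arranged in this way, and
  so are those of a path, where the first and the last edge have no variable in common.
\<close>

definition cyclic_gens :: "nat \<Rightarrow> (nat \<Rightarrow> 'v monomial) \<Rightarrow> bool" where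
  "cyclic_gens n m \<longleftrightarrow> n \<ge> 3 \<and> (\<forall>j<n. \<exists>x y. keys (m j) = {x, y}
     \<and> (\<forall>i<n. i \<noteq> j \<longrightarrow> (x \<in> keys (m i) \<longrightarrow> i = prev_index n j)
          \<and> (y \<in> keys (m i) \<longrightarrow> i = next_index n j)))"

definition bridge :: "nat \<Rightarrow> (nat \<Rightarrow> 'v monomial) \<Rightarrow> nat \<Rightarrow> bool" where
  "bridge n m j \<longleftrightarrow> mono_dvd (m j) (mono_lcm (m (prev_index n j)) (m (next_index n j)))"

text \<open>
  The sets of generators that contain a bridge from \<open>B\<close> as soon as they contain its two neighbours.
\<close>

definition bridge_family :: "nat \<Rightarrow> nat set \<Rightarrow> nat set set" where
  "bridge_family n B = {S. S \<subseteq> {..<n} \<and> (\<forall>j\<in>B. prev_index n j \<in> S \<and> next_index n j \<in> S \<longrightarrow> j \<in> S)}"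

lemma bridge_familyD:
  "S \<in> bridge_family n B \<Longrightarrow> j \<in> B \<Longrightarrow> prev_index n j \<in> S \<Longrightarrow> next_index n j \<in> S \<Longrightarrow> j \<in> S"
  unfolding bridge_family_def by simp

text \<open>
  If \<open>m j\<close> divides the lcm of a set that does not contain \<open>j\<close>, then each of its two variables occurs with
  sufficient exponent in some element of the set.  The only candidates are the two neighbours, so
  both belong to the set and \<open>j\<close> is a bridge.
\<close>

lemma dividing_gens_family:
  assumes cyc: "cyclic_gens n m"
  shows "range (dividing_gens n m) = bridge_family n {j. j < n \<and> bridge n m j}"
proof (rule antisym; rule subsetI)
  fix S assume "S \<in> range (dividing_gens n m)"
  then obtain t where S: "S = dividing_gens n m t" by blast
  have "j \<in> S" if j: "j < n" "bridge n m j" and pn: "prev_index n j \<in> S" "next_index n j \<in> S" for j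
  proof -
    have "mono_dvd (mono_lcm (m (prev_index n j)) (m (next_index n j))) t"
      using pn unfolding S dividing_gens_def mono_dvd_lcm_iff by simp
    from mono_dvd_trans[OF j(2)[unfolded bridge_def] this] show ?thesis
      using j(1) unfolding S dividing_gens_def by simp
  qed
  moreover have "S \<subseteq> {..<n}" unfolding S dividing_gens_def by auto
  ultimately show "S \<in> bridge_family n {j. j < n \<and> bridge n m j}"
    unfolding bridge_family_def by blast
next
  fix S assume S: "S \<in> bridge_family n {j. j < n \<and> bridge n m j}"
  then have Sn: "S \<subseteq> {..<n}" unfolding bridge_family_def by simp
  obtain l where l: "\<And>t. mono_dvd l t \<longleftrightarrow> (\<forall>j\<in>S. mono_dvd (m j) t)"
    "\<And>v. lookup l v \<noteq> 0 \<Longrightarrow> \<exists>j\<in>S. lookup (m j) v = lookup l v"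
    using lcm_exists[of S m UNIV] finite_subset[OF Sn] by auto
  have "j \<in> S" if j: "j < n" and dvd: "mono_dvd (m j) l" for j
  proof (rule ccontr)
    assume jS: "j \<notin> S"
    from cyc[unfolded cyclic_gens_def, THEN conjunct2, THEN spec, THEN mp, OF j]
    obtain x y where keys: "keys (m j) = {x, y}"
      and nb: "\<forall>i<n. i \<noteq> j \<longrightarrow> (x \<in> keys (m i) \<longrightarrow> i = prev_index n j)
          \<and> (y \<in> keys (m i) \<longrightarrow> i = next_index n j)" by (elim exE conjE)
    have attained: "\<exists>i\<in>S. i \<noteq> j \<and> i < n \<and> v \<in> keys (m i)
        \<and> lookup (m j) v \<le> lookup (m i) v" if v: "v \<in> keys (m j)" for v
    proof -
      have le: "lookup (m j) v \<le> lookup l v" "lookup (m j) v \<noteq> 0"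
        using dvd v unfolding mono_dvd_iff_le in_keys_iff by auto
      then obtain i where i: "i \<in> S" "lookup (m i) v = lookup l v"
        using l(2)[of v] by auto
      then show ?thesis using le jS Sn unfolding in_keys_iff by (intro bexI[OF _ i(1)]) auto
    qed
    have x: "prev_index n j \<in> S \<and> lookup (m j) x \<le> lookup (m (prev_index n j)) x"
    proof -
      have "x \<in> keys (m j)" unfolding keys by simp
      from attained[OF this] obtain i where i: "i \<in> S" "i \<noteq> j" "i < n" "x \<in> keys (m i)"
        "lookup (m j) x \<le> lookup (m i) x" by (elim bexE conjE)
      then have "i = prev_index n j" using nb by simp
      then show ?thesis using i by simp
    qed
    have y: "next_index n j \<in> S \<and> lookup (m j) y \<le> lookup (m (next_index n j)) y"
    proof -
      have "y \<in> keys (m j)" unfolding keys by simp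
      from attained[OF this] obtain i where i: "i \<in> S" "i \<noteq> j" "i < n" "y \<in> keys (m i)"
        "lookup (m j) y \<le> lookup (m i) y" by (elim bexE conjE)
      then have "i = next_index n j" using nb by simp
      then show ?thesis using i by simp
    qed
    have "bridge n m j"
      unfolding bridge_def mono_dvd_iff_le mono_lcm.rep_eq
    proof
      fix v
      show "lookup (m j) v
          \<le> max (lookup (m (prev_index n j)) v) (lookup (m (next_index n j)) v)"
      proof (cases "v \<in> {x, y}")
        case True
        then show ?thesis using x y by auto
      next
        case False
        then have "v \<notin> keys (m j)" unfolding keys .
        then have "lookup (m j) v = 0" by (simp add: in_keys_iff)
        then show ?thesis by simp
      qed
    qed
    then show False using S x y j jS unfolding bridge_family_def by simp
  qed
  moreover have "mono_dvd (m j) l" if "j \<in> S" for j using l(1)[of l] that by simp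
  ultimately have "S = dividing_gens n m l" using Sn unfolding dividing_gens_def by blast
  then show "S \<in> range (dividing_gens n m)" by blast
qed

text \<open>
  A closure condition has two different premises, so it says nothing about sets with fewer than two elements.
\<close>

lemma bridge_family_has_points:
  assumes "n \<ge> 3" "B \<subseteq> {..<n}" shows "has_points n (bridge_family n B)"
proof -
  have "{j} \<in> bridge_family n B" if "j < n" for j
    using prev_neq_next[OF assms(1)] assms(2) that unfolding bridge_family_def by fastforce
  then show ?thesis unfolding has_points_def bridge_family_def by auto
qed

section \<open>The second Betti number\<close>

text \<open>
  For \<open>n \<ge> 5\<close> these are the pairs of generators whose syzygy is not generated by smaller ones.  The syzygy of the two neighbours of a bridge
  is the sum of the syzygies of the bridge with either of them.
\<close>

definition essential_pairs :: "nat \<Rightarrow> nat set \<Rightarrow> (nat \<times> nat) set" where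
  "essential_pairs n B =
     {(i, j). i < j \<and> j < n \<and> \<not> (\<exists>k\<in>B. {i, j} = {prev_index n k, next_index n k})}"

lemma finite_essential_pairs: "finite (essential_pairs n B)"
  by (rule finite_subset[of _ "{..<n} \<times> {..<n}"]) (auto simp: essential_pairs_def)

text \<open>
  With at least five generators a generator and its neighbour never are the two neighbours of a
  third one.  Hence the neighbours of a bridge are connected through the bridge by essential pairs.  An essential pair
  belongs to the bridge family, since it cannot contain both neighbours of a bridge.
\<close>

lemma resolution_essential_pairs:
  assumes n: "n \<ge> 5" and B: "B \<subseteq> {..<n}"
  shows "\<exists>b A (c :: 'k::field scalar_mats). set_resolution n (bridge_family n B) b A c
    \<and> b 1 = n \<and> b 2 = card (essential_pairs n B)"
proof -
  obtain es where es: "set es = essential_pairs n B" "distinct es"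
    using finite_distinct_list[OF finite_essential_pairs] by blast
  have adj: "adjacent es i j \<longleftrightarrow> i \<noteq> j \<and> i < n \<and> j < n \<and> \<not> (\<exists>k\<in>B. {i, j} = {prev_index n k, next_index n k})" for i j
  proof -
    have "{i, j} = {j, i}" by (rule insert_commute)
    then show ?thesis unfolding adjacent_def es(1) essential_pairs_def by (cases i j rule: linorder_cases) auto
  qed
  have adj_sym: "adjacent es i j \<longleftrightarrow> adjacent es j i" for i j unfolding adjacent_def by blast
  have side: "{prev_index n k, k} \<noteq> {prev_index n k', next_index n k'}"
    "{k, next_index n k} \<noteq> {prev_index n k', next_index n k'}" if "k < n" "k' < n" for k k'
    using n that by (auto simp: prev_index_if next_index_if doubleton_eq_iff split: if_splits)
  interpret connecting_graph n "bridge_family n B" es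
  proof
    show "has_points n (bridge_family n B)" by (rule bridge_family_has_points) (use n B in auto)
    show "i < n \<and> j < n \<and> i \<noteq> j" if "(i, j) \<in> set es" for i j
      using that unfolding es(1) essential_pairs_def by auto
    fix S i j assume S: "S \<in> bridge_family n B" and ij: "i \<in> S" "j \<in> S" "i \<noteq> j"
    have lt: "i < n" "j < n" using S ij unfolding bridge_family_def by auto
    show "adjacent es i j \<or> (\<exists>k\<in>S. adjacent es i k \<and> adjacent es k j)"
    proof (cases "\<exists>k\<in>B. {i, j} = {prev_index n k, next_index n k}")
      case False
      then show ?thesis unfolding adj using ij lt by blast
    next
      case True
      then obtain k where k: "k \<in> B" "{i, j} = {prev_index n k, next_index n k}" by blast
      have kn: "k < n" using k(1) B by auto
      have "{prev_index n k, next_index n k} \<subseteq> S" unfolding k(2)[symmetric] using ij by simp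
      then have "k \<in> S" using S k(1) unfolding bridge_family_def by simp
      have B': "k' < n" if "k' \<in> B" for k' using B that by auto
      have a1: "adjacent es (prev_index n k) k"
        unfolding adj
      proof (intro conjI notI)
        show False if "prev_index n k = k" using that prev_neq_self[OF _ kn] n by simp
        show False if "\<exists>k'\<in>B. {prev_index n k, k} = {prev_index n k', next_index n k'}"
          using that
        proof (rule bexE)
          fix k' assume "k' \<in> B" "{prev_index n k, k} = {prev_index n k', next_index n k'}"
          then show False using side(1)[OF kn B'] by simp
        qed
      qed (use prev_index_less[OF kn] kn in auto)
      have a2: "adjacent es k (next_index n k)"
        unfolding adj
      proof (intro conjI notI)
        show False if "k = next_index n k" using that next_neq_self[OF _ kn] n by simp
        show False if "\<exists>k'\<in>B. {k, next_index n k} = {prev_index n k', next_index n k'}"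
          using that
        proof (rule bexE)
          fix k' assume "k' \<in> B" "{k, next_index n k} = {prev_index n k', next_index n k'}"
          then show False using side(2)[OF kn B'] by simp
        qed
      qed (use next_index_less[OF kn] kn in auto)
      have "(i = prev_index n k \<and> j = next_index n k) \<or> (i = next_index n k \<and> j = prev_index n k)"
        using k(2) by (simp only: doubleton_eq_iff)
      then have "adjacent es i k \<and> adjacent es k j"
        using a1 a2 adj_sym[of k "prev_index n k"] adj_sym[of k "next_index n k"] by auto
      then show ?thesis using \<open>k \<in> S\<close> by (intro disjI2 bexI[of _ k])
    qed
  qed
  have nth: "fst (es ! s) < snd (es ! s)" "snd (es ! s) < n"
    "\<not> (\<exists>k\<in>B. edge_label es s = {prev_index n k, next_index n k})" if "s < length es" for s
    using nth_mem[OF that] unfolding es(1) essential_pairs_def edge_label_def by auto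
  have "edge_label es s \<in> bridge_family n B" if s: "s < length es" for s
  proof -
    have False if k: "k \<in> B" "prev_index n k \<in> edge_label es s" "next_index n k \<in> edge_label es s" for k
    proof -
      have "prev_index n k \<noteq> next_index n k" using k(1) B n by (intro prev_neq_next) auto
      then have "edge_label es s = {prev_index n k, next_index n k}"
        using k(2,3) unfolding edge_label_def by auto
      then show False using nth(3)[OF s] k(1) by blast
    qed
    then show ?thesis using nth(1,2)[OF s] unfolding bridge_family_def edge_label_def by force
  qed
  moreover have "inj_on (edge_label es) {..<length es}"
  proof (rule inj_onI)
    fix s s' assume s: "s \<in> {..<length es}" "s' \<in> {..<length es}" and eq: "edge_label es s = edge_label es s'"
    have "es ! s = es ! s'"
      using nth(1)[of s] nth(1)[of s'] s eq unfolding edge_label_def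
      by (intro prod_eqI) (auto simp: doubleton_eq_iff)
    then show "s = s'" using es(2) s by (simp add: nth_eq_iff_index_eq)
  qed
  moreover have "length es = card (essential_pairs n B)" using es distinct_card by metis
  ultimately show ?thesis using resolution_with_edges[where 'k = 'k] by simp
qed

text \<open>
  The pair that is lost only if \<open>0\<close> is a bridge consists of the neighbours \<open>1\<close> and \<open>n - 1\<close> of \<open>0\<close>.
  With at least five generators these are the neighbours of no other index.
\<close>

lemma essential_pairs_all_less:
  assumes n: "n \<ge> 5" and B: "B \<subseteq> {..<n}" "0 \<notin> B"
  shows "card (essential_pairs n {..<n}) < card (essential_pairs n B)"
proof (rule psubset_card_mono[OF finite_essential_pairs])
  have "(1, n - 1) \<notin> essential_pairs n {..<n}"
    using n unfolding essential_pairs_def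
    by (auto simp: prev_index_if next_index_if insert_commute intro!: bexI[of _ 0])
  moreover have "(1, n - 1) \<in> essential_pairs n B"
  proof -
    have "k = 0" if "k < n" "{1, n - 1} = {prev_index n k, next_index n k}" for k
      using n that by (auto simp: prev_index_if next_index_if doubleton_eq_iff split: if_splits)
    then have "{1, n - 1} \<noteq> {prev_index n k, next_index n k}" if "k \<in> B" for k
      using B that by (metis lessThan_iff subsetD)
    then show ?thesis using n unfolding essential_pairs_def by simp
  qed
  moreover have "essential_pairs n {..<n} \<subseteq> essential_pairs n B"
    unfolding essential_pairs_def
  proof (intro subsetI, clarify)
    fix i j k assume a: "\<not> (\<exists>k\<in>{..<n}. {i, j} = {prev_index n k, next_index n k})"
      and k: "k \<in> B" and e: "{i, j} = {prev_index n k, next_index n k}"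
    show False by (rule notE[OF a], rule bexI[of _ k], rule e, rule subsetD[OF B(1) k])
  qed
  ultimately show "essential_pairs n {..<n} \<subset> essential_pairs n B" by blast
qed

section \<open>Bridge families for three and four generators\<close>

lemma index_3: "prev_index 3 1 = 0" "next_index 3 1 = 2"
  by (simp_all add: prev_index_def next_index_def)

lemma resolution_bridge_family_3:
  assumes "1 \<in> B" "B \<subseteq> {..<3}"
  shows "\<exists>A (c :: 'k::field scalar_mats). set_resolution 3 (bridge_family 3 B) (list_ranks [1, 3, 2]) A c"
proof (rule ranks_three_generators)
  show "has_points 3 (bridge_family 3 B)" using assms by (intro bridge_family_has_points) auto
  show "1 \<in> S" if "S \<in> bridge_family 3 B" "0 \<in> S" "2 \<in> S" for S
    by (rule bridge_familyD[OF that(1) assms(1)]) (simp_all only: index_3 that)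
qed

lemma index_4:
  "prev_index 4 0 = 3" "prev_index 4 1 = 0" "prev_index 4 2 = 1" "prev_index 4 3 = 2"
  "next_index 4 0 = 1" "next_index 4 1 = 2" "next_index 4 2 = 3" "next_index 4 3 = 0"
  by (simp_all add: prev_index_def next_index_def)

text \<open>
  The two neighbours of any index have the same parity, whereas the ends of a side have different parity.
\<close>

lemma bridge_family_4_sides:
  assumes "B \<subseteq> {..<4}"
  shows "{0, 1} \<in> bridge_family 4 B" "{1, 2} \<in> bridge_family 4 B" "{2, 3} \<in> bridge_family 4 B" "{0, 3} \<in> bridge_family 4 B"
proof -
  have index: "(prev_index 4 j, next_index 4 j, j) \<in> {(3, 1, 0), (0, 2, 1), (1, 3, 2), (2, 0, 3)}" if "j \<in> B" for j
  proof -
    have "j = 0 \<or> j = 1 \<or> j = 2 \<or> j = 3" using assms that by (auto simp: less_numeral_cases)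
    then show ?thesis by (elim disjE) (simp_all only: index_4, simp_all)
  qed
  show "{0, 1} \<in> bridge_family 4 B" "{1, 2} \<in> bridge_family 4 B" "{2, 3} \<in> bridge_family 4 B" "{0, 3} \<in> bridge_family 4 B"
    unfolding bridge_family_def by (auto dest!: index)
qed

lemma resolution_bridge_family_4_cycle:
  assumes "1 \<in> B" "2 \<in> B" "B \<subseteq> {..<4}"
  shows "\<exists>A (c :: 'k::field scalar_mats). set_resolution 4 (bridge_family 4 B) (list_ranks [1, 4, 4, 1]) A c"
proof (rule ranks_four_cycle)
  show "has_points 4 (bridge_family 4 B)" using assms by (intro bridge_family_has_points) auto
  show "1 \<in> S" if "S \<in> bridge_family 4 B" "0 \<in> S" "2 \<in> S" for S
    by (rule bridge_familyD[OF that(1) assms(1)]) (simp_all only: index_4 that)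
  show "2 \<in> S" if "S \<in> bridge_family 4 B" "1 \<in> S" "3 \<in> S" for S
    by (rule bridge_familyD[OF that(1) assms(2)]) (simp_all only: index_4 that)
qed (use bridge_family_4_sides[OF assms(3)] in auto)

lemma resolution_bridge_family_4_triangles:
  assumes "1 \<in> B" "0 \<notin> B" "2 \<notin> B" "B \<subseteq> {..<4}"
  shows "\<exists>A (c :: 'k::field scalar_mats). set_resolution 4 (bridge_family 4 B) (list_ranks [1, 4, 5, 2]) A c"
proof (rule ranks_two_triangles)
  show "has_points 4 (bridge_family 4 B)" using assms by (intro bridge_family_has_points) auto
  show "1 \<in> S" if "S \<in> bridge_family 4 B" "0 \<in> S" "2 \<in> S" for S
    by (rule bridge_familyD[OF that(1) assms(1)]) (simp_all only: index_4 that)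
  have index: "(prev_index 4 j, next_index 4 j, j) \<in> {(0, 2, 1), (2, 0, 3)}" if "j \<in> B" for j
  proof -
    have "j < 4" using assms(4) that by auto
    then have "j = 1 \<or> j = 3" using assms(2,3) that unfolding less_numeral_cases by auto
    then show ?thesis by (elim disjE) (simp_all only: index_4, simp_all)
  qed
  show "{1, 3} \<in> bridge_family 4 B"
    unfolding bridge_family_def by (auto dest!: index)
qed (use bridge_family_4_sides[OF assms(4)] in auto)

section \<open>Edge ideals\<close>

definition edge_gen :: "'v wo_digraph \<Rightarrow> 'v \<Rightarrow> 'v \<Rightarrow> 'v monomial" where
  "edge_gen D x y = (if (x, y) \<in> edges D then edge_mono D (x, y) else edge_mono D (y, x))"

text \<open>
  A common description of paths and cycles, in which the \<open>i\<close>-th edge joins \<open>f i\<close> and \<open>g i\<close>, in either direction.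
\<close>

definition traced_by :: "nat \<Rightarrow> (nat \<Rightarrow> 'v) \<Rightarrow> (nat \<Rightarrow> 'v) \<Rightarrow> 'v wo_digraph \<Rightarrow> bool" where
  "traced_by n f g D \<longleftrightarrow> weighted_oriented_graph D \<and> underlying_edges D = {{f i, g i} | i. i < n}"

lemma traced_edge:
  assumes "traced_by n f g D" "i < n"
  shows "(f i, g i) \<in> edges D \<or> (g i, f i) \<in> edges D"
proof -
  have "{f i, g i} \<in> underlying_edges D" using assms unfolding traced_by_def by auto
  then obtain x y where "{f i, g i} = {x, y}" "(x, y) \<in> edges D" unfolding underlying_edges_def by blast
  then show ?thesis by (auto simp: doubleton_eq_iff)
qed

lemma edge_traced:
  assumes "traced_by n f g D" "(x, y) \<in> edges D"
  obtains i where "i < n" "(x = f i \<and> y = g i) \<or> (x = g i \<and> y = f i)"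
proof -
  have "{x, y} \<in> underlying_edges D" using assms(2) unfolding underlying_edges_def by blast
  then have "{x, y} \<in> {{f i, g i} | i. i < n}" using assms(1) unfolding traced_by_def by simp
  then obtain i where "i < n" "{x, y} = {f i, g i}" by blast
  then show thesis using that by (auto simp: doubleton_eq_iff)
qed

lemma lookup_edge_mono:
  "lookup (edge_mono D (x, y)) v = (if v = x then 1 else 0) + (if v = y then weight D y else 0)"
  unfolding edge_mono_def by (auto simp: lookup_add lookup_single when_def)

lemma keys_edge_mono:
  assumes "weighted_oriented_graph D" "(x, y) \<in> edges D"
  shows "keys (edge_mono D (x, y)) = {x, y}"
proof -
  have "weight D y \<ge> 1" using assms unfolding weighted_oriented_graph_def by blast
  then show ?thesis by (auto simp: in_keys_iff lookup_edge_mono split: if_splits)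
qed

lemma keys_edge_gen:
  assumes "traced_by n f g D" "i < n"
  shows "keys (edge_gen D (f i) (g i)) = {f i, g i}"
proof -
  have "weighted_oriented_graph D" using assms(1) unfolding traced_by_def by simp
  then show ?thesis
    using traced_edge[OF assms] keys_edge_mono[of D "f i" "g i"] keys_edge_mono[of D "g i" "f i"]
    unfolding edge_gen_def by auto
qed

lemma traced_verts:
  assumes "traced_by n f g D" "i < n" shows "{f i, g i} \<subseteq> verts D"
  using traced_edge[OF assms] assms(1) unfolding traced_by_def weighted_oriented_graph_def by auto

lemma edge_monos_traced:
  assumes tr: "traced_by n f g D"
  shows "edge_mono D ` edges D = (\<lambda>i. edge_gen D (f i) (g i)) ` {..<n}"
proof (rule antisym; rule subsetI)
  fix t assume "t \<in> edge_mono D ` edges D"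
  then obtain x y where xy: "(x, y) \<in> edges D" "t = edge_mono D (x, y)" by auto
  obtain i where i: "i < n" "(x = f i \<and> y = g i) \<or> (x = g i \<and> y = f i)" using edge_traced[OF tr xy(1)] .
  have "(y, x) \<notin> edges D" using tr xy(1) unfolding traced_by_def weighted_oriented_graph_def by blast
  then have "t = edge_gen D (f i) (g i)" using i(2) xy unfolding edge_gen_def by auto
  then show "t \<in> (\<lambda>i. edge_gen D (f i) (g i)) ` {..<n}" using i(1) by blast
next
  fix t assume "t \<in> (\<lambda>i. edge_gen D (f i) (g i)) ` {..<n}"
  then obtain i where i: "i < n" "t = edge_gen D (f i) (g i)" by auto
  then show "t \<in> edge_mono D ` edges D" using traced_edge[OF tr i(1)] unfolding edge_gen_def by auto
qed

text \<open>
  The quantification over all resolutions makes it possible to compare two graphs for which the same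
  family was found: any single resolution for it gives the Betti numbers of both.
\<close>

definition betti_computed_on :: "'k::field itself \<Rightarrow> nat \<Rightarrow> nat set set \<Rightarrow> 'v wo_digraph \<Rightarrow> bool" where
  "betti_computed_on _ n \<C> D \<longleftrightarrow> (\<forall>b A (c :: 'k scalar_mats). set_resolution n \<C> b A c \<longrightarrow>
     (\<forall>i. graph_betti TYPE('k) D i = (if i < 0 then 0 else b (nat i))))"

lemma betti_computed_onD:
  fixes c :: "'k::field scalar_mats"
  shows "betti_computed_on TYPE('k) n \<C> D \<Longrightarrow> set_resolution n \<C> b A c
    \<Longrightarrow> graph_betti TYPE('k) D i = (if i < 0 then 0 else b (nat i))"
  unfolding betti_computed_on_def by blast

lemma betti_computed_on_dividing_gens:
  assumes tr: "traced_by n f g D"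
  shows "betti_computed_on TYPE('k::field) n (range (dividing_gens n (\<lambda>i. edge_gen D (f i) (g i)))) D"
  unfolding betti_computed_on_def
proof (intro allI impI)
  fix b A and c :: "'k scalar_mats" and i :: int
  assume res: "set_resolution n (range (dividing_gens n (\<lambda>i. edge_gen D (f i) (g i)))) b A c"
  have "(\<lambda>e. mono_poly (edge_mono D e)) ` edges D
      = (\<lambda>j. mono_poly (edge_gen D (f j) (g j)) :: ('a, 'k) polynomial) ` {..<n}"
    using arg_cong[OF edge_monos_traced[OF tr], of "image mono_poly"] by (simp add: image_image)
  moreover have "keys (edge_gen D (f j) (g j)) \<subseteq> verts D" if "j < n" for j
    using keys_edge_gen[OF tr that] traced_verts[OF tr that] by simp
  ultimately show "graph_betti TYPE('k) D i = (if i < 0 then 0 else b (nat i))"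
    unfolding graph_betti_def edge_ideal_def
    using betti_via_set_resolution[OF res, of "verts D" i] by simp
qed

lemma betti_computed_on_bridge_family:
  assumes "traced_by n f g D" "cyclic_gens n (\<lambda>i. edge_gen D (f i) (g i))"
  shows "betti_computed_on TYPE('k::field) n (bridge_family n {j. j < n \<and> bridge n (\<lambda>i. edge_gen D (f i) (g i)) j}) D"
  using betti_computed_on_dividing_gens[OF assms(1)] dividing_gens_family[OF assms(2)] by simp

lemma betti_eq_if_same_bridges:
  assumes "n \<ge> 3" "B \<subseteq> {..<n}" "betti_computed_on TYPE('k::field) n (bridge_family n B) D"
    "betti_computed_on TYPE('k) n (bridge_family n B) D'"
  shows "graph_betti TYPE('k) D i = graph_betti TYPE('k) D' i"
proof -
  obtain b A and c :: "'k scalar_mats" where res: "set_resolution n (bridge_family n B) b A c"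
    using set_resolution_exists[OF bridge_family_has_points[OF assms(1,2)]] by metis
  show ?thesis using betti_computed_onD[OF assms(3) res] betti_computed_onD[OF assms(4) res] by simp
qed

lemma cyclic_gensI:
  assumes "traced_by n f g D" "n \<ge> 3"
    and "\<And>i j. i < n \<Longrightarrow> j < n \<Longrightarrow> i \<noteq> j \<Longrightarrow> f j \<in> {f i, g i} \<Longrightarrow> i = prev_index n j"
    and "\<And>i j. i < n \<Longrightarrow> j < n \<Longrightarrow> i \<noteq> j \<Longrightarrow> g j \<in> {f i, g i} \<Longrightarrow> i = next_index n j"
  shows "cyclic_gens n (\<lambda>i. edge_gen D (f i) (g i))"
  unfolding cyclic_gens_def
proof (intro conjI allI impI)
  fix j assume j: "j < n"
  show "\<exists>x y. keys (edge_gen D (f j) (g j)) = {x, y}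
     \<and> (\<forall>i<n. i \<noteq> j \<longrightarrow> (x \<in> keys (edge_gen D (f i) (g i)) \<longrightarrow> i = prev_index n j)
          \<and> (y \<in> keys (edge_gen D (f i) (g i)) \<longrightarrow> i = next_index n j))"
  proof (rule exI[of _ "f j"], rule exI[of _ "g j"], intro conjI allI impI)
    show "keys (edge_gen D (f j) (g j)) = {f j, g j}" by (rule keys_edge_gen[OF assms(1) j])
    fix i assume i: "i < n" "i \<noteq> j"
    show "i = prev_index n j" if "f j \<in> keys (edge_gen D (f i) (g i))"
      using assms(3)[OF i(1) j i(2)] that unfolding keys_edge_gen[OF assms(1) i(1)] .
    show "i = next_index n j" if "g j \<in> keys (edge_gen D (f i) (g i))"
      using assms(4)[OF i(1) j i(2)] that unfolding keys_edge_gen[OF assms(1) i(1)] .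
  qed
qed (rule assms(2))

text \<open>
  Used in the negative: an edge with an end that lies on neither neighbour is no bridge.
\<close>

lemma bridge_keys:
  assumes "bridge n m j"
  shows "keys (m j) \<subseteq> keys (m (prev_index n j)) \<union> keys (m (next_index n j))"
proof
  fix v assume "v \<in> keys (m j)"
  moreover have "lookup (m j) v
      \<le> max (lookup (m (prev_index n j)) v) (lookup (m (next_index n j)) v)"
    using assms unfolding bridge_def mono_dvd_iff_le mono_lcm.rep_eq by blast
  ultimately show "v \<in> keys (m (prev_index n j)) \<union> keys (m (next_index n j))"
    unfolding in_keys_iff by (cases "lookup (m (prev_index n j)) v = 0") (auto simp: in_keys_iff)
qed

section \<open>Bridges in paths and cycles\<close>

lemma wo_path_traced:
  assumes "wo_path n P"
  obtains xs where "distinct xs" "length xs = n + 1" "traced_by n (\<lambda>i. xs ! i) (\<lambda>i. xs ! (i + 1)) P"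
  using assms unfolding wo_path_def traced_by_def by blast

lemma path_cyclic_gens:
  assumes xs: "distinct xs" "length xs = n + 1" and tr: "traced_by n (\<lambda>i. xs ! i) (\<lambda>i. xs ! (i + 1)) P"
    and n: "n \<ge> 3"
  shows "cyclic_gens n (\<lambda>i. edge_gen P (xs ! i) (xs ! (i + 1)))"
proof (rule cyclic_gensI[OF tr n])
  fix i j assume ij: "i < n" "j < n" "i \<noteq> j"
  show "i = prev_index n j" if "xs ! j \<in> {xs ! i, xs ! (i + 1)}"
    using that ij xs by (auto simp: nth_eq_iff_index_eq prev_index_if)
  show "i = next_index n j" if "xs ! (j + 1) \<in> {xs ! i, xs ! (i + 1)}"
    using that ij xs by (auto simp: nth_eq_iff_index_eq next_index_if)
qed

lemma path_ends_not_bridges: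
  assumes xs: "distinct xs" "length xs = n + 1" and tr: "traced_by n (\<lambda>i. xs ! i) (\<lambda>i. xs ! (i + 1)) P"
    and n: "n \<ge> 3"
  shows "{j. j < n \<and> bridge n (\<lambda>i. edge_gen P (xs ! i) (xs ! (i + 1))) j} \<subseteq> {1..<n - 1}"
proof
  let ?m = "\<lambda>i. edge_gen P (xs ! i) (xs ! (i + 1))"
  fix j assume "j \<in> {j. j < n \<and> bridge n ?m j}"
  then have j: "j < n" and br: "bridge n ?m j" by auto
  have keys: "keys (?m i) = {xs ! i, xs ! (i + 1)}" if "i < n" for i
    using keys_edge_gen[OF tr that] .
  have sub: "{xs ! j, xs ! (j + 1)} \<subseteq> {xs ! prev_index n j, xs ! (prev_index n j + 1)}
      \<union> {xs ! next_index n j, xs ! (next_index n j + 1)}"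
    using bridge_keys[OF br] unfolding keys[OF j] keys[OF prev_index_less[OF j]] keys[OF next_index_less[OF j]] .
  have "j \<noteq> 0"
  proof
    assume "j = 0"
    then have "xs ! 0 \<in> {xs ! (n - 1), xs ! n, xs ! 1, xs ! 2}"
      using sub n by (auto simp: prev_index_if next_index_if numeral_2_eq_2)
    then show False using xs n by (auto simp: nth_eq_iff_index_eq)
  qed
  moreover have "j \<noteq> n - 1"
  proof
    assume "j = n - 1"
    then have "xs ! n \<in> {xs ! (n - 2), xs ! (n - 1), xs ! 0, xs ! 1}"
      using sub n by (auto simp: prev_index_if next_index_if numeral_2_eq_2 Suc_diff_Suc)
    then show False using xs n by (auto simp: nth_eq_iff_index_eq)
  qed
  ultimately show "j \<in> {1..<n - 1}" using j by auto
qed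

lemma path_bridges:
  assumes "wo_path n P" "n \<ge> 3"
  obtains B where "B \<subseteq> {1..<n - 1}" "betti_computed_on TYPE('k::field) n (bridge_family n B) P"
proof -
  obtain xs where xs: "distinct xs" "length xs = n + 1" "traced_by n (\<lambda>i. xs ! i) (\<lambda>i. xs ! (i + 1)) P"
    using wo_path_traced[OF assms(1)] .
  show thesis
    by (rule that[OF path_ends_not_bridges[OF xs assms(2)] betti_computed_on_bridge_family[OF xs(3) path_cyclic_gens[OF xs assms(2)]]])
qed

text \<open>
  The first index is reduced modulo the length as well, which makes both functions periodic, in
  accordance with \<open>cycle_gen\<close>.
\<close>

lemma wo_cycle_on_traced:
  assumes "wo_cycle_on xs C"
  shows "traced_by (length xs) (\<lambda>i. xs ! (i mod length xs)) (\<lambda>i. xs ! ((i + 1) mod length xs)) C"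
proof -
  have "{{xs ! i, xs ! ((i + 1) mod length xs)} | i. i < length xs}
      = {{xs ! (i mod length xs), xs ! ((i + 1) mod length xs)} | i. i < length xs}"
    by (metis mod_less)
  then show ?thesis using assms unfolding wo_cycle_on_def traced_by_def by simp
qed

lemma cycle_gen_eq: "cycle_gen C xs = (\<lambda>i. edge_gen C (xs ! (i mod length xs)) (xs ! ((i + 1) mod length xs)))"
  unfolding cycle_gen_def edge_gen_def Let_def by simp

lemma cycle_cyclic_gens:
  assumes "wo_cycle_on xs C"
  shows "cyclic_gens (length xs) (cycle_gen C xs)"
  unfolding cycle_gen_eq
proof (rule cyclic_gensI[OF wo_cycle_on_traced[OF assms]])
  have xs: "distinct xs" "length xs \<ge> 3" using assms unfolding wo_cycle_on_def by auto
  show "length xs \<ge> 3" by (rule xs(2))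
  have next_eq: "xs ! ((i + 1) mod length xs) = xs ! next_index (length xs) i" for i
    unfolding next_index_def by simp
  fix i j assume ij: "i < length xs" "j < length xs" "i \<noteq> j"
  have inj: "xs ! k = xs ! l \<longleftrightarrow> k = l" if "k < length xs" "l < length xs" for k l
    using xs(1) that by (rule nth_eq_iff_index_eq)
  note less = ij(1,2) next_index_less[OF ij(1)] next_index_less[OF ij(2)]
  show "i = prev_index (length xs) j"
    if "xs ! (j mod length xs) \<in> {xs ! (i mod length xs), xs ! ((i + 1) mod length xs)}"
  proof -
    have "j = next_index (length xs) i" using that ij less unfolding next_eq by (auto simp: inj)
    then show ?thesis using prev_next_index[OF ij(1)] by simp
  qed
  show "i = next_index (length xs) j"
    if "xs ! ((j + 1) mod length xs) \<in> {xs ! (i mod length xs), xs ! ((i + 1) mod length xs)}"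
  proof -
    have "next_index (length xs) j = i \<or> next_index (length xs) j = next_index (length xs) i"
      using that ij less unfolding next_eq by (auto simp: inj)
    then show ?thesis using prev_next_index[OF ij(1)] prev_next_index[OF ij(2)] ij(3) by auto
  qed
qed

lemma cycle_gen_mod: "cycle_gen C xs (i mod length xs) = cycle_gen C xs i"
  unfolding cycle_gen_def by (simp add: mod_Suc_eq)

lemma bridge_iff_not_blockend:
  "bridge (length xs) (cycle_gen C xs) j \<longleftrightarrow> \<not> blockend C xs j"
  unfolding bridge_def blockend_def prev_index_def next_index_def by (simp add: cycle_gen_mod)

lemma cycle_bridges:
  assumes "wo_cycle_on xs C"
  shows "betti_computed_on TYPE('k::field) (length xs) (bridge_family (length xs) {j. j < length xs \<and> \<not> blockend C xs j}) C"
  using betti_computed_on_bridge_family[OF wo_cycle_on_traced[OF assms], folded cycle_gen_eq, OF cycle_cyclic_gens[OF assms]]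
  unfolding bridge_iff_not_blockend .

section \<open>Paths and cycles with prescribed bridges\<close>

text \<open>
  All edges point from \<open>f i\<close> to \<open>g i\<close>.  The head of an edge has weight 1 if the edge is to become a bridge and
  weight 2 otherwise.
\<close>

definition directed_graph :: "'v set \<Rightarrow> nat \<Rightarrow> (nat \<Rightarrow> 'v) \<Rightarrow> (nat \<Rightarrow> 'v) \<Rightarrow> nat set \<Rightarrow> 'v wo_digraph" where
  "directed_graph V n f g B =
     \<lparr>verts = V, edges = (\<lambda>i. (f i, g i)) ` {..<n}, weight = (\<lambda>v. if v \<in> g ` B then 1 else 2)\<rparr>"

lemma directed_graph_traced:
  assumes "finite V" "\<And>i. i < n \<Longrightarrow> f i \<in> V \<and> g i \<in> V \<and> f i \<noteq> g i"
    and "\<And>i j. i < n \<Longrightarrow> j < n \<Longrightarrow> f i = g j \<Longrightarrow> g i \<noteq> f j"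
  shows "traced_by n f g (directed_graph V n f g B)"
proof -
  have "weighted_oriented_graph (directed_graph V n f g B)"
    using assms unfolding weighted_oriented_graph_def directed_graph_def by auto
  moreover have "underlying_edges (directed_graph V n f g B) = {{f i, g i} | i. i < n}"
    unfolding underlying_edges_def directed_graph_def by auto
  ultimately show ?thesis unfolding traced_by_def ..
qed

text \<open>
  At its tail, edge \<open>j\<close> has exponent 1, which its predecessor always covers.  At its head its exponent
  is the weight, whereas the successor only has exponent 1 there.  So \<open>j\<close> is a bridge if and only if that weight is 1.
\<close>

lemma directed_graph_bridge:
  fixes f g :: "nat \<Rightarrow> 'v" and V n B
  defines "D \<equiv> directed_graph V n f g B"
  assumes j: "j < n" and B: "B \<subseteq> {..<n}" "inj_on g {..<n}" and loop: "f j \<noteq> g j"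
    and p: "f j = g (prev_index n j)" "g j \<noteq> f (prev_index n j)" "g j \<noteq> g (prev_index n j)"
    and q: "g j = f (next_index n j)" "g j \<noteq> g (next_index n j)"
  shows "bridge n (\<lambda>i. edge_gen D (f i) (g i)) j \<longleftrightarrow> j \<in> B"
proof -
  have lk: "lookup (edge_gen D (f i) (g i)) v
      = (if v = f i then 1 else 0) + (if v = g i then if g i \<in> g ` B then 1 else 2 else 0)" if "i < n" for i v
  proof -
    have "(f i, g i) \<in> edges D" using that unfolding D_def directed_graph_def by auto
    then show ?thesis unfolding edge_gen_def by (simp add: lookup_edge_mono) (simp add: D_def directed_graph_def)
  qed
  have gB: "g j \<in> g ` B \<longleftrightarrow> j \<in> B" using inj_on_image_mem_iff[OF B(2) _ B(1)] j by simp
  note lks = lk[OF j] lk[OF prev_index_less[OF j]] lk[OF next_index_less[OF j]]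
  show ?thesis
  proof
    assume "bridge n (\<lambda>i. edge_gen D (f i) (g i)) j"
    then have "lookup (edge_gen D (f j) (g j)) (g j)
        \<le> max (lookup (edge_gen D (f (prev_index n j)) (g (prev_index n j))) (g j))
              (lookup (edge_gen D (f (next_index n j)) (g (next_index n j))) (g j))"
      unfolding bridge_def mono_dvd_iff_le mono_lcm.rep_eq by blast
    then show "j \<in> B" unfolding lks gB using loop p(2,3) q by (auto split: if_splits)
  next
    assume jB: "j \<in> B"
    show "bridge n (\<lambda>i. edge_gen D (f i) (g i)) j"
      unfolding bridge_def mono_dvd_iff_le mono_lcm.rep_eq
    proof
      fix v
      have "lookup (edge_gen D (f j) (g j)) v \<le> (if v = f j \<or> v = g j then 1 else 0)"
        unfolding lks(1) gB using jB loop by simp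
      moreover have "1 \<le> lookup (edge_gen D (f (prev_index n j)) (g (prev_index n j))) v" if "v = f j"
        unfolding lks(2) that p(1) by simp
      moreover have "1 \<le> lookup (edge_gen D (f (next_index n j)) (g (next_index n j))) v" if "v = g j"
        unfolding lks(3) that q(1) by simp
      ultimately show "lookup (edge_gen D (f j) (g j)) v
          \<le> max (lookup (edge_gen D (f (prev_index n j)) (g (prev_index n j))) v)
                (lookup (edge_gen D (f (next_index n j)) (g (next_index n j))) v)"
        by (cases "v = f j"; cases "v = g j") (simp_all add: le_max_iff_disj)
    qed
  qed
qed

lemma distinct_list_exists: "\<exists>xs :: 'v::infinite list. distinct xs \<and> length xs = n"
proof -
  obtain X :: "'v set" where "finite X" "card X = n"
    using infinite_arbitrarily_large[OF infinite_UNIV, of n] by blast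
  then show ?thesis using finite_distinct_list[of X] distinct_card by metis
qed

text \<open>
  A path that is directed from one end to the other.
\<close>

lemma path_with_bridges:
  assumes n: "n \<ge> 3" and B: "B \<subseteq> {1..<n - 1}"
  shows "\<exists>P :: 'v::infinite wo_digraph. wo_path n P \<and> betti_computed_on TYPE('k::field) n (bridge_family n B) P"
proof -
  obtain xs :: "'v list" where xs: "distinct xs" "length xs = n + 1" using distinct_list_exists by blast
  define P where "P = directed_graph (set xs) n (\<lambda>i. xs ! i) (\<lambda>i. xs ! (i + 1)) B"
  have tr: "traced_by n (\<lambda>i. xs ! i) (\<lambda>i. xs ! (i + 1)) P"
    unfolding P_def by (rule directed_graph_traced) (use xs in \<open>auto simp: nth_eq_iff_index_eq\<close>)
  have path: "wo_path n P"
    using tr xs unfolding wo_path_def traced_by_def by (auto simp: P_def directed_graph_def)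
  have inner: "bridge n (\<lambda>i. edge_gen P (xs ! i) (xs ! (i + 1))) j \<longleftrightarrow> j \<in> B" if j: "j \<in> {1..<n - 1}" for j
  proof -
    have jn: "j < n" and idx: "prev_index n j = j - 1" "next_index n j = j + 1"
      using j by (auto simp: prev_index_if next_index_if)
    have eq: "xs ! k = xs ! l \<longleftrightarrow> k = l" if "k \<le> n" "l \<le> n" for k l
      using xs that by (simp add: nth_eq_iff_index_eq)
    show ?thesis
      unfolding P_def
    proof (rule directed_graph_bridge[OF jn])
      show "B \<subseteq> {..<n}" using B by (rule order_trans) auto
      show "inj_on (\<lambda>i. xs ! (i + 1)) {..<n}" using xs by (auto simp: inj_on_def nth_eq_iff_index_eq)
    qed (use j in \<open>auto simp: idx eq\<close>)
  qed
  have "{j. j < n \<and> bridge n (\<lambda>i. edge_gen P (xs ! i) (xs ! (i + 1))) j} = B"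
  proof (rule antisym; rule subsetI)
    fix j assume "j \<in> {j. j < n \<and> bridge n (\<lambda>i. edge_gen P (xs ! i) (xs ! (i + 1))) j}"
    then show "j \<in> B" using inner path_ends_not_bridges[OF xs tr n] by blast
  next
    fix j assume "j \<in> B"
    then show "j \<in> {j. j < n \<and> bridge n (\<lambda>i. edge_gen P (xs ! i) (xs ! (i + 1))) j}"
      using inner[of j] subsetD[OF B, of j] by auto
  qed
  then show ?thesis using path betti_computed_on_bridge_family[OF tr path_cyclic_gens[OF xs tr n], where 'k = 'k] by auto
qed

text \<open>
  A cycle with cyclic orientation.
\<close>

lemma cycle_with_bridges:
  assumes n: "n \<ge> 3" and B: "B \<subseteq> {..<n}"
  shows "\<exists>C :: 'v::infinite wo_digraph. wo_cycle n C \<and> betti_computed_on TYPE('k::field) n (bridge_family n B) C"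
proof -
  obtain xs :: "'v list" where xs: "distinct xs" "length xs = n" using distinct_list_exists by blast
  let ?f = "\<lambda>i. xs ! (i mod length xs)" and ?g = "\<lambda>i. xs ! ((i + 1) mod length xs)"
  define C where "C = directed_graph (set xs) n ?f ?g B"
  have inj: "xs ! k = xs ! l \<longleftrightarrow> k = l" if "k < n" "l < n" for k l
    using xs that by (simp add: nth_eq_iff_index_eq)
  have f: "?f i = xs ! i" and g: "?g i = xs ! next_index n i" if "i < n" for i
    using that unfolding next_index_def xs(2) by auto
  have cross: "?g i \<noteq> ?f j" if "i < n" "j < n" "?f i = ?g j" for i j
    using that n unfolding f[OF that(1)] g[OF that(1)] f[OF that(2)] g[OF that(2)]
    by (auto simp: inj next_index_less next_index_if split: if_splits)
  have tr: "traced_by n ?f ?g C"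
    unfolding C_def
  proof (rule directed_graph_traced)
    show "?f i \<in> set xs \<and> ?g i \<in> set xs \<and> ?f i \<noteq> ?g i" if "i < n" for i
      using that xs n next_index_less[OF that] next_neq_self[OF _ that] unfolding f[OF that] g[OF that]
      by (auto simp: inj)
  qed (use cross in auto)
  have cyc: "wo_cycle_on xs C"
  proof -
    have "{{?f i, ?g i} | i. i < n} = {{xs ! i, xs ! ((i + 1) mod length xs)} | i. i < length xs}"
      unfolding xs(2) by (metis mod_less)
    then show ?thesis
      using tr xs n unfolding wo_cycle_on_def traced_by_def by (simp add: C_def directed_graph_def)
  qed
  have "bridge n (\<lambda>i. edge_gen C (?f i) (?g i)) j \<longleftrightarrow> j \<in> B" if j: "j < n" for j
    unfolding C_def
  proof (rule directed_graph_bridge[OF j B])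
    note less = prev_index_less[OF j] next_index_less[OF j]
    show "inj_on ?g {..<n}"
    proof (rule inj_onI)
      fix k l assume kl: "k \<in> {..<n}" "l \<in> {..<n}" "?g k = ?g l"
      then have k: "k < n" and l: "l < n" by auto
      have "next_index n k = next_index n l"
        using kl(3) unfolding g[OF k] g[OF l] inj[OF next_index_less[OF k] next_index_less[OF l]] .
      from arg_cong[OF this, of "prev_index n"] show "k = l"
        unfolding prev_next_index[OF k] prev_next_index[OF l] .
    qed
    have n2: "n \<ge> 2" using n by simp
    note less2 = next_index_less[OF less(2)]
    show "?f j \<noteq> ?g j"
      unfolding f[OF j] g[OF j] inj[OF j less(2)] by (rule not_sym[OF next_neq_self[OF n2 j]])
    show "?g j \<noteq> ?g (next_index n j)"
      unfolding g[OF j] g[OF less(2)] inj[OF less(2) less2] by (rule not_sym[OF next_neq_self[OF n2 less(2)]])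
    show "?g j \<noteq> ?f (prev_index n j)"
      unfolding g[OF j] f[OF less(1)] inj[OF less(2) less(1)] by (rule not_sym[OF prev_neq_next[OF n j]])
    show "?g j \<noteq> ?g (prev_index n j)"
      unfolding g[OF j] g[OF less(1)] next_prev_index[OF j] inj[OF less(2) j] by (rule next_neq_self[OF n2 j])
    show "?f j = ?g (prev_index n j)"
      unfolding f[OF j] g[OF less(1)] next_prev_index[OF j] ..
    show "?g j = ?f (next_index n j)"
      unfolding g[OF j] f[OF less(2)] ..
  qed
  then have "{j. j < n \<and> \<not> blockend C xs j} = B"
    using B bridge_iff_not_blockend[of xs C, unfolded cycle_gen_eq, unfolded xs(2)] unfolding xs(2) by auto
  then have "betti_computed_on TYPE('k) n (bridge_family n B) C" using cycle_bridges[OF cyc, where 'k = 'k] xs(2) by simp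
  then show ?thesis using cyc xs(2) unfolding wo_cycle_def by blast
qed

section \<open>Rotating a cycle\<close>

lemma nth_rotate_mod:
  assumes "xs \<noteq> []" shows "rotate k xs ! (i mod length xs) = xs ! ((i + k) mod length xs)"
  using nth_rotate[of "i mod length xs" xs k] assms by (simp add: mod_simps add.commute)

lemma cycle_gen_rotate:
  assumes "xs \<noteq> []" shows "cycle_gen C (rotate k xs) i = cycle_gen C xs (i + k)"
  unfolding cycle_gen_eq length_rotate nth_rotate_mod[OF assms] by (simp add: ac_simps)

lemma blockend_rotate:
  assumes "xs \<noteq> []" shows "blockend C (rotate k xs) i \<longleftrightarrow> blockend C xs (i + k)"
  unfolding blockend_def length_rotate cycle_gen_rotate[OF assms] by (simp add: ac_simps)

lemma blockend_mod: "blockend C xs (i mod length xs) \<longleftrightarrow> blockend C xs i"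
proof -
  have "cycle_gen C xs (i mod length xs + j) = cycle_gen C xs (i + j)" for j
    using cycle_gen_mod[of C xs "i mod length xs + j"] cycle_gen_mod[of C xs "i + j"] by (simp add: mod_simps)
  from this[of "length xs - 1"] this[of 1] show ?thesis unfolding blockend_def cycle_gen_mod by simp
qed

lemma blockend_period: "blockend C xs (i + length xs) \<longleftrightarrow> blockend C xs i"
  using blockend_mod[of C xs "i + length xs"] blockend_mod[of C xs i] by simp

lemma wo_cycle_on_rotate:
  assumes "wo_cycle_on xs C" shows "wo_cycle_on (rotate k xs) C"
proof -
  let ?n = "length xs" and ?E = "\<lambda>i. {xs ! (i mod length xs), xs ! ((i + 1) mod length xs)}"
  have ne: "xs \<noteq> []" using assms unfolding wo_cycle_on_def by auto
  have n: "0 < ?n" using ne by simp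
  have edge: "{rotate k xs ! i, rotate k xs ! ((i + 1) mod ?n)} = ?E ((i + k) mod ?n)" if "i < ?n" for i
    using nth_rotate_mod[OF ne, of k i] nth_rotate_mod[OF ne, of k "i + 1"] that by (simp add: mod_simps)
  have "{{rotate k xs ! i, rotate k xs ! ((i + 1) mod ?n)} | i. i < ?n} = ?E ` (\<lambda>i. (i + k) mod ?n) ` {..<?n}"
    using edge by (auto simp: image_iff) blast
  also have "(\<lambda>i. (i + k) mod ?n) ` {..<?n} = {..<?n}"
  proof (rule antisym; rule subsetI)
    fix i assume "i \<in> {..<?n}"
    then have i: "i < ?n" by simp
    have "((i + (?n - k mod ?n)) mod ?n + k) mod ?n = (i + (?n - k mod ?n) + k mod ?n) mod ?n" by (simp add: mod_simps)
    also have "i + (?n - k mod ?n) + k mod ?n = i + ?n" using mod_less_divisor[OF n, of k] by linarith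
    finally have "((i + (?n - k mod ?n)) mod ?n + k) mod ?n = i" using i by simp
    then show "i \<in> (\<lambda>i. (i + k) mod ?n) ` {..<?n}"
      using n by (intro image_eqI[of _ _ "(i + (?n - k mod ?n)) mod ?n"]) auto
  qed (use n in auto)
  also have "?E ` {..<?n} = {{xs ! i, xs ! ((i + 1) mod ?n)} | i. i < ?n}"
    by (auto simp: image_iff)
  finally show ?thesis using assms unfolding wo_cycle_on_def by simp
qed

lemma cyclic_gens_inj:
  assumes cyc: "cyclic_gens n m" shows "inj_on m {..<n}"
proof (rule inj_onI, rule ccontr)
  fix i j assume ij: "i \<in> {..<n}" "j \<in> {..<n}" "m i = m j" "i \<noteq> j"
  then have j: "j < n" and i: "i < n" by auto
  from cyc[unfolded cyclic_gens_def, THEN conjunct2, THEN spec, THEN mp, OF j]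
  obtain x y where keys: "keys (m j) = {x, y}"
    and nb: "\<forall>i<n. i \<noteq> j \<longrightarrow> (x \<in> keys (m i) \<longrightarrow> i = prev_index n j)
        \<and> (y \<in> keys (m i) \<longrightarrow> i = next_index n j)" by (elim exE conjE)
  have "i = prev_index n j" "i = next_index n j"
    using nb i ij(4) keys unfolding ij(3)[symmetric] by auto
  then show False using prev_neq_next[OF _ j] cyc unfolding cyclic_gens_def by auto
qed

lemma next_next_neq_self: "n \<ge> 3 \<Longrightarrow> j < n \<Longrightarrow> next_index n (next_index n j) \<noteq> j"
  by (auto simp: next_index_less next_index_if)

section \<open>Paths with the Betti numbers of a given cycle\<close>

text \<open>
  In a cycle any three consecutive generators are different.  So a block with two elements cannot contain
  a generator strictly between its two blockends, and it is not the set of all generators either.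
\<close>

lemma adjacent_blockends_of_block:
  assumes cyc: "wo_cycle_on xs C" and B: "B \<in> blocks C xs" "card B = 2"
  obtains i where "blockend C xs i" "blockend C xs (i + 1)"
proof (cases "card {i. i < length xs \<and> blockend C xs i} = 1")
  case True
  then have "B = cycle_gen C xs ` {..<length xs}" using B(1) unfolding blocks_def by simp
  then have "card B = length xs" using cyclic_gens_inj[OF cycle_cyclic_gens[OF cyc]] by (simp add: card_image)
  then show thesis using B(2) cyc unfolding wo_cycle_on_def by simp
next
  case False
  let ?n = "length xs"
  have n: "?n \<ge> 3" using cyc unfolding wo_cycle_on_def by simp
  have "B \<in> {cycle_gen C xs ` {i..i + k} | i k. k \<ge> 1 \<and> blockend C xs i \<and> blockend C xs (i + k)
              \<and> cycle_gen C xs i \<noteq> cycle_gen C xs (i + k) \<and> (\<forall>j. i < j \<and> j < i + k \<longrightarrow> \<not> blockend C xs j)}"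
    using B(1) False unfolding blocks_def by simp
  then obtain i k where Beq: "B = cycle_gen C xs ` {i..i + k}" and k: "k \<ge> 1"
    and ends: "blockend C xs i" "blockend C xs (i + k)" by blast
  have "k = 1"
  proof (rule ccontr)
    assume "k \<noteq> 1"
    then have k2: "k \<ge> 2" using k by simp
    define j where "j = i mod ?n"
    have j: "j < ?n" unfolding j_def using n by (intro mod_less_divisor) linarith
    have mods: "(i + 1) mod ?n = next_index ?n j" "(i + 2) mod ?n = next_index ?n (next_index ?n j)"
      unfolding j_def next_index_def by (simp_all add: mod_simps)
    have neq: "j \<noteq> next_index ?n j" "j \<noteq> next_index ?n (next_index ?n j)"
      "next_index ?n j \<noteq> next_index ?n (next_index ?n j)"
      using next_neq_self[OF _ j] next_next_neq_self[OF n j] next_neq_self[OF _ next_index_less[OF j]] n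
      by auto
    have sub: "{j, next_index ?n j, next_index ?n (next_index ?n j)} \<subseteq> {..<?n}"
      using next_index_less[OF j] next_index_less[OF next_index_less[OF j]] j by simp
    have "card {j, next_index ?n j, next_index ?n (next_index ?n j)} = 3" using neq by simp
    then have "card (cycle_gen C xs ` {j, next_index ?n j, next_index ?n (next_index ?n j)}) = 3"
      using card_image[OF inj_on_subset[OF cyclic_gens_inj[OF cycle_cyclic_gens[OF cyc]] sub]] by simp
    moreover have "cycle_gen C xs ` {j, next_index ?n j, next_index ?n (next_index ?n j)} \<subseteq> B"
    proof -
      have "cycle_gen C xs j = cycle_gen C xs i" unfolding j_def by (rule cycle_gen_mod)
      moreover have "cycle_gen C xs (next_index ?n j) = cycle_gen C xs (i + 1)"
        unfolding mods(1)[symmetric] by (rule cycle_gen_mod)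
      moreover have "cycle_gen C xs (next_index ?n (next_index ?n j)) = cycle_gen C xs (i + 2)"
        unfolding mods(2)[symmetric] by (rule cycle_gen_mod)
      ultimately show ?thesis unfolding Beq using k2 by auto
    qed
    moreover have "finite B" unfolding Beq by simp
    ultimately have "3 \<le> card B" by (metis card_mono)
    then show False using B(2) by simp
  qed
  then show thesis using ends that by blast
qed

text \<open>
  Cut the cycle between the two blockends: after a rotation they are the last and the first edge.
\<close>

lemma path_like_cycle:
  fixes C :: "'v::infinite wo_digraph"
  assumes cyc: "wo_cycle_on xs C" and ends: "blockend C xs i" "blockend C xs (i + 1)"
  shows "\<exists>P :: 'v wo_digraph. wo_path (length xs) P
    \<and> (\<forall>i. graph_betti TYPE('k::field) P i = graph_betti TYPE('k) C i)"
proof -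
  let ?n = "length xs" and ?ys = "rotate (i + 1) xs"
  have n: "?n \<ge> 3" and ne: "xs \<noteq> []" using cyc unfolding wo_cycle_on_def by auto
  define B where "B = {j. j < ?n \<and> \<not> blockend C ?ys j}"
  have C: "betti_computed_on TYPE('k) ?n (bridge_family ?n B) C"
    using cycle_bridges[OF wo_cycle_on_rotate[OF cyc], of "i + 1"] unfolding B_def by simp
  have "blockend C ?ys 0" unfolding blockend_rotate[OF ne] using ends(2) by simp
  moreover have "blockend C ?ys (?n - 1)"
  proof -
    have "?n - 1 + (i + 1) = i + ?n" using n by simp
    then show ?thesis unfolding blockend_rotate[OF ne] using ends(1) blockend_period by metis
  qed
  ultimately have "j \<in> {1..<?n - 1}" if "j \<in> B" for j
    using that unfolding B_def by (cases "j = 0"; cases "j = ?n - 1") auto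
  then have B: "B \<subseteq> {1..<?n - 1}" by blast
  obtain P :: "'v wo_digraph" where P: "wo_path ?n P" "betti_computed_on TYPE('k) ?n (bridge_family ?n B) P"
    using path_with_bridges[OF n B] by blast
  have "B \<subseteq> {..<?n}" unfolding B_def by auto
  then show ?thesis using P betti_eq_if_same_bridges[OF n _ P(2) C] by blast
qed

text \<open>
  The families of the cycle and the path may be different here; it suffices that they have resolutions
  with the same ranks.
\<close>

lemma path_like_short_cycle:
  fixes C :: "'v::infinite wo_digraph" and cC cP :: "'k::field scalar_mats"
  assumes cyc: "wo_cycle_on xs C" and B: "B \<subseteq> {1..<length xs - 1}"
    and resC: "set_resolution (length xs) (bridge_family (length xs) {j. j < length xs \<and> \<not> blockend C (rotate k xs) j}) b A cC"
    and resP: "set_resolution (length xs) (bridge_family (length xs) B) b A' cP"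
  shows "\<exists>P :: 'v wo_digraph. wo_path (length xs) P
    \<and> (\<forall>i. graph_betti TYPE('k) P i = graph_betti TYPE('k) C i)"
proof -
  have n: "length xs \<ge> 3" using cyc unfolding wo_cycle_on_def by auto
  obtain P :: "'v wo_digraph" where P: "wo_path (length xs) P" "betti_computed_on TYPE('k) (length xs) (bridge_family (length xs) B) P"
    using path_with_bridges[OF n B] by blast
  have C: "betti_computed_on TYPE('k) (length xs) (bridge_family (length xs) {j. j < length xs \<and> \<not> blockend C (rotate k xs) j}) C"
    using cycle_bridges[OF wo_cycle_on_rotate[OF cyc], of k] by simp
  have "graph_betti TYPE('k) P i = graph_betti TYPE('k) C i" for i
    unfolding betti_computed_onD[OF P(2) resP] betti_computed_onD[OF C resC] ..
  then show ?thesis using P(1) by blast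
qed

lemma path_like_3_cycle:
  fixes C :: "'v::infinite wo_digraph"
  assumes cyc: "wo_cycle_on xs C" and len: "length xs = 3" and j: "\<not> blockend C xs j"
  shows "\<exists>P :: 'v wo_digraph. wo_path 3 P \<and> (\<forall>i. graph_betti TYPE('k::field) P i = graph_betti TYPE('k) C i)"
proof -
  let ?ys = "rotate (j + 2) xs" and ?B = "{i. i < 3 \<and> \<not> blockend C (rotate (j + 2) xs) i}"
  have ne: "xs \<noteq> []" using len by auto
  have "blockend C ?ys 1 \<longleftrightarrow> blockend C xs j"
  proof -
    have "1 + (j + 2) = j + length xs" unfolding len by simp
    then show ?thesis unfolding blockend_rotate[OF ne] by (simp only: blockend_period)
  qed
  then have "1 \<in> ?B" "?B \<subseteq> {..<3}" using j by auto
  from resolution_bridge_family_3[OF this, where 'k = 'k] obtain A and c :: "'k scalar_mats"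
    where "set_resolution 3 (bridge_family 3 ?B) (list_ranks [1, 3, 2]) A c" by blast
  moreover obtain A' and c' :: "'k scalar_mats"
    where "set_resolution 3 (bridge_family 3 {1}) (list_ranks [1, 3, 2]) A' c'"
    using resolution_bridge_family_3[of "{1}", where 'k = 'k] by auto
  moreover have "{1} \<subseteq> {1..<3 - 1 :: nat}" by simp
  ultimately show ?thesis
    using path_like_short_cycle[OF cyc, of "{1}" "j + 2", unfolded len, where 'k = 'k] by blast
qed

text \<open>
  Either two neighbouring edges are blockends, or two neighbouring edges are bridges, or the two kinds alternate.
\<close>

lemma path_like_4_cycle:
  fixes C :: "'v::infinite wo_digraph"
  assumes cyc: "wo_cycle_on xs C" and len: "length xs = 4"
  shows "\<exists>P :: 'v wo_digraph. wo_path 4 P \<and> (\<forall>i. graph_betti TYPE('k::field) P i = graph_betti TYPE('k) C i)"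
proof -
  have ne: "xs \<noteq> []" using len by auto
  have period: "blockend C xs (j + 4) \<longleftrightarrow> blockend C xs j" for j using blockend_period[of C xs j] len by simp
  define B where "B k = {i. i < 4 \<and> \<not> blockend C (rotate k xs) i}" for k
  have mem: "i \<in> B (j + 3) \<longleftrightarrow> i < 4 \<and> \<not> blockend C xs (i + (j + 3))" for i j
    unfolding B_def blockend_rotate[OF ne] by simp
  have shift: "0 + (j + 3) = j + 3" "1 + (j + 3) = j + 4" "2 + (j + 3) = j + 1 + 4" for j :: nat by simp_all
  have sub: "B k \<subseteq> {..<4}" for k unfolding B_def by auto
  consider (ends) j where "blockend C xs j" "blockend C xs (j + 1)"
    | (bridges) j where "\<not> blockend C xs j" "\<not> blockend C xs (j + 1)"
    | (alternating) "\<And>j. blockend C xs (j + 1) \<longleftrightarrow> \<not> blockend C xs j" by blast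
  then show ?thesis
  proof cases
    case ends
    then show ?thesis using path_like_cycle[OF cyc, of j, where 'k = 'k] len by simp
  next
    case bridges
    then have "1 \<in> B (j + 3)" "2 \<in> B (j + 3)" unfolding mem shift period by auto
    from resolution_bridge_family_4_cycle[OF this sub, where 'k = 'k] obtain A and c :: "'k scalar_mats"
      where "set_resolution 4 (bridge_family 4 (B (j + 3))) (list_ranks [1, 4, 4, 1]) A c" by blast
    moreover obtain A' and c' :: "'k scalar_mats"
      where "set_resolution 4 (bridge_family 4 {1, 2}) (list_ranks [1, 4, 4, 1]) A' c'"
      using resolution_bridge_family_4_cycle[of "{1, 2}", where 'k = 'k] by auto
    moreover have "{1, 2} \<subseteq> {1..<4 - 1 :: nat}" by simp
    ultimately show ?thesis
      using path_like_short_cycle[OF cyc, of "{1, 2}" "j + 3", unfolded len, folded B_def, where 'k = 'k] by blast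
  next
    case alternating
    obtain j where j: "\<not> blockend C xs j" using alternating[of 0] by blast
    have "blockend C xs (j + 1)" using alternating[of j] j by simp
    moreover have "blockend C xs (j + 3)" using alternating[of "j + 3"] j period[of j] by (simp add: numeral_eq_Suc)
    ultimately have "1 \<in> B (j + 3)" "0 \<notin> B (j + 3)" "2 \<notin> B (j + 3)" using j unfolding mem shift period by auto
    from resolution_bridge_family_4_triangles[OF this sub, where 'k = 'k] obtain A and c :: "'k scalar_mats"
      where "set_resolution 4 (bridge_family 4 (B (j + 3))) (list_ranks [1, 4, 5, 2]) A c" by blast
    moreover obtain A' and c' :: "'k scalar_mats"
      where "set_resolution 4 (bridge_family 4 {1}) (list_ranks [1, 4, 5, 2]) A' c'"
      using resolution_bridge_family_4_triangles[of "{1}", where 'k = 'k] by auto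
    moreover have "{1} \<subseteq> {1..<4 - 1 :: nat}" by simp
    ultimately show ?thesis
      using path_like_short_cycle[OF cyc, of "{1}" "j + 3", unfolded len, folded B_def, where 'k = 'k] by blast
  qed
qed

section \<open>A cycle whose Betti numbers differ from those of all paths\<close>

text \<open>
  No edge of a path contains another one, so no generator divides another one.
\<close>

lemma path_betti_1:
  assumes "wo_path m P" shows "graph_betti TYPE('k::field) P 1 = m"
proof -
  obtain xs where xs: "distinct xs" "length xs = m + 1" and tr: "traced_by m (\<lambda>i. xs ! i) (\<lambda>i. xs ! (i + 1)) P"
    using wo_path_traced[OF assms] .
  let ?m = "\<lambda>i. edge_gen P (xs ! i) (xs ! (i + 1))"
  have keys: "keys (?m i) = {xs ! i, xs ! (i + 1)}" if "i < m" for i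
    using keys_edge_gen[OF tr that] .
  have dvd_keys: "keys s \<subseteq> keys t" if "mono_dvd s t" for s t :: "'a monomial"
  proof
    fix v assume "v \<in> keys s"
    moreover have "lookup s v \<le> lookup t v" using that unfolding mono_dvd_iff_le by blast
    ultimately show "v \<in> keys t" unfolding in_keys_iff by linarith
  qed
  have anti: "i = j" if "i < m" "j < m" "mono_dvd (?m i) (?m j)" for i j
    using dvd_keys[OF that(3)] xs that(1,2) unfolding keys[OF that(1)] keys[OF that(2)]
    by (auto simp: nth_eq_iff_index_eq)
  have "has_points m (range (dividing_gens m ?m))"
    unfolding has_points_def
  proof (intro conjI allI impI)
    show "range (dividing_gens m ?m) \<subseteq> Pow {..<m}" unfolding dividing_gens_def by auto
    have "\<not> mono_dvd (?m i) 0" if "i < m" for i using dvd_keys[of "?m i" 0] keys[OF that] by auto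
    then have "dividing_gens m ?m 0 = {}" unfolding dividing_gens_def by simp
    then show "{} \<in> range (dividing_gens m ?m)" by (intro image_eqI[of _ _ 0]) simp_all
    fix j assume j: "j < m"
    have "dividing_gens m ?m (?m j) = {j}"
    proof (rule antisym; rule subsetI)
      fix i assume "i \<in> dividing_gens m ?m (?m j)"
      then have "i < m" "mono_dvd (?m i) (?m j)" unfolding dividing_gens_def by simp_all
      then show "i \<in> {j}" using anti[OF _ j] by simp
    qed (use j in \<open>simp add: dividing_gens_def\<close>)
    then show "{j} \<in> range (dividing_gens m ?m)" by (intro image_eqI[of _ _ "?m j"]) simp_all
  qed
  from set_resolution_exists[OF this, where 'k = 'k] obtain b A and c :: "'k scalar_mats"
    where res: "set_resolution m (range (dividing_gens m ?m)) b A c" by blast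
  then have "b 1 = m" unfolding set_resolution_def by blast
  then show ?thesis using betti_computed_onD[OF betti_computed_on_dividing_gens[OF tr] res, of 1] by simp
qed

lemma betti_1_2_bridge_family:
  assumes "n \<ge> 5" "B \<subseteq> {..<n}" "betti_computed_on TYPE('k::field) n (bridge_family n B) D"
  shows "graph_betti TYPE('k) D 1 = n" "graph_betti TYPE('k) D 2 = card (essential_pairs n B)"
proof -
  obtain b A and c :: "'k scalar_mats" where
    res: "set_resolution n (bridge_family n B) b A c" and b: "b 1 = n" "b 2 = card (essential_pairs n B)"
    using resolution_essential_pairs[OF assms(1,2), where 'k = 'k] by blast
  show "graph_betti TYPE('k) D 1 = n" "graph_betti TYPE('k) D 2 = card (essential_pairs n B)"
    using betti_computed_onD[OF assms(3) res, of 1] betti_computed_onD[OF assms(3) res, of 2] b by simp_all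
qed

lemma cycle_unlike_paths:
  assumes n: "n \<ge> 5"
  shows "\<exists>C :: 'v::infinite wo_digraph. wo_cycle n C \<and>
    (\<forall>m (P :: 'v wo_digraph). wo_path m P \<longrightarrow> (\<exists>i::int. graph_betti TYPE('k::field) P i \<noteq> graph_betti TYPE('k) C i))"
proof -
  have n3: "n \<ge> 3" using n by simp
  obtain C :: "'v wo_digraph" where C: "wo_cycle n C" "betti_computed_on TYPE('k) n (bridge_family n {..<n}) C"
    using cycle_with_bridges[OF n3 order_refl] by blast
  have "\<exists>i::int. graph_betti TYPE('k) P i \<noteq> graph_betti TYPE('k) C i" if P: "wo_path m P" for m and P :: "'v wo_digraph"
  proof (cases "m = n")
    case False
    then show ?thesis
      using path_betti_1[OF P, where 'k = 'k] betti_1_2_bridge_family(1)[OF n order_refl C(2)] by (intro exI[of _ 1]) simp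
  next
    case True
    then obtain B where B: "B \<subseteq> {1..<n - 1}" "betti_computed_on TYPE('k) n (bridge_family n B) P"
      using path_bridges[OF P[unfolded True] n3, where 'k = 'k] by metis
    have B': "B \<subseteq> {..<n}" by (rule order_trans[OF B(1)]) auto
    have "0 \<notin> B" using B(1) by auto
    then have "graph_betti TYPE('k) C 2 < graph_betti TYPE('k) P 2"
      unfolding betti_1_2_bridge_family(2)[OF n order_refl C(2)] betti_1_2_bridge_family(2)[OF n B' B(2)]
      by (rule essential_pairs_all_less[OF n B'])
    then show ?thesis by (intro exI[of _ 2]) simp
  qed
  then show ?thesis using C(1) by blast
qed

section \<open>Betti numbers of weighted oriented paths and cycles\<close>

theorem theorem4p17:
  fixes n :: nat
  assumes "n \<ge> 3"
  shows
    "(\<forall>P :: 'v::infinite wo_digraph. wo_path n P \<longrightarrow>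
        (\<exists>C :: 'v wo_digraph. wo_cycle n C \<and>
          (\<forall>i::int. graph_betti TYPE('k::field) P i = graph_betti TYPE('k) C i)))
   \<and> (\<forall>(C :: 'v wo_digraph) xs. length xs = n \<and> wo_cycle_on xs C \<and>
          ((\<exists>B\<in>blocks C xs. card B = 2) \<or> n \<le> 4) \<longrightarrow>
        (\<exists>P :: 'v wo_digraph. wo_path n P \<and>
          (\<forall>i::int. graph_betti TYPE('k) P i = graph_betti TYPE('k) C i)))
   \<and> (n \<ge> 5 \<longrightarrow>
        (\<exists>C :: 'v wo_digraph. wo_cycle n C \<and>
          (\<forall>m (P :: 'v wo_digraph). wo_path m P \<longrightarrow>
            (\<exists>i::int. graph_betti TYPE('k) P i \<noteq> graph_betti TYPE('k) C i))))"
proof (intro conjI allI impI)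
  fix P :: "'v wo_digraph" assume P: "wo_path n P"
  obtain B where B: "B \<subseteq> {1..<n - 1}" "betti_computed_on TYPE('k) n (bridge_family n B) P"
    using path_bridges[OF P assms, where 'k = 'k] .
  have B': "B \<subseteq> {..<n}" by (rule order_trans[OF B(1)]) auto
  obtain C :: "'v wo_digraph" where C: "wo_cycle n C" "betti_computed_on TYPE('k) n (bridge_family n B) C"
    using cycle_with_bridges[OF assms B'] by blast
  show "\<exists>C :: 'v wo_digraph. wo_cycle n C \<and> (\<forall>i::int. graph_betti TYPE('k) P i = graph_betti TYPE('k) C i)"
    using C(1) betti_eq_if_same_bridges[OF assms B' B(2) C(2)] by blast
next
  fix C :: "'v wo_digraph" and xs
  assume *: "length xs = n \<and> wo_cycle_on xs C \<and> ((\<exists>B\<in>blocks C xs. card B = 2) \<or> n \<le> 4)"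
  then have len: "length xs = n" and cyc: "wo_cycle_on xs C" by auto
  show "\<exists>P :: 'v wo_digraph. wo_path n P \<and> (\<forall>i::int. graph_betti TYPE('k) P i = graph_betti TYPE('k) C i)"
  proof (cases "\<exists>B\<in>blocks C xs. card B = 2")
    case True
    then obtain i where "blockend C xs i" "blockend C xs (i + 1)"
      using adjacent_blockends_of_block[OF cyc] by blast
    then show ?thesis using path_like_cycle[OF cyc, where 'k = 'k] len by blast
  next
    case False
    then consider "n = 3" | "n = 4" using * assms by linarith
    then show ?thesis
    proof cases
      case 1
      show ?thesis
      proof (cases "blockend C xs 0 \<and> blockend C xs 1")
        case True
        then show ?thesis using path_like_cycle[OF cyc, of 0, where 'k = 'k] len by simp
      next
        case False
        then obtain j where j: "\<not> blockend C xs j" by blast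
        show ?thesis using path_like_3_cycle[OF cyc _ j, where 'k = 'k] len 1 by simp
      qed
    next
      case 2
      then show ?thesis using path_like_4_cycle[OF cyc, where 'k = 'k] len by simp
    qed
  qed
next
  assume "n \<ge> 5"
  then show "\<exists>C :: 'v wo_digraph. wo_cycle n C \<and>
    (\<forall>m (P :: 'v wo_digraph). wo_path m P \<longrightarrow> (\<exists>i::int. graph_betti TYPE('k) P i \<noteq> graph_betti TYPE('k) C i))"
    by (rule cycle_unlike_paths)
qed

end
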